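(* Let $n\ge1$. Every proper $(2n+1)$-dimensional flat affine hypersphere in $\mathbb{R}^{2n+2}$ is, after a suitable affine transformation, either $\widetilde{J}$-tangent or $J$-tangent. Moreover, when $n$ is odd, the hypersurface $$(x_1^2+x_2^2)(x_3^2+x_4^2)\cdots(x_{2n+1}^2+x_{2n+2}^2)=1$$ is both $\widetilde{J}$-tangent and $J$-tangent (each after a suitable affine transformation).
   Context: $\widetilde{J}$ and $J$ are the standard para-complex and complex structures on $\mathbb{R}^{2n+2}$: $\widetilde{J}(x_1,\ldots,x_{n+1},y_1,\ldots,y_{n+1})=(y_1,\ldots,y_{n+1},x_1,\ldots,x_{n+1})$ and $J(x_1,\ldots,x_{n+1},y_1,\ldots,y_{n+1})=(-y_1,\ldots,-y_{n+1},x_1,\ldots,x_{n+1})$. "Either ... or" is inclusive, and the statement is understood locally. For an immersion $f\colon M^{N}\to\mathbb{R}^{N+1}$ ($M$ connected, orientable) with transversal field $C$, the objects $\nabla,h,S,\tau$ are defined by $\mathrm{D}_Xf_*Y=f_*(\nabla_XY)+h(X,Y)C$, $\mathrm{D}_XC=-f_*(SX)+\tau(X)C$, with $\mathrm{D}$ the flat connection. $f$ is nondegenerate if $h$ is. For nondegenerate $f$ the affine normal (Blaschke) field is the transversal field $C$, unique up to sign, such that the metric volume form $\omega_h(X_1,\ldots,X_N)=|\det[h(X_i,X_j)]|^{1/2}$ (bases positively oriented with respect to $\Theta$) is $\nabla$-parallel and equals $\Theta(X_1,\ldots,X_N)=\det[f_*X_1,\ldots,f_*X_N,C]$; then $h$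 is the affine (Blaschke) metric. With this $C$, $f$ is an affine hypersphere if $S=\lambda I$, $\lambda$ constant (proper if $\lambda\ne0$); it is flat if the affine metric $h$ is flat (zero sectional curvature). An affine hypersphere in $\mathbb{R}^{2n+2}$ is $\widetilde{J}$-tangent (resp. $J$-tangent) if its Blaschke field satisfies $\widetilde{J}C_x\in f_*(T_xM)$ (resp. $JC_x\in f_*(T_xM)$) for all $x\in M$. *)

theory Defs
  imports "HOL-Analysis.Analysis"
begin

section \<open>Smooth maps, vector fields and affine transformations\<close>

fun Ck_on :: "nat \<Rightarrow> 'a::euclidean_space set \<Rightarrow> ('a \<Rightarrow> 'b::euclidean_space) \<Rightarrow> bool" where
  "Ck_on 0 U f \<longleftrightarrow> continuous_on U f"
| "Ck_on (Suc k) U f \<longleftrightarrow> (\<forall>x\<in>U. f differentiable (at x)) \<and>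
     (\<forall>v. Ck_on k U (\<lambda>x. frechet_derivative f (at x) v))"

text \<open>Only meant for open \<open>U\<close>: the derivatives are taken in the full space.\<close>
definition smooth_on :: "'a::euclidean_space set \<Rightarrow> ('a \<Rightarrow> 'b::euclidean_space) \<Rightarrow> bool" where
  "smooth_on U f \<longleftrightarrow> (\<forall>k. Ck_on k U f)"

text \<open>Vector fields are functions on the whole space of which only the values on an open set
  matter. \<open>dder X W\<close> is the derivative of \<open>W\<close> along \<open>X\<close>: the flat connection \<open>D\<close> if \<open>W\<close> is
  vector valued, and \<open>X(W)\<close> if \<open>W\<close> is a scalar function.\<close>
definition dder :: "('a::euclidean_space \<Rightarrow> 'a) \<Rightarrow> ('a \<Rightarrow> 'b::euclidean_space) \<Rightarrow> 'a \<Rightarrow> 'b" where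
  "dder X W p = frechet_derivative W (at p) (X p)"

definition lie :: "('a::euclidean_space \<Rightarrow> 'a) \<Rightarrow> ('a \<Rightarrow> 'a) \<Rightarrow> 'a \<Rightarrow> 'a" where
  "lie X Y p = dder X Y p - dder Y X p"

definition affine_transformation :: "('a::real_vector \<Rightarrow> 'a) \<Rightarrow> bool" where
  "affine_transformation A \<longleftrightarrow> (\<exists>L b. linear L \<and> bij L \<and> A = (\<lambda>x. L x + b))"

section \<open>Flat pseudo-Riemannian metrics\<close>

text \<open>A metric \<open>g\<close> is given by its action \<open>g X Y p\<close> on vector fields. By the Koszul formula the
  conditions below determine \<open>N X Y\<close> on \<open>U\<close> when \<open>g\<close> is a nondegenerate metric.\<close>
definition levi_civita ::
  "'a::euclidean_space set \<Rightarrow> (('a \<Rightarrow> 'a) \<Rightarrow> ('a \<Rightarrow> 'a) \<Rightarrow> 'a \<Rightarrow> real)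
    \<Rightarrow> (('a \<Rightarrow> 'a) \<Rightarrow> ('a \<Rightarrow> 'a) \<Rightarrow> 'a \<Rightarrow> 'a) \<Rightarrow> bool" where
  "levi_civita U g N \<longleftrightarrow>
    (\<forall>X Y. smooth_on U X \<longrightarrow> smooth_on U Y \<longrightarrow> smooth_on U (N X Y)) \<and>
    (\<forall>X X' Y. smooth_on U X \<longrightarrow> smooth_on U X' \<longrightarrow> smooth_on U Y \<longrightarrow>
       (\<forall>p\<in>U. N (\<lambda>q. X q + X' q) Y p = N X Y p + N X' Y p)) \<and>
    (\<forall>\<phi> X Y. smooth_on U \<phi> \<longrightarrow> smooth_on U X \<longrightarrow> smooth_on U Y \<longrightarrow>
       (\<forall>p\<in>U. N (\<lambda>q. \<phi> q *\<^sub>R X q) Y p = \<phi> p *\<^sub>R N X Y p)) \<and>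
    (\<forall>X Y Y'. smooth_on U X \<longrightarrow> smooth_on U Y \<longrightarrow> smooth_on U Y' \<longrightarrow>
       (\<forall>p\<in>U. N X (\<lambda>q. Y q + Y' q) p = N X Y p + N X Y' p)) \<and>
    (\<forall>\<phi> X Y. smooth_on U \<phi> \<longrightarrow> smooth_on U X \<longrightarrow> smooth_on U Y \<longrightarrow>
       (\<forall>p\<in>U. N X (\<lambda>q. \<phi> q *\<^sub>R Y q) p = dder X \<phi> p *\<^sub>R Y p + \<phi> p *\<^sub>R N X Y p)) \<and>
    (\<forall>X Y. smooth_on U X \<longrightarrow> smooth_on U Y \<longrightarrow>
       (\<forall>p\<in>U. N X Y p - N Y X p = lie X Y p)) \<and>
    (\<forall>X Y Z. smooth_on U X \<longrightarrow> smooth_on U Y \<longrightarrow> smooth_on U Z \<longrightarrow>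
       (\<forall>p\<in>U. dder X (g Y Z) p = g (N X Y) Z p + g Y (N X Z) p))"

definition curvature ::
  "(('a::euclidean_space \<Rightarrow> 'a) \<Rightarrow> ('a \<Rightarrow> 'a) \<Rightarrow> 'a \<Rightarrow> 'a)
    \<Rightarrow> ('a \<Rightarrow> 'a) \<Rightarrow> ('a \<Rightarrow> 'a) \<Rightarrow> ('a \<Rightarrow> 'a) \<Rightarrow> 'a \<Rightarrow> 'a" where
  "curvature N X Y Z p = N X (N Y Z) p - N Y (N X Z) p - N (lie X Y) Z p"

definition plane_gram ::
  "(('a \<Rightarrow> 'a) \<Rightarrow> ('a \<Rightarrow> 'a) \<Rightarrow> 'a \<Rightarrow> real) \<Rightarrow> ('a \<Rightarrow> 'a) \<Rightarrow> ('a \<Rightarrow> 'a) \<Rightarrow> 'a \<Rightarrow> real" where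
  "plane_gram g X Y p = g X X p * g Y Y p - (g X Y p)\<^sup>2"

definition sectional_curvature ::
  "(('a::euclidean_space \<Rightarrow> 'a) \<Rightarrow> ('a \<Rightarrow> 'a) \<Rightarrow> 'a \<Rightarrow> real)
    \<Rightarrow> (('a \<Rightarrow> 'a) \<Rightarrow> ('a \<Rightarrow> 'a) \<Rightarrow> 'a \<Rightarrow> 'a) \<Rightarrow> ('a \<Rightarrow> 'a) \<Rightarrow> ('a \<Rightarrow> 'a) \<Rightarrow> 'a \<Rightarrow> real" where
  "sectional_curvature g N X Y p = g (curvature N X Y Y) X p / plane_gram g X Y p"

text \<open>As \<open>g\<close> may be indefinite, sectional curvature exists only for nondegenerate planes.\<close>
definition flat_metric ::
  "'a::euclidean_space set \<Rightarrow> (('a \<Rightarrow> 'a) \<Rightarrow> ('a \<Rightarrow> 'a) \<Rightarrow> 'a \<Rightarrow> real) \<Rightarrow> bool" where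
  "flat_metric U g \<longleftrightarrow> (\<exists>N. levi_civita U g N \<and>
     (\<forall>X Y. smooth_on U X \<longrightarrow> smooth_on U Y \<longrightarrow>
        (\<forall>p\<in>U. plane_gram g X Y p \<noteq> 0 \<longrightarrow> sectional_curvature g N X Y p = 0)))"

section \<open>Affine hypersurfaces\<close>

text \<open>For \<open>N = CARD('m)\<close> the domain of an immersion is an open connected subset of
  \<open>real ^ 'm\<close> (a coordinate chart), and \<open>real ^ ('m option)\<close> is the ambient
  space of dimension \<open>N + 1\<close>.\<close>

definition push ::
  "(real ^ 'm \<Rightarrow> real ^ ('m option)) \<Rightarrow> (real ^ 'm \<Rightarrow> real ^ 'm) \<Rightarrow> real ^ 'm \<Rightarrow> real ^ ('m option)"
  where "push f X p = frechet_derivative f (at p) (X p)"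

definition tangent_space ::
  "(real ^ 'm \<Rightarrow> real ^ ('m option)) \<Rightarrow> real ^ 'm \<Rightarrow> (real ^ ('m option)) set" where
  "tangent_space f p = range (frechet_derivative f (at p))"

definition immersion_on :: "(real ^ 'm) set \<Rightarrow> (real ^ 'm \<Rightarrow> real ^ ('m option)) \<Rightarrow> bool" where
  "immersion_on U f \<longleftrightarrow> open U \<and> connected U \<and> U \<noteq> {} \<and> smooth_on U f \<and>
     (\<forall>p\<in>U. inj (frechet_derivative f (at p)))"

definition transversal_on ::
  "(real ^ 'm) set \<Rightarrow> (real ^ 'm \<Rightarrow> real ^ ('m option)) \<Rightarrow> (real ^ 'm \<Rightarrow> real ^ ('m option)) \<Rightarrow> bool"
  where "transversal_on U f C \<longleftrightarrow> smooth_on U C \<and> (\<forall>p\<in>U. C p \<notin> tangent_space f p)"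

text \<open>Components of \<open>w\<close> in the direct sum of the tangent space at \<open>p\<close> and the line spanned
  by \<open>C p\<close>.\<close>
definition tangential_part ::
  "(real ^ 'm \<Rightarrow> real ^ ('m option)) \<Rightarrow> (real ^ 'm \<Rightarrow> real ^ ('m option)) \<Rightarrow> real ^ 'm
    \<Rightarrow> real ^ ('m option) \<Rightarrow> real ^ 'm" where
  "tangential_part f C p w = (THE v. \<exists>a. w = frechet_derivative f (at p) v + a *\<^sub>R C p)"

definition transversal_part ::
  "(real ^ 'm \<Rightarrow> real ^ ('m option)) \<Rightarrow> (real ^ 'm \<Rightarrow> real ^ ('m option)) \<Rightarrow> real ^ 'm
    \<Rightarrow> real ^ ('m option) \<Rightarrow> real" where
  "transversal_part f C p w = (THE a. \<exists>v. w = frechet_derivative f (at p) v + a *\<^sub>R C p)"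

definition induced_connection ::
  "(real ^ 'm \<Rightarrow> real ^ ('m option)) \<Rightarrow> (real ^ 'm \<Rightarrow> real ^ ('m option))
    \<Rightarrow> (real ^ 'm \<Rightarrow> real ^ 'm) \<Rightarrow> (real ^ 'm \<Rightarrow> real ^ 'm) \<Rightarrow> real ^ 'm \<Rightarrow> real ^ 'm" where
  "induced_connection f C X Y p = tangential_part f C p (dder X (push f Y) p)"

definition affine_metric ::
  "(real ^ 'm \<Rightarrow> real ^ ('m option)) \<Rightarrow> (real ^ 'm \<Rightarrow> real ^ ('m option))
    \<Rightarrow> (real ^ 'm \<Rightarrow> real ^ 'm) \<Rightarrow> (real ^ 'm \<Rightarrow> real ^ 'm) \<Rightarrow> real ^ 'm \<Rightarrow> real" where
  "affine_metric f C X Y p = transversal_part f C p (dder X (push f Y) p)"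

definition shape_operator ::
  "(real ^ 'm \<Rightarrow> real ^ ('m option)) \<Rightarrow> (real ^ 'm \<Rightarrow> real ^ ('m option))
    \<Rightarrow> (real ^ 'm \<Rightarrow> real ^ 'm) \<Rightarrow> real ^ 'm \<Rightarrow> real ^ 'm" where
  "shape_operator f C X p = - tangential_part f C p (dder X C p)"

definition nondegenerate_on ::
  "(real ^ 'm) set \<Rightarrow> (real ^ 'm \<Rightarrow> real ^ ('m option)) \<Rightarrow> (real ^ 'm \<Rightarrow> real ^ ('m option)) \<Rightarrow> bool"
  where "nondegenerate_on U f C \<longleftrightarrow>
    (\<forall>p\<in>U. \<forall>u. (\<forall>v. affine_metric f C (\<lambda>_. u) (\<lambda>_. v) p = 0) \<longrightarrow> u = 0)"

text \<open>Rows instead of columns; the row indexed by \<open>None\<close> is the transversal field. The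
  overall sign convention of the determinant is irrelevant below, since it also
  determines which bases are positively oriented.\<close>
definition Theta ::
  "(real ^ 'm \<Rightarrow> real ^ ('m::finite option)) \<Rightarrow> (real ^ 'm \<Rightarrow> real ^ ('m option))
    \<Rightarrow> ('m \<Rightarrow> real ^ 'm \<Rightarrow> real ^ 'm) \<Rightarrow> real ^ 'm \<Rightarrow> real" where
  "Theta f C X p = det (\<chi> i. case i of None \<Rightarrow> C p | Some j \<Rightarrow> push f (X j) p)"

text \<open>The factor \<open>sgn (Theta f C X p)\<close> is 1 on positively oriented bases and extends
  \<open>\<omega>\<^sub>h\<close> to an alternating form.\<close>
definition metric_volume ::
  "(real ^ 'm \<Rightarrow> real ^ ('m::finite option)) \<Rightarrow> (real ^ 'm \<Rightarrow> real ^ ('m option))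
    \<Rightarrow> ('m \<Rightarrow> real ^ 'm \<Rightarrow> real ^ 'm) \<Rightarrow> real ^ 'm \<Rightarrow> real" where
  "metric_volume f C X p =
     sgn (Theta f C X p) * sqrt \<bar>det (\<chi> i j. affine_metric f C (X i) (X j) p)\<bar>"

definition parallel_form ::
  "(real ^ 'm) set \<Rightarrow> ((real ^ 'm \<Rightarrow> real ^ 'm) \<Rightarrow> (real ^ 'm \<Rightarrow> real ^ 'm) \<Rightarrow> real ^ 'm \<Rightarrow> real ^ 'm)
    \<Rightarrow> (('m::finite \<Rightarrow> real ^ 'm \<Rightarrow> real ^ 'm) \<Rightarrow> real ^ 'm \<Rightarrow> real) \<Rightarrow> bool" where
  "parallel_form U N \<omega> \<longleftrightarrow>
    (\<forall>Z X. smooth_on U Z \<longrightarrow> (\<forall>i. smooth_on U (X i)) \<longrightarrow>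
      (\<forall>p\<in>U. dder Z (\<omega> X) p - (\<Sum>i\<in>UNIV. \<omega> (X(i := N Z (X i))) p) = 0))"

definition blaschke_field ::
  "(real ^ 'm) set \<Rightarrow> (real ^ 'm \<Rightarrow> real ^ ('m::finite option))
    \<Rightarrow> (real ^ 'm \<Rightarrow> real ^ ('m option)) \<Rightarrow> bool" where
  "blaschke_field U f C \<longleftrightarrow> transversal_on U f C \<and> nondegenerate_on U f C \<and>
     parallel_form U (induced_connection f C) (metric_volume f C) \<and>
     (\<forall>X. (\<forall>i. smooth_on U (X i)) \<longrightarrow> (\<forall>p\<in>U. metric_volume f C X p = Theta f C X p))"

definition affine_hypersphere_with ::
  "(real ^ 'm) set \<Rightarrow> (real ^ 'm \<Rightarrow> real ^ ('m::finite option))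
    \<Rightarrow> (real ^ 'm \<Rightarrow> real ^ ('m option)) \<Rightarrow> real \<Rightarrow> bool" where
  "affine_hypersphere_with U f C \<kappa> \<longleftrightarrow> immersion_on U f \<and> blaschke_field U f C \<and>
     (\<forall>X. smooth_on U X \<longrightarrow> (\<forall>p\<in>U. shape_operator f C X p = \<kappa> *\<^sub>R X p))"

definition proper_flat_affine_hypersphere ::
  "(real ^ 'm) set \<Rightarrow> (real ^ 'm \<Rightarrow> real ^ ('m::finite option)) \<Rightarrow> bool" where
  "proper_flat_affine_hypersphere U f \<longleftrightarrow>
     (\<exists>C \<kappa>. affine_hypersphere_with U f C \<kappa> \<and> \<kappa> \<noteq> 0 \<and> flat_metric U (affine_metric f C))"

text \<open>The first argument is the linear structure: \<open>para_complex_structure\<close> or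
  \<open>complex_structure\<close> below.\<close>
definition structure_tangent ::
  "(real ^ ('m option) \<Rightarrow> real ^ ('m option)) \<Rightarrow> (real ^ 'm) set
    \<Rightarrow> (real ^ 'm \<Rightarrow> real ^ ('m::finite option)) \<Rightarrow> bool" where
  "structure_tangent J U f \<longleftrightarrow>
     (\<exists>C \<kappa>. affine_hypersphere_with U f C \<kappa> \<and> (\<forall>p\<in>U. J (C p) \<in> tangent_space f p))"

text \<open>Embedded hypersurfaces given as point sets, treated through all their smooth local
  parametrizations.\<close>
definition local_parametrization ::
  "(real ^ ('m option)) set \<Rightarrow> (real ^ 'm) set \<Rightarrow> (real ^ 'm \<Rightarrow> real ^ ('m::finite option)) \<Rightarrow> bool"
  where "local_parametrization H U f \<longleftrightarrow> immersion_on U f \<and>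
     openin (top_of_set H) (f ` U) \<and> (\<exists>g. homeomorphism U (f ` U) f g)"

definition structure_tangent_hypersurface ::
  "(real ^ ('m option) \<Rightarrow> real ^ ('m option)) \<Rightarrow> (real ^ ('m::finite option)) set \<Rightarrow> bool" where
  "structure_tangent_hypersurface J H \<longleftrightarrow> H \<noteq> {} \<and>
     (\<forall>x\<in>H. \<exists>U f. local_parametrization H U f \<and> x \<in> f ` U) \<and>
     (\<forall>U f. local_parametrization H U f \<longrightarrow> structure_tangent J U f)"

section \<open>The standard structures\<close>

text \<open>A bijection \<open>e\<close> from \<open>{1..2n+2}\<close> to the index type numbers the coordinates, so that
  \<open>x $ e 1, ..., x $ e (2n+2)\<close> are the standard coordinates of \<open>x\<close>; in the notation
  \<open>(x\<^sub>1,...,x\<^sub>n\<^sub>+\<^sub>1,y\<^sub>1,...,y\<^sub>n\<^sub>+\<^sub>1)\<close> the last \<open>n+1\<close> of them are the \<open>y\<^sub>i\<close>.\<close>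

definition para_complex_structure :: "nat \<Rightarrow> (nat \<Rightarrow> 'd) \<Rightarrow> real ^ 'd \<Rightarrow> real ^ 'd" where
  "para_complex_structure n e x = (\<chi> s. let k = the_inv_into {1..2*n+2} e s in
     if k \<le> n + 1 then x $ e (n + 1 + k) else x $ e (k - (n + 1)))"

definition complex_structure :: "nat \<Rightarrow> (nat \<Rightarrow> 'd) \<Rightarrow> real ^ 'd \<Rightarrow> real ^ 'd" where
  "complex_structure n e x = (\<chi> s. let k = the_inv_into {1..2*n+2} e s in
     if k \<le> n + 1 then - (x $ e (n + 1 + k)) else x $ e (k - (n + 1)))"

lemma para_complex_structure_nth:
  fixes e :: "nat \<Rightarrow> 'd::finite"
  assumes "bij_betw e {1..2*n+2} UNIV" "i \<in> {1..n+1}"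
  shows "para_complex_structure n e x $ e i = x $ e (n + 1 + i)"
    and "para_complex_structure n e x $ e (n + 1 + i) = x $ e i"
proof -
  have *: "the_inv_into {1..2*n+2} e (e k) = k" if "k \<in> {1..2*n+2}" for k
    using assms(1) that by (auto simp: bij_betw_def intro!: the_inv_into_f_f)
  show "para_complex_structure n e x $ e i = x $ e (n + 1 + i)"
    and "para_complex_structure n e x $ e (n + 1 + i) = x $ e i"
    using assms(2) *[of i] *[of "n + 1 + i"] by (auto simp: para_complex_structure_def Let_def)
qed

lemma complex_structure_nth:
  fixes e :: "nat \<Rightarrow> 'd::finite"
  assumes "bij_betw e {1..2*n+2} UNIV" "i \<in> {1..n+1}"
  shows "complex_structure n e x $ e i = - (x $ e (n + 1 + i))"
    and "complex_structure n e x $ e (n + 1 + i) = x $ e i"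
proof -
  have *: "the_inv_into {1..2*n+2} e (e k) = k" if "k \<in> {1..2*n+2}" for k
    using assms(1) that by (auto simp: bij_betw_def intro!: the_inv_into_f_f)
  show "complex_structure n e x $ e i = - (x $ e (n + 1 + i))"
    and "complex_structure n e x $ e (n + 1 + i) = x $ e i"
    using assms(2) *[of i] *[of "n + 1 + i"] by (auto simp: complex_structure_def Let_def)
qed

definition circle_product_hypersurface :: "nat \<Rightarrow> (nat \<Rightarrow> 'd) \<Rightarrow> (real ^ 'd) set" where
  "circle_product_hypersurface n e =
     {x. (\<Prod>i=1..n+1. (x $ e (2*i - 1))\<^sup>2 + (x $ e (2*i))\<^sup>2) = 1}"

end

theory Submission
  imports Defs "HOL-Computational_Algebra.Fundamental_Theorem_Algebra"
begin

text \<open>For a proper affine sphere the Blaschke field \<open>C\<close> is a multiple of the position vector \<open>E\<close>,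
  after a translation. The difference of the induced connection and the Levi-Civita connection of
  \<open>h\<close>, extended by \<open>E\<close> as a unit, is a commutative product on the ambient space, invariant under
  an extension of \<open>h\<close>. Flatness of \<open>h\<close> makes it associative, the Codazzi equation makes its
  covariant derivative totally symmetric, and the trace condition on the Blaschke field gives that
  the algebra is reduced and the product is parallel. Hence the algebra of multiplications is a
  locally constant subspace of endomorphisms of the ambient space, isomorphic to a product of
  copies of the reals and the complex numbers. Every multiplication by an element orthogonal to
  the unit maps the position vector into the tangent space. In even dimension the algebra contains
  such an element \<open>j\<close> with \<open>j\<^sup>2 = 1\<close> and both eigenspaces of the same dimension, or with
  \<open>j\<^sup>2 = -1\<close>, and multiplication by \<open>j\<close> is conjugate to one of the standard structures.

  For the product of circles, the algebra is a power of the complex numbers, which for odd \<open>n\<close>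
  (an even number of factors) contains both kinds of elements.\<close>

section \<open>Calculus of smooth maps\<close>

text \<open>The trace condition (apolarity of the difference tensor) acts twice. Multiplications by
  elements orthogonal to the unit are trace-free, so the trace form of the algebra is the dimension
  times the invariant form, hence nondegenerate; an element of square zero is orthogonal to
  everything for it, so it is zero. For the covariant derivative of the product, the Codazzi
  equation makes a trilinear trace symmetric in its first two slots, while the Leibniz rule and the
  trace condition make it skew in the last two; such a form vanishes, and the nondegenerate trace
  form turns this into parallelism. The metric may be indefinite, so flatness is a condition on
  nondegenerate planes only; these are dense, and the resulting identity extends to all planes
  before it is polarized. Orthogonality of \<open>j\<close> to the unit need not be arranged: the
  standard structures have trace zero, and the trace is invariant under conjugation. The conjugating
  maps are rescaled to determinant of absolute value 1, since the Blaschke normalization fixes the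
  length of \<open>C\<close> through a volume.\<close>

lemma frechet_derivative_eqI:
  "(f has_derivative f') (at x) \<Longrightarrow> frechet_derivative f (at x) v = f' v"
  by (simp add: frechet_derivative_at[symmetric])

lemma has_frechet_derivative:
  "f differentiable at x \<Longrightarrow> (f has_derivative frechet_derivative f (at x)) (at x)"
  using frechet_derivative_works by blast

lemma frechet_derivative_cong_open:
  assumes "open U" "x \<in> U" "\<And>y. y \<in> U \<Longrightarrow> f y = g y"
  shows "frechet_derivative f (at x) = frechet_derivative g (at x)"
proof -
  have "(f has_derivative f') (at x) \<longleftrightarrow> (g has_derivative f') (at x)" for f'
    by (metis (full_types) assms has_derivative_transform_within_open)
  then show ?thesis by (simp add: frechet_derivative_def)
qed

lemma differentiable_cong_open:
  assumes "open U" "x \<in> U" "\<And>y. y \<in> U \<Longrightarrow> f y = g y"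
  shows "f differentiable at x \<longleftrightarrow> g differentiable at x"
  by (metis (full_types) assms differentiable_def has_derivative_transform_within_open)

lemma Ck_on_cong:
  assumes "open U" "\<And>y. y \<in> U \<Longrightarrow> f y = g y"
  shows "Ck_on k U f \<longleftrightarrow> Ck_on k U g"
  using assms(2)
proof (induction k arbitrary: f g)
  case 0
  then show ?case by (simp cong: continuous_on_cong)
next
  case (Suc k)
  have "Ck_on k U (\<lambda>x. frechet_derivative f (at x) v) \<longleftrightarrow> Ck_on k U (\<lambda>x. frechet_derivative g (at x) v)" for v
    by (rule Suc.IH) (use frechet_derivative_cong_open[OF assms(1)] Suc.prems in metis)
  moreover have "(\<forall>x\<in>U. f differentiable at x) \<longleftrightarrow> (\<forall>x\<in>U. g differentiable at x)"
    using differentiable_cong_open[OF assms(1)] Suc.prems by metis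
  ultimately show ?case by simp
qed

lemma Ck_on_Suc_imp:
  "Ck_on (Suc k) U f \<Longrightarrow> Ck_on k U f"
proof (induction k arbitrary: f)
  case 0
  then show ?case
    by (auto intro!: continuous_at_imp_continuous_on differentiable_imp_continuous_within)
next
  case (Suc k)
  show ?case using Suc.prems Suc.IH unfolding Ck_on.simps(2)[of "Suc k"] Ck_on.simps(2)[of k] by blast
qed

lemma Ck_on_subset: "Ck_on k U f \<Longrightarrow> V \<subseteq> U \<Longrightarrow> Ck_on k V f"
  by (induction k arbitrary: f) (auto intro: continuous_on_subset)

lemma Ck_on_const: "Ck_on k U (\<lambda>x. c)"
  by (induction k arbitrary: c) auto

lemma Ck_on_add:
  assumes "open U" "Ck_on k U f" "Ck_on k U g"
  shows "Ck_on k U (\<lambda>x. f x + g x)"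
  using assms(2,3)
proof (induction k arbitrary: f g)
  case 0 then show ?case by (auto intro: continuous_intros)
next
  case (Suc k)
  have "Ck_on k U (\<lambda>x. frechet_derivative (\<lambda>x. f x + g x) (at x) v) \<longleftrightarrow>
    Ck_on k U (\<lambda>x. frechet_derivative f (at x) v + frechet_derivative g (at x) v)" for v
    by (rule Ck_on_cong[OF assms(1)], rule frechet_derivative_eqI, rule has_derivative_add;
        rule has_frechet_derivative) (use Suc.prems in auto)
  then show ?case using Suc by auto
qed

lemma Ck_on_linear:
  assumes "open U" "bounded_linear L" "Ck_on k U f"
  shows "Ck_on k U (\<lambda>x. L (f x))"
  using assms(3)
proof (induction k arbitrary: f)
  case 0 then show ?case using bounded_linear.continuous_on[OF assms(2)] by auto
next
  case (Suc k)
  have der: "((\<lambda>x. L (f x)) has_derivative (\<lambda>v. L (frechet_derivative f (at x) v))) (at x)" if "x \<in> U" for x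
    by (rule bounded_linear.has_derivative[OF assms(2)]) (use Suc.prems that has_frechet_derivative in auto)
  have "Ck_on k U (\<lambda>x. frechet_derivative (\<lambda>x. L (f x)) (at x) v) \<longleftrightarrow>
    Ck_on k U (\<lambda>x. L (frechet_derivative f (at x) v))" for v
    by (rule Ck_on_cong[OF assms(1)]) (rule frechet_derivative_eqI[OF der])
  then show ?case using Suc der by (auto simp: differentiable_def)
qed

lemma Ck_on_bilinear:
  assumes "open U" "bounded_bilinear B" "Ck_on k U f" "Ck_on k U g"
  shows "Ck_on k U (\<lambda>x. B (f x) (g x))"
  using assms(3,4)
proof (induction k arbitrary: f g)
  case 0 then show ?case using bounded_bilinear.continuous_on[OF assms(2)] by auto
next
  case (Suc k)
  have der: "((\<lambda>x. B (f x) (g x)) has_derivative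
      (\<lambda>v. B (f x) (frechet_derivative g (at x) v) + B (frechet_derivative f (at x) v) (g x))) (at x)" if "x \<in> U" for x
    by (rule bounded_bilinear.FDERIV[OF assms(2)]; rule has_frechet_derivative) (use Suc.prems that in simp_all)
  have "Ck_on k U (\<lambda>x. frechet_derivative (\<lambda>x. B (f x) (g x)) (at x) v) \<longleftrightarrow>
    Ck_on k U (\<lambda>x. B (f x) (frechet_derivative g (at x) v) + B (frechet_derivative f (at x) v) (g x))" for v
    by (rule Ck_on_cong[OF assms(1)]) (rule frechet_derivative_eqI[OF der])
  moreover have "Ck_on k U (\<lambda>x. B (f x) (frechet_derivative g (at x) v) + B (frechet_derivative f (at x) v) (g x))" for v
    by (rule Ck_on_add[OF assms(1)]; rule Suc.IH; use Suc.prems Ck_on_Suc_imp in auto)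
  ultimately show ?case using der by (auto simp: differentiable_def)
qed

lemma smooth_on_Ck: "smooth_on U f \<Longrightarrow> Ck_on k U f"
  by (simp add: smooth_on_def)

lemma smooth_on_differentiable: "smooth_on U f \<Longrightarrow> x \<in> U \<Longrightarrow> f differentiable at x"
  using smooth_on_Ck[of U f 1] by auto

lemma smooth_on_has_derivative:
  "smooth_on U f \<Longrightarrow> x \<in> U \<Longrightarrow> (f has_derivative frechet_derivative f (at x)) (at x)"
  using smooth_on_differentiable has_frechet_derivative by blast

lemma smooth_on_continuous: "smooth_on U f \<Longrightarrow> continuous_on U f"
  using smooth_on_Ck[of U f 0] by simp

lemma smooth_on_frechet_derivative:
  "smooth_on U f \<Longrightarrow> smooth_on U (\<lambda>x. frechet_derivative f (at x) v)"
  unfolding smooth_on_def by (metis Ck_on.simps(2))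

lemma smooth_on_cong:
  "open U \<Longrightarrow> (\<And>y. y \<in> U \<Longrightarrow> f y = g y) \<Longrightarrow> smooth_on U f \<longleftrightarrow> smooth_on U g"
  unfolding smooth_on_def using Ck_on_cong by blast

lemma smooth_on_subset: "smooth_on U f \<Longrightarrow> V \<subseteq> U \<Longrightarrow> smooth_on V f"
  unfolding smooth_on_def using Ck_on_subset by blast

lemma smooth_on_const: "smooth_on U (\<lambda>x. c)"
  unfolding smooth_on_def using Ck_on_const by blast

lemma smooth_on_add:
  "open U \<Longrightarrow> smooth_on U f \<Longrightarrow> smooth_on U g \<Longrightarrow> smooth_on U (\<lambda>x. f x + g x)"
  unfolding smooth_on_def using Ck_on_add by blast

lemma smooth_on_linear:
  "open U \<Longrightarrow> bounded_linear L \<Longrightarrow> smooth_on U f \<Longrightarrow> smooth_on U (\<lambda>x. L (f x))"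
  unfolding smooth_on_def using Ck_on_linear by blast

lemma smooth_on_bilinear:
  "open U \<Longrightarrow> bounded_bilinear B \<Longrightarrow> smooth_on U f \<Longrightarrow> smooth_on U g \<Longrightarrow> smooth_on U (\<lambda>x. B (f x) (g x))"
  unfolding smooth_on_def using Ck_on_bilinear by blast

lemma smooth_on_sum:
  "open U \<Longrightarrow> (\<And>i. i \<in> I \<Longrightarrow> smooth_on U (f i)) \<Longrightarrow> smooth_on U (\<lambda>x. \<Sum>i\<in>I. f i x)"
  by (induction I rule: infinite_finite_induct) (auto intro: smooth_on_const smooth_on_add)

lemma smooth_on_prod:
  fixes f :: "'i \<Rightarrow> 'a::euclidean_space \<Rightarrow> real"
  shows "open U \<Longrightarrow> (\<And>i. i \<in> I \<Longrightarrow> smooth_on U (f i)) \<Longrightarrow> smooth_on U (\<lambda>x. \<Prod>i\<in>I. f i x)"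
  by (induction I rule: infinite_finite_induct)
    (auto intro: smooth_on_const smooth_on_bilinear[OF _ bounded_bilinear_mult])

lemma smooth_on_ident: "open U \<Longrightarrow> smooth_on U (\<lambda>x. x)"
  unfolding smooth_on_def
proof
  fix k assume "open U"
  show "Ck_on k U (\<lambda>x. x)" by (cases k) (auto simp: Ck_on_const)
qed

lemma smooth_on_mult:
  fixes f g :: "'a::euclidean_space \<Rightarrow> real"
  shows "open U \<Longrightarrow> smooth_on U f \<Longrightarrow> smooth_on U g \<Longrightarrow> smooth_on U (\<lambda>x. f x * g x)"
  by (rule smooth_on_bilinear[OF _ bounded_bilinear_mult])

lemma smooth_on_scaleR:
  "open U \<Longrightarrow> smooth_on U f \<Longrightarrow> smooth_on U g \<Longrightarrow> smooth_on U (\<lambda>x. f x *\<^sub>R g x)"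
  by (rule smooth_on_bilinear[OF _ bounded_bilinear_scaleR])

lemma smooth_on_minus: "open U \<Longrightarrow> smooth_on U f \<Longrightarrow> smooth_on U (\<lambda>x. - f x)"
  by (rule smooth_on_linear[OF _ bounded_linear_minus[OF bounded_linear_ident]])

lemma smooth_on_diff:
  "open U \<Longrightarrow> smooth_on U f \<Longrightarrow> smooth_on U g \<Longrightarrow> smooth_on U (\<lambda>x. f x - g x)"
  using smooth_on_add[of U f "\<lambda>x. - g x"] smooth_on_minus[of U g] by simp

lemma smooth_on_vec_nth:
  "open U \<Longrightarrow> smooth_on U f \<Longrightarrow> smooth_on U (\<lambda>x. (f x :: 'b::euclidean_space ^ 'n) $ i)"
  by (rule smooth_on_linear[OF _ bounded_linear_vec_nth])

lemma bounded_linear_axis: "bounded_linear (axis i :: 'b::euclidean_space \<Rightarrow> 'b ^ 'n)"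
  by (rule linear_conv_bounded_linear[THEN iffD1], rule linearI) (auto simp: vec_eq_iff axis_def)

lemma smooth_on_vecI:
  fixes f :: "'a::euclidean_space \<Rightarrow> 'b::euclidean_space ^ 'n"
  assumes "open U" "\<And>i. smooth_on U (\<lambda>x. f x $ i)"
  shows "smooth_on U f"
proof -
  have "smooth_on U (\<lambda>x. \<Sum>i\<in>UNIV. axis i (f x $ i))"
    by (intro smooth_on_sum assms smooth_on_linear[OF _ bounded_linear_axis])
  moreover have "(\<Sum>i\<in>UNIV. axis i (f x $ i)) = f x" for x
    by (simp add: vec_eq_iff axis_def if_distrib cong: if_cong)
  ultimately show ?thesis by simp
qed

text \<open>Both lemmas below use that the derivative of the composition is again a product of the
  composition with the inner derivative, so that the order can be raised step by step.\<close>

lemma smooth_on_inverse: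
  fixes f :: "'a::euclidean_space \<Rightarrow> real"
  assumes U: "open U" and f: "smooth_on U f" and nz: "\<And>x. x \<in> U \<Longrightarrow> f x \<noteq> 0"
  shows "smooth_on U (\<lambda>x. inverse (f x))"
proof -
  have "Ck_on k U (\<lambda>x. inverse (f x))" for k
  proof (induction k)
    case 0 then show ?case using nz smooth_on_continuous[OF f] by (auto intro: continuous_intros)
  next
    case (Suc k)
    have der: "((\<lambda>x. inverse (f x)) has_derivative
        (\<lambda>v. - (inverse (f x) * frechet_derivative f (at x) v * inverse (f x)))) (at x)" if "x \<in> U" for x
      by (rule Deriv.has_derivative_inverse[OF nz[OF that] smooth_on_has_derivative[OF f that]])
    have "Ck_on k U (\<lambda>x. frechet_derivative (\<lambda>x. inverse (f x)) (at x) v) \<longleftrightarrow>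
       Ck_on k U (\<lambda>x. - (inverse (f x) * frechet_derivative f (at x) v * inverse (f x)))" for v
      by (rule Ck_on_cong[OF U]) (rule frechet_derivative_eqI[OF der])
    moreover have "Ck_on k U (\<lambda>x. - (inverse (f x) * frechet_derivative f (at x) v * inverse (f x)))" for v
      using Suc smooth_on_Ck[OF smooth_on_frechet_derivative[OF f]]
      by (intro Ck_on_linear[OF U bounded_linear_minus[OF bounded_linear_ident]]
          Ck_on_bilinear[OF U bounded_bilinear_mult]) auto
    ultimately show ?case using der by (auto simp: differentiable_def)
  qed
  then show ?thesis by (simp add: smooth_on_def)
qed

lemma smooth_on_sqrt:
  fixes f :: "'a::euclidean_space \<Rightarrow> real"
  assumes U: "open U" and f: "smooth_on U f" and pos: "\<And>x. x \<in> U \<Longrightarrow> f x > 0"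
  shows "smooth_on U (\<lambda>x. sqrt (f x))"
proof -
  have fi: "smooth_on U (\<lambda>x. inverse (2 * f x))"
    by (intro smooth_on_inverse smooth_on_mult smooth_on_const U f) (use pos in force)
  have "Ck_on k U (\<lambda>x. sqrt (f x))" for k
  proof (induction k)
    case 0 then show ?case using smooth_on_continuous[OF f] by (auto intro: continuous_intros)
  next
    case (Suc k)
    have der: "((\<lambda>x. sqrt (f x)) has_derivative
        (\<lambda>v. frechet_derivative f (at x) v * (sqrt (f x) * inverse (2 * f x)))) (at x)" if "x \<in> U" for x
      using pos[OF that] that
      by (auto intro!: derivative_eq_intros smooth_on_has_derivative[OF f]
          simp: fun_eq_iff field_simps simp flip: power2_eq_square)
    have "Ck_on k U (\<lambda>x. frechet_derivative (\<lambda>x. sqrt (f x)) (at x) v) \<longleftrightarrow>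
       Ck_on k U (\<lambda>x. frechet_derivative f (at x) v * (sqrt (f x) * inverse (2 * f x)))" for v
      by (rule Ck_on_cong[OF U]) (rule frechet_derivative_eqI[OF der])
    moreover have "Ck_on k U (\<lambda>x. frechet_derivative f (at x) v * (sqrt (f x) * inverse (2 * f x)))" for v
      using Suc smooth_on_Ck[OF smooth_on_frechet_derivative[OF f]] smooth_on_Ck[OF fi]
      by (intro Ck_on_bilinear[OF U bounded_bilinear_mult]) auto
    ultimately show ?case using der by (auto simp: differentiable_def)
  qed
  then show ?thesis by (simp add: smooth_on_def)
qed

text \<open>The second difference of \<open>f\<close> over a small parallelogram is symmetric in the
  two sides, and two uses of the mean value theorem write it as \<open>h * h\<close> times a mixed
  derivative at a nearby point, in either order. Continuity of both mixed derivatives then makes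
  them agree at \<open>x\<close>.\<close>

lemma second_derivative_symmetric_real:
  fixes f :: "'a::euclidean_space \<Rightarrow> real"
  assumes U: "open U" and x: "x \<in> U" and f: "smooth_on U f"
  shows "frechet_derivative (\<lambda>y. frechet_derivative f (at y) u) (at x) v
       = frechet_derivative (\<lambda>y. frechet_derivative f (at y) v) (at x) u"
proof -
  define D where "D u y = frechet_derivative f (at y) u" for u y
  define DD where "DD u v y = frechet_derivative (D u) (at y) v" for u v y
  have sD: "smooth_on U (D u)" for u
    unfolding D_def by (rule smooth_on_frechet_derivative[OF f])
  have sDD: "smooth_on U (DD u v)" for u v
    unfolding DD_def by (rule smooth_on_frechet_derivative[OF sD])
  have line: "((\<lambda>s. g (a + s *\<^sub>R u)) has_real_derivative frechet_derivative g (at (a + s *\<^sub>R u)) u) (at s)"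
    if "smooth_on U g" "a + s *\<^sub>R u \<in> U" for g :: "'a \<Rightarrow> real" and a u s
  proof -
    have 1: "((\<lambda>s. a + s *\<^sub>R u) has_derivative (\<lambda>h. h *\<^sub>R u)) (at s)"
      by (auto intro!: derivative_eq_intros)
    have "((\<lambda>s. g (a + s *\<^sub>R u)) has_derivative (\<lambda>h. frechet_derivative g (at (a + s *\<^sub>R u)) (h *\<^sub>R u))) (at s)"
      using has_derivative_compose[OF 1 smooth_on_has_derivative[OF that]] .
    moreover have "frechet_derivative g (at (a + s *\<^sub>R u)) (h *\<^sub>R u) = frechet_derivative g (at (a + s *\<^sub>R u)) u * h" for h
      using linear_frechet_derivative[OF smooth_on_differentiable[OF that]]
      by (simp add: linear_scale)
    ultimately show ?thesis by (simp add: has_field_derivative_def)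
  qed
  obtain e where e: "e > 0" "ball x e \<subseteq> U" using U x open_contains_ball by blast
  \<comment> \<open>The summand 1 keeps \<open>K\<close> positive when both directions vanish, so
    that \<open>h\<close> can be defined by a division by \<open>K\<close>.\<close>
  define K where "K = norm u + norm v + 1"
  have K: "K > 0" by (simp add: K_def add_nonneg_pos)
  have inU: "x + s *\<^sub>R u + t *\<^sub>R v \<in> ball x r" if "0 \<le> s" "s \<le> h" "0 \<le> t" "t \<le> h" "h * K < r" for s t h r
  proof -
    have "norm (s *\<^sub>R u + t *\<^sub>R v) \<le> h * norm u + h * norm v"
      by (rule order_trans[OF norm_triangle_ineq])
        (use that in \<open>auto intro!: add_mono mult_right_mono\<close>)
    also have "\<dots> \<le> h * K" using that by (simp add: K_def algebra_simps)
    finally have "norm (s *\<^sub>R u + t *\<^sub>R v) < r" using that by simp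
    moreover have "dist x (x + s *\<^sub>R u + t *\<^sub>R v) = norm (s *\<^sub>R u + t *\<^sub>R v)"
      by (metis add.assoc add_diff_cancel_left' dist_commute dist_norm)
    ultimately show ?thesis by simp
  qed
  have mvt: "\<exists>y\<in>ball x (r::real). f (x + h *\<^sub>R a + h *\<^sub>R b) - f (x + h *\<^sub>R a) - f (x + h *\<^sub>R b) + f x = h * h * DD a b y"
    if h: "0 < h" "h * K < r" "r \<le> e" and
      inb: "\<And>s t r. 0 \<le> s \<Longrightarrow> s \<le> h \<Longrightarrow> 0 \<le> t \<Longrightarrow> t \<le> h \<Longrightarrow> h * K < r \<Longrightarrow> x + s *\<^sub>R a + t *\<^sub>R b \<in> ball x r"
    for a b h r
  proof -
    have inb': "x + s *\<^sub>R a + t *\<^sub>R b \<in> U" if "0 \<le> s" "s \<le> h" "0 \<le> t" "t \<le> h" for s t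
      using inb[OF that h(2)] e h by auto
    have d1: "((\<lambda>s. f ((x + h *\<^sub>R b) + s *\<^sub>R a) - f (x + s *\<^sub>R a)) has_real_derivative
        (D a ((x + h *\<^sub>R b) + s *\<^sub>R a) - D a (x + s *\<^sub>R a))) (at s)" if "0 \<le> s" "s \<le> h" for s
      unfolding D_def using inb'[OF that, of h] inb'[OF that, of 0] h that
      by (intro DERIV_diff line[OF f]) (auto simp: algebra_simps)
    \<comment> \<open>The mean value theorem in direction \<open>a\<close> is applied to a
      difference of two values of \<open>f\<close>, the next one in direction \<open>b\<close> to
      the derivative that results.\<close>
    obtain s where s: "0 < s" "s < h"
      "(f ((x + h *\<^sub>R b) + h *\<^sub>R a) - f (x + h *\<^sub>R a)) - (f ((x + h *\<^sub>R b) + 0 *\<^sub>R a) - f (x + 0 *\<^sub>R a))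
       = (h - 0) * (D a ((x + h *\<^sub>R b) + s *\<^sub>R a) - D a (x + s *\<^sub>R a))"
      using MVT2[OF h(1) d1] by blast
    have d2: "((\<lambda>t. D a ((x + s *\<^sub>R a) + t *\<^sub>R b)) has_real_derivative DD a b ((x + s *\<^sub>R a) + t *\<^sub>R b)) (at t)"
      if "0 \<le> t" "t \<le> h" for t
      unfolding DD_def using inb'[OF _ _ that, of s] s by (intro line[OF sD]) auto
    obtain t where t: "0 < t" "t < h"
      "D a ((x + s *\<^sub>R a) + h *\<^sub>R b) - D a ((x + s *\<^sub>R a) + 0 *\<^sub>R b) = (h - 0) * DD a b ((x + s *\<^sub>R a) + t *\<^sub>R b)"
      using MVT2[OF h(1) d2] by blast
    have "f (x + h *\<^sub>R a + h *\<^sub>R b) - f (x + h *\<^sub>R a) - f (x + h *\<^sub>R b) + f x = h * h * DD a b ((x + s *\<^sub>R a) + t *\<^sub>R b)"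
      using s(3) t(3) by (simp add: algebra_simps)
    then show ?thesis using inb[of s t r] s t h by auto
  qed
  show ?thesis
  proof (rule ccontr)
    assume "\<not> ?thesis"
    then have ne: "DD u v x \<noteq> DD v u x" by (simp add: DD_def D_def[abs_def])
    \<comment> \<open>Half the gap: two numbers within less than \<open>d\<close> of the two mixed
      derivatives at \<open>x\<close> cannot be equal.\<close>
    define d where "d = \<bar>DD u v x - DD v u x\<bar> / 2"
    have d: "d > 0" using ne by (simp add: d_def)
    have c: "isCont (DD a b) x" for a b
      using smooth_on_continuous[OF sDD] U x continuous_on_eq_continuous_at by blast
    obtain r1 where r1: "r1 > 0" "\<And>y. dist y x < r1 \<Longrightarrow> \<bar>DD u v y - DD u v x\<bar> < d"
      using c[of u v] d unfolding continuous_at_eps_delta by (metis dist_real_def)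
    obtain r2 where r2: "r2 > 0" "\<And>y. dist y x < r2 \<Longrightarrow> \<bar>DD v u y - DD v u x\<bar> < d"
      using c[of v u] d unfolding continuous_at_eps_delta by (metis dist_real_def)
    define r where "r = min e (min r1 r2)"
    define h where "h = r / (2 * K)"
    have r: "r > 0" using e r1 r2 by (simp add: r_def)
    have h: "h > 0" "h * K < r" "r \<le> e" using r K by (auto simp: h_def r_def)
    obtain y where y: "y \<in> ball x r"
      "f (x + h *\<^sub>R u + h *\<^sub>R v) - f (x + h *\<^sub>R u) - f (x + h *\<^sub>R v) + f x = h * h * DD u v y"
      using mvt[OF h inU[where h=h]] by blast
    have inU': "x + s *\<^sub>R v + t *\<^sub>R u \<in> ball x r" if "0 \<le> s" "s \<le> h" "0 \<le> t" "t \<le> h" "h * K < r" for s t h r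
      using inU[OF that(3,4,1,2,5)] by (simp add: add.assoc add.commute add.left_commute)
    obtain z where z: "z \<in> ball x r"
      "f (x + h *\<^sub>R v + h *\<^sub>R u) - f (x + h *\<^sub>R v) - f (x + h *\<^sub>R u) + f x = h * h * DD v u z"
      using mvt[OF h inU'[where h=h]] by blast
    have "x + h *\<^sub>R v + h *\<^sub>R u = x + h *\<^sub>R u + h *\<^sub>R v" by simp
    from z(2)[unfolded this] y(2) have "h * h * DD u v y = h * h * DD v u z" by linarith
    then have "DD u v y = DD v u z" using h by simp
    moreover have "\<bar>DD u v y - DD u v x\<bar> < d" "\<bar>DD v u z - DD v u x\<bar> < d"
      using y z r1 r2 by (auto simp: r_def dist_commute)
    ultimately show False unfolding d_def by (simp add: abs_if split: if_splits)
  qed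
qed

lemma frechet_derivative_linear:
  assumes "bounded_linear L" "f differentiable at x"
  shows "frechet_derivative (\<lambda>y. L (f y)) (at x) v = L (frechet_derivative f (at x) v)"
  by (rule frechet_derivative_eqI[OF bounded_linear.has_derivative[OF assms(1) has_frechet_derivative[OF assms(2)]]])

lemma second_derivative_symmetric:
  fixes f :: "'a::euclidean_space \<Rightarrow> 'b::euclidean_space"
  assumes U: "open U" and x: "x \<in> U" and f: "smooth_on U f"
  shows "frechet_derivative (\<lambda>y. frechet_derivative f (at y) u) (at x) v
       = frechet_derivative (\<lambda>y. frechet_derivative f (at y) v) (at x) u"
proof (rule euclidean_eqI)
  fix b :: 'b assume "b \<in> Basis"
  let ?L = "\<lambda>y. y \<bullet> b"
  have L: "bounded_linear ?L" by (rule bounded_linear_inner_left)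
  have comm: "frechet_derivative (\<lambda>y. frechet_derivative (\<lambda>z. ?L (f z)) (at y) u) (at x) v
      = ?L (frechet_derivative (\<lambda>y. frechet_derivative f (at y) u) (at x) v)" for u v
  proof -
    have "frechet_derivative (\<lambda>y. frechet_derivative (\<lambda>z. ?L (f z)) (at y) u) (at x)
        = frechet_derivative (\<lambda>y. ?L (frechet_derivative f (at y) u)) (at x)"
      by (rule frechet_derivative_cong_open[OF U x])
        (rule frechet_derivative_linear[OF L smooth_on_differentiable[OF f]])
    then show ?thesis
      using frechet_derivative_linear[OF L smooth_on_differentiable[OF smooth_on_frechet_derivative[OF f] x]]
      by simp
  qed
  show "?L (frechet_derivative (\<lambda>y. frechet_derivative f (at y) u) (at x) v)
       = ?L (frechet_derivative (\<lambda>y. frechet_derivative f (at y) v) (at x) u)"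
    using second_derivative_symmetric_real[OF U x smooth_on_linear[OF U L f], of u v] by (simp add: comm)
qed

section \<open>Matrices of smooth functions\<close>

lemma bounded_bilinear_matrix_matrix_mult:
  "bounded_bilinear ((**) :: real^'n^'m \<Rightarrow> real^'k^'n \<Rightarrow> real^'k^'m)"
proof -
  have "bilinear ((**) :: real^'n^'m \<Rightarrow> real^'k^'n \<Rightarrow> real^'k^'m)"
    unfolding bilinear_def
    by (auto intro!: linearI simp: matrix_add_ldistrib matrix_matrix_mult_def vec_eq_iff
        algebra_simps sum.distrib sum_distrib_left)
  then show ?thesis by (rule bilinear_conv_bounded_bilinear[THEN iffD1])
qed

lemma bounded_bilinear_vector_matrix_mult:
  "bounded_bilinear ((v*) :: real^'m \<Rightarrow> real^'n^'m \<Rightarrow> real^'n)"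
proof -
  have "bilinear ((v*) :: real^'m \<Rightarrow> real^'n^'m \<Rightarrow> real^'n)"
    unfolding bilinear_def
    by (auto intro!: linearI simp: vector_matrix_mult_def vec_eq_iff
        algebra_simps sum.distrib sum_distrib_left)
  then show ?thesis by (rule bilinear_conv_bounded_bilinear[THEN iffD1])
qed

lemma bounded_linear_transpose: "bounded_linear (transpose :: real^'n^'m \<Rightarrow> real^'m^'n)"
  by (rule linear_conv_bounded_linear[THEN iffD1], rule linearI) (auto simp: vec_eq_iff transpose_def)

lemma bounded_linear_trace: "bounded_linear (trace :: real^'n^'n \<Rightarrow> real)"
  by (rule linear_conv_bounded_linear[THEN iffD1], rule linearI)
    (auto simp: trace_def sum.distrib sum_distrib_left)

text \<open>The differential of the determinant at \<open>A\<close> in direction \<open>B\<close>,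
  with one row exchanged at a time so that multilinearity in the rows applies.\<close>

definition ddet :: "real^'n^'n \<Rightarrow> real^'n^'n \<Rightarrow> real" where
  "ddet A B = (\<Sum>i\<in>UNIV. det (\<chi> r. if r = i then B $ r else A $ r))"

lemma det_has_derivative:
  fixes A :: "'a::euclidean_space \<Rightarrow> real^'n^'n"
  assumes "(A has_derivative A') (at x)"
  shows "((\<lambda>y. det (A y)) has_derivative (\<lambda>v. ddet (A x) (A' v))) (at x)"
proof -
  have e: "((\<lambda>y. A y $ i $ j) has_derivative (\<lambda>v. A' v $ i $ j)) (at x)" for i j
    by (intro bounded_linear.has_derivative[OF bounded_linear_vec_nth] assms)
  have "((\<lambda>y. det (A y)) has_derivative
     (\<lambda>v. \<Sum>p | p permutes UNIV. of_int (sign p) *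
        (\<Sum>i\<in>UNIV. A' v $ i $ p i * (\<Prod>j\<in>UNIV - {i}. A x $ j $ p j)))) (at x)"
    unfolding det_def
    by (intro has_derivative_sum has_derivative_mult_right has_derivative_prod e)
  moreover have "(\<Sum>p | p permutes UNIV. of_int (sign p) *
        (\<Sum>i\<in>UNIV. B $ i $ p i * (\<Prod>j\<in>UNIV - {i}. A x $ j $ p j))) = ddet (A x) B" for B
  proof -
    have "(\<Prod>j\<in>UNIV. (if j = i then B $ j else A x $ j) $ p j) =
        B $ i $ p i * (\<Prod>j\<in>UNIV - {i}. A x $ j $ p j)" for i and p :: "'n \<Rightarrow> 'n"
      by (subst prod.remove[of _ i]) auto
    then show ?thesis
      unfolding ddet_def det_def by (subst sum.swap) (simp add: sum_distrib_left)
  qed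
  ultimately show ?thesis by simp
qed

text \<open>After expansion of row \<open>i\<close>, each term with \<open>k \<noteq> i\<close>
  repeats another row and vanishes.\<close>

lemma det_row_replace_sum:
  fixes A :: "real^'n^'n"
  shows "det (\<chi> r. if r = i then (\<Sum>k\<in>UNIV. c k *s (A $ k)) else A $ r) = c i * det A"
proof -
  have "det (\<chi> r. if r = i then (\<Sum>k\<in>UNIV. c k *s (A $ k)) else A $ r)
      = (\<Sum>k\<in>UNIV. det (\<chi> r. if r = i then c k *s (A $ k) else A $ r))"
    by (rule det_linear_row_sum) simp
  also have "\<dots> = (\<Sum>k\<in>UNIV. c k * det (\<chi> r. if r = i then A $ k else A $ r))"
    by (simp add: det_row_mul)
  also have "\<dots> = (\<Sum>k\<in>UNIV. if k = i then c i * det A else 0)"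
  proof (rule sum.cong)
    fix k
    have "det (\<chi> r. if r = i then A $ k else A $ r) = 0" if "k \<noteq> i"
      by (rule det_identical_rows[of k i]) (use that in \<open>auto simp: row_def vec_eq_iff\<close>)
    moreover have "(\<chi> r. if r = i then A $ i else A $ r) = A" by (auto simp: vec_eq_iff)
    ultimately show "c k * det (\<chi> r. if r = i then A $ k else A $ r) = (if k = i then c i * det A else 0)"
      by auto
  qed simp
  finally show ?thesis by simp
qed

text \<open>Jacobi's formula without an inverse of \<open>A\<close>: row \<open>i\<close> of
  \<open>B ** A\<close> is a combination of the rows of \<open>A\<close>, and only the coefficient
  \<open>B $ i $ i\<close> survives in the determinant.\<close>

lemma ddet_mult_left: "ddet A (B ** A) = trace B * det A"
proof -
  have row: "(B ** A) $ r = (\<Sum>k\<in>UNIV. (B $ r $ k) *s (A $ k))" for r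
    by (simp add: matrix_matrix_mult_def vec_eq_iff)
  have "det (\<chi> r. if r = i then (B ** A) $ r else A $ r) = B $ i $ i * det A" for i
  proof -
    have "(\<chi> r. if r = i then (B ** A) $ r else A $ r) =
        (\<chi> r. if r = i then (\<Sum>k\<in>UNIV. (B $ i $ k) *s (A $ k)) else A $ r)"
      by (rule Cart_lambda_cong) (simp add: row)
    then show ?thesis using det_row_replace_sum[of i "\<lambda>k. B $ i $ k" A] by simp
  qed
  then show ?thesis by (simp add: ddet_def trace_def sum_distrib_right)
qed

lemma ddet_add: "ddet A (B + C) = ddet A B + ddet A C"
proof -
  have "det (\<chi> r. if r = i then (B + C) $ r else A $ r) =
      det (\<chi> r. if r = i then B $ r else A $ r) + det (\<chi> r. if r = i then C $ r else A $ r)" for i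
    using det_row_add[of i "\<lambda>r. B $ r" "\<lambda>r. C $ r" "\<lambda>r. A $ r"]
    by (simp cong: if_cong)
  then show ?thesis by (simp add: ddet_def sum.distrib)
qed

text \<open>Conjugation by \<open>A\<close> turns right into left multiplication and keeps the
  trace.\<close>

lemma ddet_mult_right:
  assumes "invertible A"
  shows "ddet A (A ** B) = trace B * det A"
proof -
  obtain A' where A': "A ** A' = mat 1" "A' ** A = mat 1" using assms invertible_def by metis
  have "A ** B = (A ** B ** A') ** A" by (simp add: A'(2) flip: matrix_mul_assoc)
  then have "ddet A (A ** B) = trace (A ** B ** A') * det A" using ddet_mult_left[of A "A ** B ** A'"] by simp
  also have "trace (A ** B ** A') = trace (A' ** (A ** B))" by (rule trace_mul_sym)
  also have "A' ** (A ** B) = B" by (simp add: matrix_mul_assoc A'(2))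
  finally show ?thesis .
qed

lemma smooth_on_det:
  fixes A :: "'a::euclidean_space \<Rightarrow> real^'n^'n"
  assumes "open U" "smooth_on U A"
  shows "smooth_on U (\<lambda>x. det (A x))"
proof -
  have "smooth_on U (\<lambda>x. of_int (sign p) * (\<Prod>i\<in>UNIV. A x $ i $ p i))" for p :: "'n \<Rightarrow> 'n"
    by (rule smooth_on_mult[OF assms(1) smooth_on_const], rule smooth_on_prod[OF assms(1)],
        rule smooth_on_vec_nth[OF assms(1)], rule smooth_on_vec_nth[OF assms])
  then show ?thesis unfolding det_def by (rule smooth_on_sum[OF assms(1)])
qed

lemma matrix_inv_left_right:
  fixes A :: "real^'n^'n"
  assumes "invertible A"
  shows "A ** matrix_inv A = mat 1" "matrix_inv A ** A = mat 1"
proof -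
  obtain A' where "A ** A' = mat 1 \<and> A' ** A = mat 1" using assms invertible_def by metis
  then have "A ** matrix_inv A = mat 1 \<and> matrix_inv A ** A = mat 1"
    unfolding matrix_inv_def by (rule someI)
  then show "A ** matrix_inv A = mat 1" "matrix_inv A ** A = mat 1" by auto
qed

text \<open>Cramer's rule: the entries of the inverse are quotients of determinants, and
  determinants are polynomial in the entries.\<close>

lemma smooth_on_matrix_inv:
  fixes A :: "'a::euclidean_space \<Rightarrow> real^'n^'n"
  assumes U: "open U" and A: "smooth_on U A" and inv: "\<And>x. x \<in> U \<Longrightarrow> invertible (A x)"
  shows "smooth_on U (\<lambda>x. matrix_inv (A x))"
proof -
  define c where "c x k j = det (\<chi> r s. if s = k then axis j 1 $ r else A x $ r $ s) * inverse (det (A x))" for x k j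
  have nz: "det (A x) \<noteq> 0" if "x \<in> U" for x using inv[OF that] by (simp add: invertible_det_nz)
  have eq: "matrix_inv (A x) = (\<chi> k j. c x k j)" if "x \<in> U" for x
  proof -
    have "A x *v (\<chi> k. c x k j) = axis j 1" for j
      by (rule cramer[THEN iffD2, OF nz[OF that]]) (simp add: c_def vec_eq_iff field_simps)
    then have "A x ** (\<chi> k j. c x k j) = mat 1"
      unfolding vec_eq_iff matrix_matrix_mult_def matrix_vector_mult_def mat_def axis_def
      by (simp add: vec_lambda_beta)
    then show ?thesis using matrix_inv_left_right[OF inv[OF that]]
      by (metis matrix_mul_assoc matrix_mul_lid matrix_mul_rid)
  qed
  have sm: "smooth_on U (\<lambda>x. if s = k then axis j 1 $ r else A x $ r $ s)" for k j r s
    by (cases "s = k") (auto intro!: smooth_on_const smooth_on_vec_nth U A)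
  have "smooth_on U (\<lambda>x. c x k j)" for k j
    unfolding c_def
    by (rule smooth_on_mult[OF U smooth_on_det[OF U smooth_on_vecI[OF U smooth_on_vecI[OF U]]]
          smooth_on_inverse[OF U smooth_on_det[OF U A] nz]]) (simp_all add: sm)
  then have "smooth_on U (\<lambda>x. \<chi> k j. c x k j)"
    by (intro smooth_on_vecI[OF U]) simp
  then show ?thesis using smooth_on_cong[OF U eq] by simp
qed

section \<open>Block matrices over the index type \<open>'m option\<close>\<close>

definition block_mat :: "real \<Rightarrow> real^'m^'m \<Rightarrow> real^('m option)^('m::finite option)" where
  "block_mat a A = (\<chi> i j. case i of None \<Rightarrow> (case j of None \<Rightarrow> a | Some _ \<Rightarrow> 0)
     | Some k \<Rightarrow> (case j of None \<Rightarrow> 0 | Some l \<Rightarrow> A $ k $ l))"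

lemma UNIV_option_sum:
  fixes g :: "'m::finite option \<Rightarrow> 'a::comm_monoid_add"
  shows "(\<Sum>i\<in>UNIV. g i) = g None + (\<Sum>i\<in>UNIV. g (Some i))"
  by (simp add: UNIV_option_conv sum.reindex)

lemma UNIV_option_prod:
  fixes g :: "'m::finite option \<Rightarrow> 'a::comm_monoid_mult"
  shows "(\<Prod>i\<in>UNIV. g i) = g None * (\<Prod>i\<in>UNIV. g (Some i))"
  by (simp add: UNIV_option_conv prod.reindex)

lemma block_mat_mult: "block_mat a A ** block_mat b B = block_mat (a * b) (A ** B)"
  by (simp add: vec_eq_iff block_mat_def matrix_matrix_mult_def UNIV_option_sum split: option.splits)

lemma det_transposition_matrix:
  fixes a b :: "'k::finite"
  assumes "a \<noteq> b"
  shows "det (\<chi> i j. (mat 1 :: real^'k^'k) $ i $ Transposition.transpose a b j) = -1"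
  using det_permute_columns[OF permutes_swap_id[of a UNIV b], of "mat 1 :: real^'k^'k"] assms
  by (simp add: sign_swap_id)

lemma det_elementary_matrix:
  fixes a b :: "'k::finite"
  assumes "a \<noteq> b"
  shows "det ((\<chi> i j. if i = a \<and> j = b then c else of_bool (i = j)) :: real^'k^'k) = 1"
proof -
  have "(\<chi> i j. if i = a \<and> j = b then c else of_bool (i = j)) =
      (\<chi> k. if k = a then row a (mat 1) + c *s row b (mat 1) else row k (mat 1 :: real^'k^'k))"
    using assms by (auto simp: vec_eq_iff row_def mat_def)
  then show ?thesis using det_row_operation[OF assms, of "mat 1 :: real^'k^'k" c] by simp
qed

text \<open>With corner entry 1 the construction is multiplicative and sends elementary and diagonal
  matrices to matrices of the same kind, so induction over elementary factors applies. A general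
  corner is then split off as a diagonal factor.\<close>

lemma det_block_mat: "det (block_mat a A) = a * det A"
proof -
  have one: "det (block_mat 1 A) = det A"
  proof (induction A rule: induct_matrix_elementary)
    case (1 A B)
    then show ?case using block_mat_mult[of 1 A 1 B] by (metis det_mul mult_1)
  next
    case (2 A i)
    have "row (Some i) (block_mat 1 A) = 0" "row i A = 0"
      using 2 by (auto simp: vec_eq_iff row_def block_mat_def split: option.splits)
    then show ?case by (metis det_zero_row(1))
  next
    case (3 A)
    have "block_mat 1 A $ i $ j = 0" if "i \<noteq> j" for i j
      using that 3 by (auto simp: block_mat_def split: option.splits)
    then show ?case by (subst (1 2) det_diagonal) (auto simp: 3 UNIV_option_prod block_mat_def)
  next
    case (4 m n)
    have "block_mat 1 (\<chi> i j. mat 1 $ i $ Transposition.transpose m n j) =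
       (\<chi> i j. mat 1 $ i $ Transposition.transpose (Some m) (Some n) j)"
      by (auto simp: vec_eq_iff block_mat_def mat_def Transposition.transpose_def split: option.splits)
    then show ?case using 4 by (simp add: det_transposition_matrix)
  next
    case (5 m n c)
    have "block_mat 1 (\<chi> i j. if i = m \<and> j = n then c else of_bool (i = j)) =
       (\<chi> i j. if i = Some m \<and> j = Some n then c else of_bool (i = j))"
      by (auto simp: vec_eq_iff block_mat_def split: option.splits)
    then show ?case using 5 by (simp add: det_elementary_matrix)
  qed
  have "det (block_mat a (mat 1 :: real^'m^'m)) = a"
    by (subst det_diagonal) (auto simp: UNIV_option_prod block_mat_def mat_def split: option.splits)
  then show ?thesis using one block_mat_mult[of a "mat 1" 1 A] by (metis det_mul matrix_mul_lid mult.right_neutral)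
qed

lemma frechet_derivative_bilinear:
  assumes "bounded_bilinear B" "f differentiable at x" "g differentiable at x"
  shows "frechet_derivative (\<lambda>y. B (f y) (g y)) (at x) v =
    B (f x) (frechet_derivative g (at x) v) + B (frechet_derivative f (at x) v) (g x)"
  using frechet_derivative_eqI[OF bounded_bilinear.FDERIV[OF assms(1)
    has_frechet_derivative[OF assms(2)] has_frechet_derivative[OF assms(3)]]] .

section \<open>Hypersurfaces with a transversal field\<close>

text \<open>Row vectors indexed by \<open>'m option\<close> are coordinates with respect to a frame:
  the \<open>Some\<close> part is tangential, the \<open>None\<close> part transversal.
  \<open>hat\<close> embeds the tangential coordinates.\<close>

definition hat :: "real ^ 'm \<Rightarrow> real ^ ('m option)" where
  "hat v = (\<chi> i. case i of None \<Rightarrow> 0 | Some j \<Rightarrow> v $ j)"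

definition drop_None :: "real ^ ('m option) \<Rightarrow> real ^ 'm" where
  "drop_None y = (\<chi> j. y $ Some j)"

lemma hat_nth [simp]: "hat v $ None = 0" "hat v $ Some j = v $ j"
  by (simp_all add: hat_def)

lemma drop_None_nth [simp]: "drop_None y $ j = y $ Some j"
  by (simp add: drop_None_def)

lemma drop_None_hat [simp]: "drop_None (hat v) = v"
  by (simp add: vec_eq_iff)

lemma all_option: "(\<forall>i. P i) \<longleftrightarrow> P None \<and> (\<forall>j. P (Some j))"
  by (metis option.exhaust)

lemma hat_drop_None: "y = hat (drop_None y) + y $ None *\<^sub>R axis None 1"
  by (simp add: vec_eq_iff all_option axis_def)

lemma bounded_linear_hat: "bounded_linear (hat :: real ^ 'm \<Rightarrow> real ^ ('m::finite option))"
  by (rule linear_conv_bounded_linear[THEN iffD1], rule linearI) (simp_all add: vec_eq_iff all_option)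

lemma bounded_linear_drop_None: "bounded_linear (drop_None :: real ^ ('m::finite option) \<Rightarrow> _)"
  by (rule linear_conv_bounded_linear[THEN iffD1], rule linearI) (simp_all add: vec_eq_iff)

lemma linear_as_sum_axis:
  fixes F :: "real ^ 'm \<Rightarrow> 'b::real_vector"
  assumes "linear F"
  shows "F v = (\<Sum>j\<in>UNIV. v $ j *\<^sub>R F (axis j 1))"
proof -
  have "v = (\<Sum>j\<in>UNIV. v $ j *\<^sub>R axis j 1)"
    by (simp add: vec_eq_iff axis_def if_distrib cong: if_cong)
  then have "F v = F (\<Sum>j\<in>UNIV. v $ j *\<^sub>R axis j 1)" by simp
  then show ?thesis using assms by (simp add: linear_sum linear_scale)
qed

lemma smooth_on_dder:
  fixes X :: "real ^ 'm \<Rightarrow> real ^ 'm"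
  assumes U: "open U" and X: "smooth_on U X" and W: "smooth_on U W"
  shows "smooth_on U (dder X W)"
proof -
  have "smooth_on U (\<lambda>p. \<Sum>j\<in>UNIV. X p $ j *\<^sub>R frechet_derivative W (at p) (axis j 1))"
    by (intro smooth_on_sum U smooth_on_scaleR smooth_on_vec_nth[OF U X] smooth_on_frechet_derivative[OF W])
  moreover have "dder X W p = (\<Sum>j\<in>UNIV. X p $ j *\<^sub>R frechet_derivative W (at p) (axis j 1))" if "p \<in> U" for p
    unfolding dder_def
    by (rule linear_as_sum_axis[OF linear_frechet_derivative[OF smooth_on_differentiable[OF W that]]])
  ultimately show ?thesis using smooth_on_cong[OF U] by (metis (no_types, lifting))
qed

text \<open>The frame vectors are rows, so that \<open>y v* frame f C p\<close> is the ambient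
  vector with coordinates \<open>y\<close>.\<close>

definition frame :: "(real ^ 'm \<Rightarrow> real ^ ('m::finite option)) \<Rightarrow> (real ^ 'm \<Rightarrow> real ^ ('m option))
    \<Rightarrow> real ^ 'm \<Rightarrow> real ^ ('m option) ^ ('m option)" where
  "frame f C p = (\<chi> i. case i of None \<Rightarrow> C p | Some j \<Rightarrow> frechet_derivative f (at p) (axis j 1))"

definition metric_matrix :: "(real ^ 'm \<Rightarrow> real ^ ('m::finite option)) \<Rightarrow> (real ^ 'm \<Rightarrow> real ^ ('m option))
    \<Rightarrow> real ^ 'm \<Rightarrow> real ^ 'm ^ 'm" where
  "metric_matrix f C p = (\<chi> i j. affine_metric f C (\<lambda>_. axis i 1) (\<lambda>_. axis j 1) p)"

lemma vector_matrix_mult_rows: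
  "x v* (A :: real^'n^'m) = (\<Sum>i\<in>UNIV. x $ i *\<^sub>R A $ i)"
  by (simp add: vec_eq_iff vector_matrix_mult_def mult.commute)

section \<open>The Gauss formula for a transversal field\<close>

locale transversal_immersion =
  fixes U :: "(real ^ 'm) set" and f :: "real ^ 'm \<Rightarrow> real ^ ('m::finite option)"
    and C :: "real ^ 'm \<Rightarrow> real ^ ('m option)"
  assumes imm: "immersion_on U f" and transv: "transversal_on U f C"
begin

lemma openU: "open U" and smooth_f: "smooth_on U f" and smooth_C: "smooth_on U C"
  using imm transv by (auto simp: immersion_on_def transversal_on_def)

lemma linear_df: "p \<in> U \<Longrightarrow> linear (frechet_derivative f (at p))"
  using linear_frechet_derivative smooth_on_differentiable[OF smooth_f] by blast

lemma inj_df: "p \<in> U \<Longrightarrow> inj (frechet_derivative f (at p))"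
  using imm by (simp add: immersion_on_def)

lemma vmult_frame:
  assumes "p \<in> U"
  shows "y v* frame f C p = frechet_derivative f (at p) (drop_None y) + y $ None *\<^sub>R C p"
  using linear_as_sum_axis[OF linear_df[OF assms], of "drop_None y"]
  by (simp add: vector_matrix_mult_rows UNIV_option_sum frame_def add.commute)

lemma df_tangent_eq:
  assumes p: "p \<in> U" and e: "frechet_derivative f (at p) v + a *\<^sub>R C p = frechet_derivative f (at p) w + b *\<^sub>R C p"
  shows "v = w \<and> a = b"
proof -
  have d: "(a - b) *\<^sub>R C p = frechet_derivative f (at p) (w - v)"
    unfolding linear_diff[OF linear_df[OF p]] using e by (simp add: algebra_simps)
  have "a = b"
  proof (rule ccontr)
    assume ne: "a \<noteq> b"
    then have "C p = inverse (a - b) *\<^sub>R ((a - b) *\<^sub>R C p)" by simp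
    then have "C p = frechet_derivative f (at p) (inverse (a - b) *\<^sub>R (w - v))"
      unfolding d by (simp add: linear_scale[OF linear_df[OF p]])
    then show False using transv p by (auto simp: transversal_on_def tangent_space_def)
  qed
  then show ?thesis using e injD[OF inj_df[OF p]] by auto
qed

lemma invertible_frame:
  assumes p: "p \<in> U"
  shows "invertible (frame f C p)"
proof -
  have "y = 0" if "y v* frame f C p = 0" for y
  proof -
    have "frechet_derivative f (at p) (drop_None y) + y $ None *\<^sub>R C p
        = frechet_derivative f (at p) 0 + 0 *\<^sub>R C p"
      using that vmult_frame[OF p, of y] linear_0[OF linear_df[OF p]] by simp
    then have "drop_None y = 0" "y $ None = 0" using df_tangent_eq[OF p] by blast+
    then show ?thesis using hat_drop_None[of y] by (simp add: vec_eq_iff all_option)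
  qed
  then have "\<forall>y. transpose (frame f C p) *v y = 0 \<longrightarrow> y = 0" by simp
  then have "invertible (transpose (frame f C p))"
    by (simp add: invertible_left_inverse matrix_left_invertible_ker)
  then show ?thesis by (simp add: invertible_det_nz)
qed

text \<open>The inverse frame computes both components by linear algebra, which replaces the
  descriptions by \<open>THE\<close> and makes smoothness in \<open>p\<close> visible.\<close>

lemma
  assumes p: "p \<in> U"
  shows tangential_part_eq: "tangential_part f C p w = drop_None (w v* matrix_inv (frame f C p))"
    and transversal_part_eq: "transversal_part f C p w = (w v* matrix_inv (frame f C p)) $ None"
    and tangential_transversal_decomp:
      "w = frechet_derivative f (at p) (tangential_part f C p w) + transversal_part f C p w *\<^sub>R C p"
proof -
  let ?y = "w v* matrix_inv (frame f C p)"
  have w: "w = frechet_derivative f (at p) (drop_None ?y) + ?y $ None *\<^sub>R C p"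
    using vmult_frame[OF p, of ?y] matrix_inv_left_right[OF invertible_frame[OF p]]
    by (simp add: vector_matrix_mul_assoc)
  show 1: "tangential_part f C p w = drop_None ?y"
    unfolding tangential_part_def
    by (rule the_equality) (use w df_tangent_eq[OF p] in metis)+
  show 2: "transversal_part f C p w = ?y $ None"
    unfolding transversal_part_def
    by (rule the_equality) (use w df_tangent_eq[OF p] in metis)+
  show "w = frechet_derivative f (at p) (tangential_part f C p w) + transversal_part f C p w *\<^sub>R C p"
    using w unfolding 1 2 .
qed

lemma
  assumes p: "p \<in> U" and w: "w = frechet_derivative f (at p) v + a *\<^sub>R C p"
  shows tangential_partI: "tangential_part f C p w = v"
    and transversal_partI: "transversal_part f C p w = a"
  using df_tangent_eq[OF p] tangential_transversal_decomp[OF p, of w] w by metis+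

lemma smooth_matrix_inv_frame: "smooth_on U (\<lambda>p. matrix_inv (frame f C p))"
  and smooth_frame: "smooth_on U (frame f C)"
proof -
  have row: "smooth_on U (\<lambda>p. frame f C p $ i)" for i
    by (cases i) (simp_all add: frame_def smooth_C smooth_on_frechet_derivative smooth_f)
  show "smooth_on U (frame f C)" by (rule smooth_on_vecI[OF openU row])
  then show "smooth_on U (\<lambda>p. matrix_inv (frame f C p))"
    by (rule smooth_on_matrix_inv[OF openU]) (rule invertible_frame)
qed

lemma smooth_tangential_part:
  assumes "smooth_on U W" shows "smooth_on U (\<lambda>p. tangential_part f C p (W p))"
proof -
  have "smooth_on U (\<lambda>p. drop_None (W p v* matrix_inv (frame f C p)))"
    by (intro smooth_on_linear[OF openU bounded_linear_drop_None]
        smooth_on_bilinear[OF openU bounded_bilinear_vector_matrix_mult] assms smooth_matrix_inv_frame)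
  then show ?thesis by (subst smooth_on_cong[OF openU tangential_part_eq])
qed

lemma smooth_transversal_part:
  assumes "smooth_on U W" shows "smooth_on U (\<lambda>p. transversal_part f C p (W p))"
proof -
  have "smooth_on U (\<lambda>p. (W p v* matrix_inv (frame f C p)) $ None)"
    by (intro smooth_on_vec_nth[OF openU]
        smooth_on_bilinear[OF openU bounded_bilinear_vector_matrix_mult] assms smooth_matrix_inv_frame)
  then show ?thesis by (subst smooth_on_cong[OF openU transversal_part_eq])
qed

lemma tangential_part_add: "p \<in> U \<Longrightarrow> tangential_part f C p (v + w) = tangential_part f C p v + tangential_part f C p w"
  and tangential_part_scale: "p \<in> U \<Longrightarrow> tangential_part f C p (a *\<^sub>R v) = a *\<^sub>R tangential_part f C p v"
  and transversal_part_add: "p \<in> U \<Longrightarrow> transversal_part f C p (v + w) = transversal_part f C p v + transversal_part f C p w"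
  and transversal_part_scale: "p \<in> U \<Longrightarrow> transversal_part f C p (a *\<^sub>R v) = a * transversal_part f C p v"
  by (simp_all add: tangential_part_eq transversal_part_eq vec_eq_iff vector_matrix_mult_def
      algebra_simps sum.distrib sum_distrib_left)

text \<open>The product rule for \<open>df\<close> applied to a field: one term with the field
  frozen at \<open>p\<close>, one with its derivative. The field is expanded in constant ones,
  because only the maps \<open>df\<close> on a fixed vector are available as smooth maps.\<close>

lemma push_has_derivative:
  assumes p: "p \<in> U" and Y: "Y differentiable at p"
  shows "(push f Y has_derivative (\<lambda>u. frechet_derivative (\<lambda>q. frechet_derivative f (at q) (Y p)) (at p) u
      + frechet_derivative f (at p) (frechet_derivative Y (at p) u))) (at p)"
proof -
  let ?d = "\<lambda>j q. frechet_derivative f (at q) (axis j 1)"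
  have eq: "push f Y q = (\<Sum>j\<in>UNIV. Y q $ j *\<^sub>R ?d j q)" if "q \<in> U" for q
    unfolding push_def by (rule linear_as_sum_axis[OF linear_df[OF that]])
  have dd: "(?d j has_derivative frechet_derivative (?d j) (at p)) (at p)" for j
    by (rule smooth_on_has_derivative[OF smooth_on_frechet_derivative[OF smooth_f] p])
  have Yd: "((\<lambda>q. Y q $ j) has_derivative (\<lambda>u. frechet_derivative Y (at p) u $ j)) (at p)" for j
    by (rule bounded_linear.has_derivative[OF bounded_linear_vec_nth has_frechet_derivative[OF Y]])
  have "((\<lambda>q. \<Sum>j\<in>UNIV. Y q $ j *\<^sub>R ?d j q) has_derivative (\<lambda>u. \<Sum>j\<in>UNIV.
      Y p $ j *\<^sub>R frechet_derivative (?d j) (at p) u + (frechet_derivative Y (at p) u $ j) *\<^sub>R ?d j p)) (at p)"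
    by (intro has_derivative_sum bounded_bilinear.FDERIV[OF bounded_bilinear_scaleR] Yd dd)
  moreover have "(\<Sum>j\<in>UNIV. Y p $ j *\<^sub>R frechet_derivative (?d j) (at p) u + (frechet_derivative Y (at p) u $ j) *\<^sub>R ?d j p)
     = frechet_derivative (\<lambda>q. frechet_derivative f (at q) (Y p)) (at p) u
      + frechet_derivative f (at p) (frechet_derivative Y (at p) u)" for u
  proof -
    have "((\<lambda>q. \<Sum>j\<in>UNIV. Y p $ j *\<^sub>R ?d j q) has_derivative
       (\<lambda>u. \<Sum>j\<in>UNIV. Y p $ j *\<^sub>R frechet_derivative (?d j) (at p) u)) (at p)"
      by (intro has_derivative_sum bounded_linear.has_derivative[OF bounded_linear_scaleR_right] dd)
    moreover have "frechet_derivative (\<lambda>q. frechet_derivative f (at q) (Y p)) (at p)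
       = frechet_derivative (\<lambda>q. \<Sum>j\<in>UNIV. Y p $ j *\<^sub>R ?d j q) (at p)"
      by (rule frechet_derivative_cong_open[OF openU p]) (rule linear_as_sum_axis[OF linear_df])
    ultimately have "frechet_derivative (\<lambda>q. frechet_derivative f (at q) (Y p)) (at p) u
        = (\<Sum>j\<in>UNIV. Y p $ j *\<^sub>R frechet_derivative (?d j) (at p) u)"
      by (simp add: frechet_derivative_eqI)
    then show ?thesis
      using linear_as_sum_axis[OF linear_df[OF p], of "frechet_derivative Y (at p) u"]
      by (simp add: sum.distrib)
  qed
  ultimately show ?thesis
    using has_derivative_transform_within_open[OF _ openU p eq[symmetric]] by simp
qed

lemma dder_push:
  assumes "p \<in> U" "Y differentiable at p"
  shows "dder X (push f Y) p = dder (\<lambda>_. X p) (push f (\<lambda>_. Y p)) p + frechet_derivative f (at p) (dder X Y p)"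
  using frechet_derivative_eqI[OF push_has_derivative[OF assms]]
  by (simp add: dder_def) (simp add: push_def[abs_def])

text \<open>The derivative of \<open>Y\<close> enters \<open>dder_push\<close> only through a
  tangential vector, which the transversal component does not see; hence \<open>h\<close> is a
  tensor.\<close>

lemma affine_metric_pointwise:
  assumes p: "p \<in> U" and Y: "Y differentiable at p"
  shows "affine_metric f C X Y p = affine_metric f C (\<lambda>_. X p) (\<lambda>_. Y p) p"
proof -
  have "transversal_part f C p (frechet_derivative f (at p) v) = 0" for v
    by (rule transversal_partI[OF p, of _ v]) simp
  then show ?thesis
    unfolding affine_metric_def dder_push[OF assms] by (simp add: transversal_part_add[OF p])
qed

lemma smooth_push: "smooth_on U Y \<Longrightarrow> smooth_on U (push f Y)"
  using smooth_on_dder[OF openU _ smooth_f, of Y] by (simp add: dder_def[abs_def] push_def[abs_def])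

lemma smooth_induced_connection:
  "smooth_on U X \<Longrightarrow> smooth_on U Y \<Longrightarrow> smooth_on U (induced_connection f C X Y)"
  unfolding induced_connection_def[abs_def]
  by (intro smooth_tangential_part smooth_on_dder openU smooth_push)

lemma smooth_affine_metric:
  "smooth_on U X \<Longrightarrow> smooth_on U Y \<Longrightarrow> smooth_on U (affine_metric f C X Y)"
  unfolding affine_metric_def[abs_def]
  by (intro smooth_transversal_part smooth_on_dder openU smooth_push)

definition hess where "hess p u v = frechet_derivative (\<lambda>q. frechet_derivative f (at q) v) (at p) u"

lemma dder_const_push: "dder (\<lambda>_. u) (push f (\<lambda>_. v)) p = hess p u v"
  by (simp add: dder_def push_def[abs_def] hess_def)

lemma hess_decomp:
  assumes "p \<in> U"
  shows "hess p u v = frechet_derivative f (at p) (induced_connection f C (\<lambda>_. u) (\<lambda>_. v) p)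
    + affine_metric f C (\<lambda>_. u) (\<lambda>_. v) p *\<^sub>R C p"
  using tangential_transversal_decomp[OF assms, of "hess p u v"]
  by (simp add: induced_connection_def affine_metric_def dder_const_push)

lemma hess_sym: "p \<in> U \<Longrightarrow> hess p u v = hess p v u"
  unfolding hess_def by (rule second_derivative_symmetric[OF openU _ smooth_f])

lemma hess_add: "p \<in> U \<Longrightarrow> hess p (u + u') v = hess p u v + hess p u' v"
  and hess_scale: "p \<in> U \<Longrightarrow> hess p (a *\<^sub>R u) v = a *\<^sub>R hess p u v"
  using linear_frechet_derivative[OF smooth_on_differentiable[OF smooth_on_frechet_derivative[OF smooth_f]]]
  by (auto simp: hess_def linear_add linear_scale)

lemma bilinear_hess: "p \<in> U \<Longrightarrow> bilinear (hess p)"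
  unfolding bilinear_def by (auto intro!: linearI simp: hess_add hess_scale)
     (metis hess_add hess_sym, metis hess_scale hess_sym)

abbreviation metric where "metric p u v \<equiv> affine_metric f C (\<lambda>_. u) (\<lambda>_. v) p"
abbreviation conn where "conn p u v \<equiv> induced_connection f C (\<lambda>_. u) (\<lambda>_. v) p"

lemma metric_hess: "metric p u v = transversal_part f C p (hess p u v)"
  by (simp add: affine_metric_def dder_const_push)

lemma conn_hess: "conn p u v = tangential_part f C p (hess p u v)"
  by (simp add: induced_connection_def dder_const_push)

lemma metric_sym: "p \<in> U \<Longrightarrow> metric p u v = metric p v u"
  and conn_sym: "p \<in> U \<Longrightarrow> conn p u v = conn p v u"
  by (simp_all add: metric_hess conn_hess hess_sym)

lemma bilinear_metric: "p \<in> U \<Longrightarrow> bilinear (metric p)"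
  and bilinear_conn: "p \<in> U \<Longrightarrow> bilinear (conn p)"
proof -
  assume p: "p \<in> U"
  note h = bilinear_hess[OF p]
  show "bilinear (metric p)" "bilinear (conn p)"
    unfolding bilinear_def metric_hess conn_hess
    by (auto intro!: linearI simp: transversal_part_add[OF p] transversal_part_scale[OF p]
        tangential_part_add[OF p] tangential_part_scale[OF p]
        bilinear_ladd[OF h] bilinear_radd[OF h] bilinear_lmul[OF h] bilinear_rmul[OF h])
qed

section \<open>The two volume forms\<close>

lemma bilinear_as_matrix:
  assumes "bilinear (B :: real ^ 'm \<Rightarrow> real ^ 'm \<Rightarrow> real)"
  shows "B u v = (\<Sum>i\<in>UNIV. \<Sum>j\<in>UNIV. u $ i * v $ j * B (axis i 1) (axis j 1))"
proof -
  have "B u v = (\<Sum>i\<in>UNIV. u $ i *\<^sub>R B (axis i 1) v)"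
    using assms by (intro linear_as_sum_axis[of "\<lambda>u. B u v"]) (simp add: bilinear_def)
  also have "(\<lambda>i. B (axis i 1) v) = (\<lambda>i. \<Sum>j\<in>UNIV. v $ j *\<^sub>R B (axis i 1) (axis j 1))"
    using assms by (intro ext linear_as_sum_axis) (simp add: bilinear_def)
  finally show ?thesis by (simp add: sum_distrib_left mult.assoc)
qed

lemma det_metric:
  assumes p: "p \<in> U" and X: "\<And>i. X i differentiable at p"
  shows "det (\<chi> i j. affine_metric f C (X i) (X j) p) = (det (\<chi> i. X i p))\<^sup>2 * det (metric_matrix f C p)"
proof -
  let ?X = "\<chi> i. X i p"
  have "(\<chi> i j. affine_metric f C (X i) (X j) p) = ?X ** metric_matrix f C p ** transpose ?X"
  proof -
    have "affine_metric f C (X i) (X j) p = (?X ** metric_matrix f C p ** transpose ?X) $ i $ j" for i j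
      unfolding affine_metric_pointwise[OF p X] bilinear_as_matrix[OF bilinear_metric[OF p], of "X i p"]
      by (simp add: matrix_matrix_mult_def transpose_def metric_matrix_def sum_distrib_right, subst sum.swap)
        (simp add: ac_simps)
    then show ?thesis by (simp add: vec_eq_iff)
  qed
  then show ?thesis by (simp add: det_mul power2_eq_square)
qed

lemma Theta_eq:
  assumes p: "p \<in> U"
  shows "Theta f C X p = det (\<chi> i. X i p) * det (frame f C p)"
proof -
  have "(\<chi> i. case i of None \<Rightarrow> C p | Some j \<Rightarrow> push f (X j) p) = block_mat 1 (\<chi> i. X i p) ** frame f C p"
  proof -
    have "(block_mat 1 (\<chi> i. X i p) ** frame f C p) $ i = (block_mat 1 (\<chi> i. X i p)) $ i v* frame f C p" for i
      by (simp add: vec_eq_iff matrix_matrix_mult_def vector_matrix_mult_def mult.commute)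
    moreover have "block_mat 1 (\<chi> i. X i p) $ None = axis None 1"
      "block_mat 1 (\<chi> i. X i p) $ Some j = hat (X j p)" for j
      by (simp_all add: vec_eq_iff all_option block_mat_def axis_def)
    ultimately show ?thesis
      using linear_0[OF linear_df[OF p]]
      by (simp add: vec_eq_iff[of "\<chi> i. _ i"] all_option vmult_frame[OF p] push_def drop_None_def axis_def
          zero_vec_def[symmetric] vec_eq_iff)
  qed
  then show ?thesis by (simp add: Theta_def det_mul det_block_mat)
qed

lemma metric_volume_eq:
  assumes p: "p \<in> U" and X: "\<And>i. X i differentiable at p"
  shows "metric_volume f C X p = sgn (Theta f C X p) * (\<bar>det (\<chi> i. X i p)\<bar> * sqrt \<bar>det (metric_matrix f C p)\<bar>)"
  by (simp add: metric_volume_def det_metric[OF assms] abs_mult real_sqrt_mult)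

lemma det_frame_nz: "p \<in> U \<Longrightarrow> det (frame f C p) \<noteq> 0"
  using invertible_frame by (simp add: invertible_det_nz)

text \<open>By \<open>det_metric\<close> and \<open>Theta_eq\<close> both sides depend on
  \<open>X\<close> only through the determinant of its coefficient matrix. The volume condition on
  all fields is therefore one equation for the coordinate frame.\<close>

lemma metric_volume_eq_Theta:
  assumes p: "p \<in> U" and X: "\<And>i. X i differentiable at p"
    and d: "\<bar>det (metric_matrix f C p)\<bar> = (det (frame f C p))\<^sup>2"
  shows "metric_volume f C X p = Theta f C X p"
  unfolding metric_volume_eq[OF p X] d Theta_eq[OF p]
  by (simp add: abs_sgn_eq flip: abs_mult sgn_mult) (simp add: abs_mult_sgn mult.commute flip: abs_mult)

lemma metric_volume_eq_ThetaD:
  assumes p: "p \<in> U" and e: "metric_volume f C (\<lambda>i _. axis i 1) p = Theta f C (\<lambda>i _. axis i 1) p"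
  shows "\<bar>det (metric_matrix f C p)\<bar> = (det (frame f C p))\<^sup>2"
proof -
  have 1: "(\<chi> i. axis i 1) = (mat 1 :: real^'m^'m)" by (auto simp: vec_eq_iff axis_def mat_def)
  have "metric_volume f C (\<lambda>i _. axis i 1) p = sgn (det (frame f C p)) * sqrt \<bar>det (metric_matrix f C p)\<bar>"
    by (subst metric_volume_eq[OF p]) (simp_all add: Theta_eq[OF p] 1)
  then have "\<bar>sgn (det (frame f C p)) * sqrt \<bar>det (metric_matrix f C p)\<bar>\<bar> = \<bar>det (frame f C p)\<bar>"
    using e by (simp add: Theta_eq[OF p] 1)
  then have "sqrt \<bar>det (metric_matrix f C p)\<bar> = \<bar>det (frame f C p)\<bar>"
    using det_frame_nz[OF p] by (simp add: abs_mult abs_sgn_eq)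
  then have "(sqrt \<bar>det (metric_matrix f C p)\<bar>)\<^sup>2 = \<bar>det (frame f C p)\<bar>\<^sup>2" by simp
  then show ?thesis by simp
qed

end

lemma has_derivative_vecI:
  fixes R :: "'a::real_normed_vector \<Rightarrow> 'b::euclidean_space ^ 'n"
  assumes "\<And>i. ((\<lambda>q. R q $ i) has_derivative (\<lambda>u. R' u $ i)) (at p)"
  shows "(R has_derivative R') (at p)"
proof -
  have sum: "(\<Sum>i\<in>UNIV. axis i (x $ i)) = x" for x :: "'b ^ 'n"
    by (simp add: vec_eq_iff axis_def if_distrib cong: if_cong)
  have "((\<lambda>q. \<Sum>i\<in>UNIV. axis i (R q $ i)) has_derivative (\<lambda>u. \<Sum>i\<in>UNIV. axis i (R' u $ i))) (at p)"
    by (rule has_derivative_sum, rule bounded_linear.has_derivative[OF bounded_linear_axis assms])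
  then show ?thesis by (simp add: sum)
qed

context transversal_immersion
begin

text \<open>Differentiation row by row: the transversal part of a differentiated tangent row is
  absorbed by the row \<open>C\<close>, the tangential part of the differentiated \<open>C\<close>
  by the tangent rows. So the covariant derivative of \<open>Theta\<close> is \<tau> times
  \<open>Theta\<close>, and \<open>Theta\<close> is parallel exactly when \<tau> vanishes.\<close>

lemma dder_Theta:
  assumes p: "p \<in> U" and X: "\<And>i. X i differentiable at p"
  shows "dder Z (Theta f C X) p = (\<Sum>i\<in>UNIV. Theta f C (X(i := induced_connection f C Z (X i))) p)
    + transversal_part f C p (dder Z C p) * Theta f C X p"
proof -
  define R where "R q = (\<chi> i. case i of None \<Rightarrow> C q | Some j \<Rightarrow> push f (X j) q)" for q
  define R' where "R' = (\<chi> i. case i of None \<Rightarrow> dder Z C p | Some j \<Rightarrow> dder Z (push f (X j)) p)"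
  have row: "((\<lambda>q. R q $ i) has_derivative (\<lambda>u. (\<chi> i. case i of None \<Rightarrow> frechet_derivative C (at p) u
      | Some j \<Rightarrow> frechet_derivative (push f (X j)) (at p) u) $ i)) (at p)" for i
    using smooth_on_has_derivative[OF smooth_C p] has_frechet_derivative[OF differentiableI[OF push_has_derivative[OF p X]]]
    by (cases i) (simp_all add: R_def)
  have "(R has_derivative (\<lambda>u. \<chi> i. case i of None \<Rightarrow> frechet_derivative C (at p) u
      | Some j \<Rightarrow> frechet_derivative (push f (X j)) (at p) u)) (at p)"
    by (rule has_derivative_vecI) (rule row)
  from det_has_derivative[OF this] have der: "dder Z (Theta f C X) p = ddet (R p) R'"
    unfolding dder_def R'_def Theta_def[abs_def] R_def[symmetric] by (simp add: frechet_derivative_eqI)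
  have Some: "det (\<chi> r. if r = Some i then R' $ r else R p $ r)
      = Theta f C (X(i := induced_connection f C Z (X i))) p" for i
  proof -
    let ?n = "induced_connection f C Z (X i) p" and ?h = "affine_metric f C Z (X i) p"
    have R': "R' $ Some i = frechet_derivative f (at p) ?n + ?h *s C p"
      unfolding scalar_mult_eq_scaleR induced_connection_def affine_metric_def
      by (rule trans[OF _ tangential_transversal_decomp[OF p]]) (simp add: R'_def)
    have "det (\<chi> r. if r = Some i then R' $ r else R p $ r) =
        det (\<chi> r. if r = Some i then frechet_derivative f (at p) ?n else R p $ r)
        + ?h * det (\<chi> r. if r = Some i then C p else R p $ r)"
      using det_row_add[of "Some i" "\<lambda>_. frechet_derivative f (at p) ?n" "\<lambda>_. ?h *s C p" "\<lambda>r. R p $ r"]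
        det_row_mul[of "Some i" ?h "\<lambda>_. C p" "\<lambda>r. R p $ r"] R'
      by (simp cong: if_cong)
    moreover have "det (\<chi> r. if r = Some i then C p else R p $ r) = 0"
      by (rule det_identical_rows[of None "Some i"]) (auto simp: row_def R_def vec_eq_iff)
    moreover have "(\<chi> r. if r = Some i then frechet_derivative f (at p) ?n else R p $ r) =
       (\<chi> r. case r of None \<Rightarrow> C p | Some j \<Rightarrow> push f ((X(i := induced_connection f C Z (X i))) j) p)"
      by (simp add: vec_eq_iff all_option R_def push_def)
    ultimately show ?thesis unfolding Theta_def by (simp only: add_0_right mult_zero_right)
  qed
  have None: "det (\<chi> r. if r = None then R' $ r else R p $ r)
      = transversal_part f C p (dder Z C p) * Theta f C X p"
  proof -
    let ?v = "tangential_part f C p (dder Z C p)" and ?t = "transversal_part f C p (dder Z C p)"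
    have R': "R' $ None = frechet_derivative f (at p) ?v + ?t *s C p"
      unfolding scalar_mult_eq_scaleR
      by (rule trans[OF _ tangential_transversal_decomp[OF p]]) (simp add: R'_def)
    have "det (\<chi> r. if r = None then R' $ r else R p $ r) =
        det (\<chi> r. if r = None then frechet_derivative f (at p) ?v else R p $ r)
        + ?t * det (\<chi> r. if r = None then C p else R p $ r)"
      using det_row_add[of None "\<lambda>_. frechet_derivative f (at p) ?v" "\<lambda>_. ?t *s C p" "\<lambda>r. R p $ r"]
        det_row_mul[of None ?t "\<lambda>_. C p" "\<lambda>r. R p $ r"] R'
      by (simp cong: if_cong)
    moreover have "(\<chi> r. if r = None then C p else R p $ r) = R p"
      by (simp add: vec_eq_iff all_option R_def)
    \<comment> \<open>All rows are now tangent vectors, so the coordinate matrix \<open>?Y\<close>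
      has a zero column at \<open>None\<close>.\<close>
    moreover have "det (\<chi> r. if r = None then frechet_derivative f (at p) ?v else R p $ r) = 0"
    proof -
      let ?Y = "\<chi> i. case i of None \<Rightarrow> hat ?v | Some j \<Rightarrow> hat (X j p)"
      have "(?Y ** frame f C p) $ i = ?Y $ i v* frame f C p" for i
        by (simp add: vec_eq_iff matrix_matrix_mult_def vector_matrix_mult_def mult.commute)
      then have "(\<chi> r. if r = None then frechet_derivative f (at p) ?v else R p $ r) = ?Y ** frame f C p"
        by (simp add: vec_eq_iff[of "\<chi> i. _ i"] all_option vmult_frame[OF p] R_def push_def)
      moreover have "det ?Y = 0"
        by (rule det_zero_column(1)[of None]) (simp add: column_def vec_eq_iff all_option)
      ultimately show ?thesis by (simp add: det_mul)
    qed
    ultimately show ?thesis by (simp add: Theta_def R_def)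
  qed
  show ?thesis unfolding der ddet_def UNIV_option_sum Some None by simp
qed

text \<open>The first condition includes that the transversal connection form vanishes; for Blaschke
  fields this follows from the parallel volume form.\<close>
definition sphere_data :: "real \<Rightarrow> bool" where
  "sphere_data \<kappa> \<longleftrightarrow>
    (\<forall>p\<in>U. \<forall>v. frechet_derivative C (at p) v = - \<kappa> *\<^sub>R frechet_derivative f (at p) v) \<and>
    (\<forall>p\<in>U. \<forall>u. (\<forall>v. metric p u v = 0) \<longrightarrow> u = 0) \<and>
    (\<forall>p\<in>U. \<bar>det (metric_matrix f C p)\<bar> = (det (frame f C p))\<^sup>2)"

text \<open>A field with \<open>dC = - \<kappa> df\<close> has \<tau> = 0, so \<open>Theta\<close>
  is parallel; the determinant equation identifies it with the metric volume.\<close>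

lemma affine_hypersphere_withI:
  assumes "sphere_data \<kappa>"
  shows "affine_hypersphere_with U f C \<kappa>"
proof -
  have dC: "dder Z C p = frechet_derivative f (at p) (- \<kappa> *\<^sub>R Z p) + 0 *\<^sub>R C p" if "p \<in> U" for Z p
    using assms that by (simp add: sphere_data_def dder_def linear_neg[OF linear_df] linear_scale[OF linear_df])
  have vol: "metric_volume f C X p = Theta f C X p" if "p \<in> U" "\<And>i. X i differentiable at p" for X p
    using metric_volume_eq_Theta[OF that] assms that by (simp add: sphere_data_def)
  have "dder Z (metric_volume f C X) p - (\<Sum>i\<in>UNIV. metric_volume f C (X(i := induced_connection f C Z (X i))) p) = 0"
    if Z: "smooth_on U Z" and X: "\<And>i. smooth_on U (X i)" and p: "p \<in> U" for Z X p
  proof -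
    have "frechet_derivative (metric_volume f C X) (at p) = frechet_derivative (Theta f C X) (at p)"
      by (rule frechet_derivative_cong_open[OF openU p], rule vol, assumption, rule smooth_on_differentiable[OF X])
    then have 1: "dder Z (metric_volume f C X) p = dder Z (Theta f C X) p" by (simp add: dder_def)
    have 2: "metric_volume f C (X(i := induced_connection f C Z (X i))) p
        = Theta f C (X(i := induced_connection f C Z (X i))) p" for i
      by (rule vol[OF p])
        (simp add: smooth_on_differentiable[OF X p] smooth_on_differentiable[OF smooth_induced_connection[OF Z X] p])
    show ?thesis
      unfolding 1 2 dder_Theta[OF p smooth_on_differentiable[OF X p]]
      using transversal_partI[OF p dC[OF p]] by simp
  qed
  then have par: "parallel_form U (induced_connection f C) (metric_volume f C)"
    by (simp add: parallel_form_def)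
  have ndeg: "nondegenerate_on U f C" using assms by (simp add: nondegenerate_on_def sphere_data_def)
  have vol': "\<forall>X. (\<forall>i. smooth_on U (X i)) \<longrightarrow> (\<forall>p\<in>U. metric_volume f C X p = Theta f C X p)"
  proof (intro allI impI ballI)
    fix X :: "'m \<Rightarrow> real^'m \<Rightarrow> real^'m" and p assume X: "\<forall>i. smooth_on U (X i)" and p: "p \<in> U"
    show "metric_volume f C X p = Theta f C X p"
      by (rule vol[OF p smooth_on_differentiable[OF X[rule_format] p]])
  qed
  have shape: "\<forall>X. smooth_on U X \<longrightarrow> (\<forall>p\<in>U. shape_operator f C X p = \<kappa> *\<^sub>R X p)"
  proof (intro allI impI ballI)
    fix X :: "real^'m \<Rightarrow> real^'m" and p assume p: "p \<in> U"
    show "shape_operator f C X p = \<kappa> *\<^sub>R X p"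
      unfolding shape_operator_def tangential_partI[OF p dC[OF p]] by simp
  qed
  show ?thesis
    unfolding affine_hypersphere_with_def blaschke_field_def
    by (intro conjI imm transv ndeg par vol' shape)
qed

end

text \<open>On coordinate fields the parallel volume condition, compared with
  \<open>dder_Theta\<close>, leaves \<tau> times \<open>Theta\<close> equal to zero. With \<tau>
  gone, the shape operator is the whole derivative of \<open>C\<close>.\<close>

lemma affine_hypersphere_withD:
  fixes f :: "real ^ 'm \<Rightarrow> real ^ ('m::finite option)"
  assumes h: "affine_hypersphere_with U f C \<kappa>"
  shows "transversal_immersion U f C" "transversal_immersion.sphere_data U f C \<kappa>"
proof -
  have "immersion_on U f" "transversal_on U f C"
    using h by (simp_all add: affine_hypersphere_with_def blaschke_field_def)
  then interpret transversal_immersion U f C by unfold_locales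
  show "transversal_immersion U f C" by unfold_locales
  have par: "parallel_form U (induced_connection f C) (metric_volume f C)"
    and ndeg: "nondegenerate_on U f C"
    and vol: "\<And>X p. (\<And>i. smooth_on U (X i)) \<Longrightarrow> p \<in> U \<Longrightarrow> metric_volume f C X p = Theta f C X p"
    and S: "\<And>X p. smooth_on U X \<Longrightarrow> p \<in> U \<Longrightarrow> shape_operator f C X p = \<kappa> *\<^sub>R X p"
    using h by (auto simp: affine_hypersphere_with_def blaschke_field_def)
  let ?E = "\<lambda>i _. axis i 1"
  have E: "smooth_on U (?E i)" for i by (rule smooth_on_const)
  have d: "\<bar>det (metric_matrix f C p)\<bar> = (det (frame f C p))\<^sup>2" if "p \<in> U" for p
    by (rule metric_volume_eq_ThetaD[OF that vol[OF E that]])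
  have dC: "frechet_derivative C (at p) v = - \<kappa> *\<^sub>R frechet_derivative f (at p) v" if p: "p \<in> U" for p v
  proof -
    let ?Z = "\<lambda>_. v"
    have Z: "smooth_on U ?Z" by (rule smooth_on_const)
    have "frechet_derivative (metric_volume f C ?E) (at p) = frechet_derivative (Theta f C ?E) (at p)"
      by (rule frechet_derivative_cong_open[OF openU p vol[OF E]])
    then have 1: "dder ?Z (metric_volume f C ?E) p = dder ?Z (Theta f C ?E) p" by (simp add: dder_def)
    have 2: "metric_volume f C (?E(i := induced_connection f C ?Z (?E i))) p
        = Theta f C (?E(i := induced_connection f C ?Z (?E i))) p" for i
      by (rule vol[OF _ p]) (simp add: E smooth_induced_connection[OF Z E])
    have "dder ?Z (metric_volume f C ?E) p - (\<Sum>i\<in>UNIV. metric_volume f C (?E(i := induced_connection f C ?Z (?E i))) p) = 0"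
      by (rule par[unfolded parallel_form_def, rule_format, OF Z E p])
    then have "transversal_part f C p (dder ?Z C p) * Theta f C ?E p = 0"
      unfolding 1 2 dder_Theta[OF p smooth_on_differentiable[OF E p]] by simp
    moreover have "Theta f C ?E p \<noteq> 0"
    proof -
      have "(\<chi> i. axis i 1) = (mat 1 :: real^'m^'m)" by (auto simp: vec_eq_iff axis_def mat_def)
      then show ?thesis using det_frame_nz[OF p] by (simp add: Theta_eq[OF p])
    qed
    ultimately have n: "transversal_part f C p (dder ?Z C p) = 0" by simp
    have t: "tangential_part f C p (dder ?Z C p) = - \<kappa> *\<^sub>R v"
      using arg_cong[OF S[OF Z p], of uminus] by (simp add: shape_operator_def)
    have "dder ?Z C p = frechet_derivative f (at p) (- \<kappa> *\<^sub>R v)"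
      using tangential_transversal_decomp[OF p, of "dder ?Z C p", unfolded t n] by simp
    then show ?thesis using linear_scale[OF linear_df[OF p], of "- \<kappa>" v] by (simp add: dder_def)
  qed
  show "sphere_data \<kappa>"
    unfolding sphere_data_def
  proof (intro conjI ballI allI)
    fix p v assume "p \<in> U"
    then show "frechet_derivative C (at p) v = - \<kappa> *\<^sub>R frechet_derivative f (at p) v" by (rule dC)
  next
    fix p u assume "p \<in> U"
    then show "(\<forall>v. metric p u v = 0) \<longrightarrow> u = 0" using ndeg by (simp add: nondegenerate_on_def)
  next
    fix p assume "p \<in> U"
    then show "\<bar>det (metric_matrix f C p)\<bar> = (det (frame f C p))\<^sup>2" by (rule d)
  qed
qed

section \<open>Linear images of affine hyperspheres\<close>

lemma frechet_derivative_compose_linear: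
  fixes L :: "'b::euclidean_space \<Rightarrow> 'c::euclidean_space"
  assumes "linear L" "f differentiable at p"
  shows "frechet_derivative (L \<circ> f) (at p) v = L (frechet_derivative f (at p) v)"
  using frechet_derivative_linear[OF linear_conv_bounded_linear[THEN iffD1, OF assms(1)] assms(2)]
  by (simp add: o_def)

text \<open>\<open>L\<close> carries the Gauss formula of \<open>f\<close> to that of
  \<open>L \<circ> f\<close> with the same \<open>h\<close> and the same connection. Only the frame
  determinant changes, by the factor \<open>det (matrix L)\<close>, which disappears from its
  square.\<close>

lemma affine_hypersphere_with_linear_image:
  fixes f :: "real ^ 'm \<Rightarrow> real ^ ('m::finite option)"
  assumes h: "affine_hypersphere_with U f C \<kappa>" and V: "open V" "connected V" "V \<noteq> {}" "V \<subseteq> U"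
    and L: "linear L" "bij L" "\<bar>det (matrix L)\<bar> = 1"
  shows "affine_hypersphere_with V (L \<circ> f) (L \<circ> C) \<kappa>"
proof -
  interpret F: transversal_immersion U f C using affine_hypersphere_withD(1)[OF h] .
  have data: "F.sphere_data \<kappa>" using affine_hypersphere_withD(2)[OF h] .
  have bL: "bounded_linear L" using L(1) linear_conv_bounded_linear by blast
  have df: "frechet_derivative (L \<circ> f) (at p) = L \<circ> frechet_derivative f (at p)"
    and dC: "frechet_derivative (L \<circ> C) (at p) = L \<circ> frechet_derivative C (at p)" if "p \<in> V" for p
    using that V(4) by (auto simp: fun_eq_iff frechet_derivative_compose_linear[OF L(1)]
        smooth_on_differentiable[OF F.smooth_f] smooth_on_differentiable[OF F.smooth_C])
  have sm: "smooth_on V (L \<circ> g)" if "smooth_on U g" for g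
    using smooth_on_linear[OF V(1) bL smooth_on_subset[OF that V(4)]] by (simp add: o_def)
  interpret G: transversal_immersion V "L \<circ> f" "L \<circ> C"
  proof
    have "inj (frechet_derivative (L \<circ> f) (at p))" if "p \<in> V" for p
      unfolding df[OF that] using that V(4) by (intro inj_compose bij_is_inj[OF L(2)] F.inj_df) auto
    then show "immersion_on V (L \<circ> f)"
      by (simp add: immersion_on_def V sm[OF F.smooth_f])
    have "(L \<circ> C) p \<notin> tangent_space (L \<circ> f) p" if "p \<in> V" for p
    proof -
      have "C p \<notin> tangent_space f p" using F.transv that V(4) by (auto simp: transversal_on_def)
      then show ?thesis
        using injD[OF bij_is_inj[OF L(2)]] by (auto simp: tangent_space_def df[OF that])
    qed
    then show "transversal_on V (L \<circ> f) (L \<circ> C)"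
      by (simp add: transversal_on_def sm[OF F.smooth_C])
  qed
  have hess: "G.hess p u v = L (F.hess p u v)" if "p \<in> V" for p u v
  proof -
    have "frechet_derivative (\<lambda>q. frechet_derivative (L \<circ> f) (at q) v) (at p)
        = frechet_derivative (\<lambda>q. L (frechet_derivative f (at q) v)) (at p)"
      by (rule frechet_derivative_cong_open[OF V(1) that]) (simp add: df)
    moreover have "p \<in> U" using that V(4) by auto
    ultimately show ?thesis
      by (simp add: G.hess_def F.hess_def frechet_derivative_linear[OF bL
          smooth_on_differentiable[OF smooth_on_frechet_derivative[OF F.smooth_f]]])
  qed
  have metric: "G.metric p u v = F.metric p u v" if p: "p \<in> V" for p u v
    unfolding G.metric_hess
  proof (rule G.transversal_partI[OF p, of _ "F.conn p u v"])
    show "G.hess p u v = frechet_derivative (L \<circ> f) (at p) (F.conn p u v) + F.metric p u v *\<^sub>R (L \<circ> C) p"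
      unfolding hess[OF p] df[OF p] using p V(4)
      by (subst F.hess_decomp) (auto simp: linear_add[OF L(1)] linear_scale[OF L(1)])
  qed
  have "frame (L \<circ> f) (L \<circ> C) p = frame f C p ** transpose (matrix L)" if "p \<in> V" for p
  proof -
    have "L x = x v* transpose (matrix L)" for x
      using L(1) by (simp add: matrix_works)
    moreover have "(frame f C p ** transpose (matrix L)) $ i = frame f C p $ i v* transpose (matrix L)" for i
      by (simp add: vec_eq_iff matrix_matrix_mult_def vector_matrix_mult_def mult.commute)
    ultimately show ?thesis
      unfolding vec_eq_iff[of "frame _ _ _"] all_option by (simp add: frame_def df[OF that])
  qed
  then have fr: "(det (frame (L \<circ> f) (L \<circ> C) p))\<^sup>2 = (det (frame f C p))\<^sup>2" if "p \<in> V" for p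
    using that power2_abs[of "det (matrix L)"] by (simp add: det_mul power_mult_distrib L(3))
  have mm: "metric_matrix (L \<circ> f) (L \<circ> C) p = metric_matrix f C p" if "p \<in> V" for p
    using metric[OF that] by (simp add: metric_matrix_def)
  have "G.sphere_data \<kappa>"
    unfolding G.sphere_data_def
  proof (intro conjI ballI allI impI)
    fix p v assume p: "p \<in> V"
    then have "frechet_derivative C (at p) v = - \<kappa> *\<^sub>R frechet_derivative f (at p) v"
      using data V(4) by (auto simp: F.sphere_data_def)
    then show "frechet_derivative (L \<circ> C) (at p) v = - \<kappa> *\<^sub>R frechet_derivative (L \<circ> f) (at p) v"
      by (simp add: df[OF p] dC[OF p] linear_scale[OF L(1)] linear_neg[OF L(1)])
  next
    fix p u assume p: "p \<in> V" and "\<forall>v. G.metric p u v = 0"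
    then have "\<forall>v. F.metric p u v = 0" by (simp add: metric[OF p])
    moreover have "p \<in> U" using p V(4) by auto
    ultimately show "u = 0" using data by (simp add: F.sphere_data_def)
  next
    fix p assume p: "p \<in> V"
    moreover have "p \<in> U" using p V(4) by auto
    ultimately show "\<bar>det (metric_matrix (L \<circ> f) (L \<circ> C) p)\<bar> = (det (frame (L \<circ> f) (L \<circ> C) p))\<^sup>2"
      using data by (simp add: F.sphere_data_def fr mm)
  qed
  then show ?thesis by (rule G.affine_hypersphere_withI)
qed

section \<open>Reduced commutative real algebras\<close>

text \<open>Horner evaluation with \<open>e\<close> in the place of the constant 1: polynomials are
  evaluated inside the ideal of an idempotent \<open>e\<close>, whose unit is \<open>e\<close> and
  not that of the whole algebra.\<close>

definition aeval :: "('v \<Rightarrow> 'v \<Rightarrow> 'v) \<Rightarrow> 'v \<Rightarrow> 'v \<Rightarrow> real poly \<Rightarrow> 'v::real_vector" where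
  "aeval mul e a p = fold_coeffs (\<lambda>c x. c *\<^sub>R e + mul a x) p 0"

locale comm_algebra =
  fixes mul :: "'v::euclidean_space \<Rightarrow> 'v \<Rightarrow> 'v" (infixl \<open>\<odot>\<close> 70)
  assumes bil: "bilinear (\<odot>)" and comm: "x \<odot> y = y \<odot> x" and assoc: "x \<odot> y \<odot> z = x \<odot> (y \<odot> z)"
begin

lemma mul_simps:
  "(x + y) \<odot> z = x \<odot> z + y \<odot> z" "z \<odot> (x + y) = z \<odot> x + z \<odot> y"
  "(x - y) \<odot> z = x \<odot> z - y \<odot> z" "z \<odot> (x - y) = z \<odot> x - z \<odot> y"
  "(c *\<^sub>R x) \<odot> z = c *\<^sub>R (x \<odot> z)" "z \<odot> (c *\<^sub>R x) = c *\<^sub>R (z \<odot> x)"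
  "(- x) \<odot> z = - (x \<odot> z)" "z \<odot> (- x) = - (z \<odot> x)"
  "0 \<odot> z = 0" "z \<odot> 0 = 0"
  by (simp_all add: bilinear_ladd[OF bil] bilinear_radd[OF bil] bilinear_lsub[OF bil] bilinear_rsub[OF bil]
      bilinear_lmul[OF bil] bilinear_rmul[OF bil] bilinear_lneg[OF bil] bilinear_rneg[OF bil]
      bilinear_lzero[OF bil] bilinear_rzero[OF bil])

lemma mul_left_comm: "x \<odot> (y \<odot> z) = y \<odot> (x \<odot> z)"
  by (metis assoc comm)

lemmas mul_ac = assoc comm mul_left_comm

lemma linear_mul: "linear ((\<odot>) a)"
  using bil by (simp add: bilinear_def)

lemma mul_sum_right: "a \<odot> (\<Sum>i\<in>I. g i) = (\<Sum>i\<in>I. a \<odot> g i)"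
  by (rule linear_sum[OF linear_mul])

lemma mul_sum_left: "(\<Sum>i\<in>I. g i) \<odot> a = (\<Sum>i\<in>I. g i \<odot> a)"
  using mul_sum_right[of a g I] by (simp add: comm)

lemma aeval_0 [simp]: "aeval (\<odot>) e a 0 = 0"
  by (simp add: aeval_def)

lemma aeval_pCons: "aeval (\<odot>) e a (pCons c p) = c *\<^sub>R e + a \<odot> aeval (\<odot>) e a p"
  by (cases "p = 0 \<and> c = 0") (auto simp: aeval_def mul_simps)

lemma aeval_add: "aeval (\<odot>) e a (p + q) = aeval (\<odot>) e a p + aeval (\<odot>) e a q"
proof (induction p arbitrary: q)
  case (pCons c p)
  show ?case by (cases q) (simp add: aeval_pCons pCons.IH mul_simps scaleR_add_left)
qed simp

lemma aeval_smult: "aeval (\<odot>) e a (smult c p) = c *\<^sub>R aeval (\<odot>) e a p"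
  by (induction p) (simp_all add: aeval_pCons mul_simps algebra_simps)

lemma aeval_mult:
  assumes e: "\<And>x. e \<odot> (a \<odot> x) = a \<odot> x" "e \<odot> e = e"
  shows "aeval (\<odot>) e a (p * q) = aeval (\<odot>) e a p \<odot> aeval (\<odot>) e a q"
proof -
  have eq: "e \<odot> aeval (\<odot>) e a q = aeval (\<odot>) e a q" for q
    by (cases q) (simp add: aeval_pCons mul_simps e)
  show ?thesis
    by (induction p) (simp_all add: aeval_pCons aeval_add aeval_smult mul_simps eq assoc)
qed

lemma aeval_sum: "aeval (\<odot>) e a (\<Sum>i\<in>I. g i) = (\<Sum>i\<in>I. aeval (\<odot>) e a (g i))"
  using sum_comp_morphism[of "aeval (\<odot>) e a" g I] by (simp only: aeval_0 aeval_add o_def)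

text \<open>There are more powers of \<open>a\<close> with exponents up to the dimension than an
  independent set can have elements, and a linear relation among them is the polynomial.\<close>

lemma exists_annihilating_polynomial: "\<exists>p. p \<noteq> 0 \<and> aeval (\<odot>) e a p = 0"
proof -
  define w where "w k = aeval (\<odot>) e a (monom 1 k)" for k
  have mon: "aeval (\<odot>) e a (monom c k) = c *\<^sub>R w k" for c k
    unfolding w_def by (metis aeval_smult smult_monom mult.right_neutral)
  let ?I = "{..DIM('v)}"
  show ?thesis
  proof (cases "inj_on w ?I")
    case True
    have "card (w ` ?I) > DIM('v)" using True by (simp add: card_image)
    then have "dependent (w ` ?I)" using independent_bound[of "w ` ?I"] by auto
    then obtain u v where u: "(\<Sum>v\<in>w ` ?I. u v *\<^sub>R v) = 0" "v \<in> w ` ?I" "u v \<noteq> 0"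
      by (auto simp: dependent_finite)
    define p where "p = (\<Sum>k\<in>?I. monom (u (w k)) k)"
    obtain k where k: "k \<in> ?I" "v = w k" using u by auto
    have "coeff p k = u (w k)"
      using k(1) by (simp add: p_def coeff_sum if_distrib cong: if_cong)
    then have "p \<noteq> 0" using u k by auto
    moreover have "aeval (\<odot>) e a p = (\<Sum>k\<in>?I. u (w k) *\<^sub>R w k)"
      by (simp add: p_def aeval_sum mon)
    moreover have "\<dots> = 0" using u(1) by (simp add: sum.reindex[OF True])
    ultimately show ?thesis by auto
  next
    \<comment> \<open>If two powers coincide, the set of powers may be too small to force
      dependence, but the difference of the two monomials serves directly.\<close>
    case False
    then obtain i j where ij: "i \<noteq> j" "w i = w j" by (auto simp: inj_on_def)
    have "aeval (\<odot>) e a (monom 1 i + smult (-1) (monom 1 j)) = 0"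
      unfolding aeval_add aeval_smult mon using ij(2) by simp
    moreover have "coeff (monom (1::real) i + smult (-1) (monom 1 j)) i = 1"
      using ij(1) by simp
    then have "monom (1::real) i + smult (-1) (monom 1 j) \<noteq> 0" by (metis coeff_0 zero_neq_one)
    ultimately show ?thesis by blast
  qed
qed

text \<open>For an idempotent \<open>e\<close> this is the ideal generated by \<open>e\<close>.
  Described by fixed points it is a subspace for every \<open>e\<close>.\<close>

definition ideal :: "'v \<Rightarrow> 'v set" where "ideal e = {x. e \<odot> x = x}"

lemma subspace_ideal: "subspace (ideal e)"
  by (auto simp: ideal_def subspace_def mul_simps)

definition primitive :: "'v \<Rightarrow> bool" where
  "primitive e \<longleftrightarrow> e \<odot> e = e \<and> e \<noteq> 0 \<and> (\<forall>u. u \<odot> u = u \<longrightarrow> u \<odot> e = u \<longrightarrow> u = 0 \<or> u = e)"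

text \<open>An idempotent that is not primitive splits as \<open>u + (e - u)\<close> into orthogonal
  idempotents. The ideals of both summands have smaller dimension, because they lie in the ideal of
  \<open>e\<close> without containing \<open>e\<close>.\<close>

lemma idempotent_sum_of_primitives:
  assumes "e \<odot> e = e"
  shows "\<exists>P. finite P \<and> (\<forall>a\<in>P. primitive a \<and> a \<odot> e = a) \<and> (\<forall>a\<in>P. \<forall>b\<in>P. a \<noteq> b \<longrightarrow> a \<odot> b = 0) \<and> \<Sum>P = e"
  using assms
proof (induction "dim (ideal e)" arbitrary: e rule: less_induct)
  case less
  consider "e = 0" | "primitive e" | u where "u \<odot> u = u" "u \<odot> e = u" "u \<noteq> 0" "u \<noteq> e"
    using less.prems unfolding primitive_def by blast
  then show ?case
  proof cases
    case 1 then show ?thesis by (intro exI[of _ "{}"]) auto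
  next
    case 2 then show ?thesis using less.prems by (intro exI[of _ "{e}"]) auto
  next
    case 3
    define v where "v = e - u"
    have v: "v \<odot> v = v" "v \<odot> e = v" "u \<odot> v = 0" "v \<noteq> e" "v \<noteq> 0"
      using 3 less.prems by (auto simp: v_def mul_simps comm)
    have smaller: "dim (ideal x) < dim (ideal e)" if x: "x \<odot> e = x" "x \<noteq> e" for x
    proof -
      have sub: "ideal x \<subseteq> ideal e"
      proof
        fix y assume "y \<in> ideal x"
        then have y: "x \<odot> y = y" by (simp add: ideal_def)
        have "e \<odot> (x \<odot> y) = (x \<odot> e) \<odot> y" by (simp add: mul_ac)
        then show "y \<in> ideal e" by (simp add: ideal_def x(1) y)
      qed
      have "e \<in> ideal e" "e \<notin> ideal x" using less.prems x by (auto simp: ideal_def)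
      then have "ideal x \<noteq> ideal e" by auto
      then show ?thesis
        using subspace_dim_equal[OF subspace_ideal subspace_ideal sub] by (meson not_le)
    qed
    obtain P where P: "finite P" "\<forall>a\<in>P. primitive a \<and> a \<odot> u = a" "\<forall>a\<in>P. \<forall>b\<in>P. a \<noteq> b \<longrightarrow> a \<odot> b = 0" "\<Sum>P = u"
      using less.hyps[OF smaller[OF 3(2,4)] 3(1)] by blast
    obtain Q where Q: "finite Q" "\<forall>a\<in>Q. primitive a \<and> a \<odot> v = a" "\<forall>a\<in>Q. \<forall>b\<in>Q. a \<noteq> b \<longrightarrow> a \<odot> b = 0" "\<Sum>Q = v"
      using less.hyps[OF smaller[OF v(2,4)] v(1)] by blast
    have ab: "a \<odot> b = 0" if "a \<in> P" "b \<in> Q" for a b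
    proof -
      have "a \<odot> b = (a \<odot> u) \<odot> (b \<odot> v)" using P Q that by simp
      also have "\<dots> = (a \<odot> b) \<odot> (u \<odot> v)" by (simp add: mul_ac)
      finally show ?thesis using v by (simp add: mul_simps)
    qed
    have disj: "P \<inter> Q = {}"
    proof (rule ccontr)
      assume "P \<inter> Q \<noteq> {}"
      then obtain a where "a \<in> P" "a \<in> Q" by auto
      then show False using ab[of a a] P(2) by (auto simp: primitive_def)
    qed
    have "\<Sum>(P \<union> Q) = e" using P Q disj by (simp add: sum.union_disjoint v_def)
    moreover have "a \<odot> e = a" if "a \<in> P \<union> Q" for a
    proof -
      have "a \<odot> u = a \<or> a \<odot> v = a" using that P(2) Q(2) by auto
      then show ?thesis using assoc[of a u e] assoc[of a v e] 3(2) v(2) by auto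
    qed
    moreover have "a \<odot> b = 0" if "a \<in> P \<union> Q" "b \<in> P \<union> Q" "a \<noteq> b" for a b
      using that(1,2)
    proof (elim UnE)
      assume "a \<in> Q" "b \<in> P"
      then show ?thesis using ab[of b a] comm[of a b] by simp
    qed (use that(3) P(3) Q(3) ab in auto)
    ultimately show ?thesis
      using P Q by (intro exI[of _ "P \<union> Q"]) auto
  qed
qed

end

section \<open>Complex roots of real polynomials\<close>

lemma comm_algebra_complex: "comm_algebra ((*) :: complex \<Rightarrow> complex \<Rightarrow> complex)"
  by (rule comm_algebra.intro[OF bilinear_conv_bounded_bilinear[THEN iffD2, OF bounded_bilinear_mult]
        mult.commute mult.assoc])

lemma aeval_complex: "aeval (*) 1 z p = poly (map_poly complex_of_real p) z"
proof -
  interpret comm_algebra "(*) :: complex \<Rightarrow> complex \<Rightarrow> complex" by (rule comm_algebra_complex)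
  show ?thesis
    by (induction p) (simp_all add: aeval_pCons map_poly_pCons scaleR_conv_of_real)
qed

lemma aeval_complex_of_real: "aeval (*) 1 (Complex s 0) p = of_real (poly p s)"
proof -
  interpret comm_algebra "(*) :: complex \<Rightarrow> complex \<Rightarrow> complex" by (rule comm_algebra_complex)
  have "Complex s 0 = of_real s" by (simp add: complex_eq_iff)
  then show ?thesis
    by (induction p) (simp_all add: aeval_pCons scaleR_conv_of_real)
qed

text \<open>The remainder modulo the real quadratic with roots \<open>s \<plusminus> i t\<close> is
  linear with real coefficients and vanishes at a nonreal point, so it is zero: first the imaginary,
  then the real part.\<close>

lemma complex_root_factor:
  fixes p :: "real poly"
  assumes "aeval (*) 1 (Complex s t) p = 0" "t \<noteq> 0"
  shows "[:s\<^sup>2 + t\<^sup>2, -2 * s, 1:] dvd p"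
proof -
  interpret comm_algebra "(*) :: complex \<Rightarrow> complex \<Rightarrow> complex" by (rule comm_algebra_complex)
  let ?q = "[:s\<^sup>2 + t\<^sup>2, -2 * s, 1:]" and ?z = "Complex s t"
  have q0: "aeval (*) 1 ?z ?q = 0"
    by (simp add: aeval_pCons complex_eq_iff power2_eq_square algebra_simps)
  have "aeval (*) 1 ?z (?q * (p div ?q) + p mod ?q) = 0" unfolding mult_div_mod_eq by (rule assms)
  then have r: "aeval (*) 1 ?z (p mod ?q) = 0"
    by (subst (asm) aeval_add, subst (asm) aeval_mult) (simp_all only: q0, simp_all)
  have "degree (p mod ?q) < 2" using degree_mod_less[of ?q p] by auto
  then have "p mod ?q = [:coeff (p mod ?q) 0, coeff (p mod ?q) 1:]"
    by (intro poly_eqI) (auto simp: coeff_pCons coeff_eq_0 split: nat.splits)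
  then obtain r0 r1 where rr: "p mod ?q = [:r0, r1:]" by blast
  have "r1 = 0" "r0 = 0"
    using r assms(2) unfolding rr by (auto simp: aeval_pCons complex_eq_iff)
  then show ?thesis using rr by (simp add: dvd_eq_mod_eq_0)
qed

section \<open>Factors of a reduced algebra are the reals or the complex numbers\<close>

locale reduced_algebra = comm_algebra +
  fixes one :: 'a
  assumes one: "one \<odot> x = x" and reduced: "x \<odot> x = 0 \<Longrightarrow> x = 0"
begin

text \<open>Without elements of square zero, multiplication by \<open>a\<close> is injective on the
  image \<open>S\<close> of the ideal under it, hence maps \<open>S\<close> onto itself. So
  \<open>a = a \<odot> (a \<odot> y)\<close> for some \<open>y\<close>, and
  \<open>a \<odot> y\<close> is a nonzero idempotent below \<open>e\<close>, that is
  \<open>e\<close>.\<close>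

lemma primitive_inverse:
  assumes e: "primitive e" and a: "a \<in> ideal e" "a \<noteq> 0"
  shows "\<exists>b\<in>ideal e. a \<odot> b = e"
proof -
  define S where "S = (\<odot>) a ` ideal e"
  have S: "subspace S" unfolding S_def by (rule linear_subspace_image[OF linear_mul subspace_ideal])
  have inj: "inj_on ((\<odot>) a) S"
  proof -
    have "x = 0" if "x \<in> S" "a \<odot> x = 0" for x
    proof -
      obtain y where y: "x = a \<odot> y" using \<open>x \<in> S\<close> by (auto simp: S_def)
      have "x \<odot> x = y \<odot> (a \<odot> x)" unfolding y by (simp add: mul_ac)
      then have "x \<odot> x = 0" using that(2) by (simp add: mul_simps)
      then show ?thesis by (rule reduced)
    qed
    then show ?thesis using linear_injective_on_subspace_0[OF linear_mul S] by blast
  qed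
  have sub: "(\<odot>) a ` S \<subseteq> S"
  proof -
    have "a \<odot> y \<in> ideal e" for y using a(1) assoc[of e a y] by (simp add: ideal_def)
    then have "S \<subseteq> ideal e" by (auto simp: S_def)
    then show ?thesis by (auto simp: S_def)
  qed
  have "dim ((\<odot>) a ` S) = dim S"
    using dim_image_eq[OF linear_mul] inj S by (metis subspace_span span_eq_iff)
  then have eq: "(\<odot>) a ` S = S"
    using subspace_dim_equal[OF linear_subspace_image[OF linear_mul S] S sub] by simp
  have "e \<in> ideal e" using e by (simp add: primitive_def ideal_def)
  moreover have "a = a \<odot> e" using a(1) by (simp add: ideal_def comm)
  ultimately have "a \<in> S" unfolding S_def by blast
  then have "a \<in> (\<odot>) a ` S" using eq by simp
  then obtain y where y: "y \<in> ideal e" "a = a \<odot> (a \<odot> y)" by (auto simp: S_def)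
  let ?u = "a \<odot> y"
  have "?u \<odot> ?u = (a \<odot> (a \<odot> y)) \<odot> y" by (simp add: mul_ac)
  then have "?u \<odot> ?u = ?u" using y(2) by simp
  moreover have "?u \<odot> e = (e \<odot> a) \<odot> y" by (simp add: mul_ac)
  then have "?u \<odot> e = ?u" using a(1) by (simp add: ideal_def)
  moreover have "?u \<noteq> 0" using a(2) y(2) by (metis mul_simps(10))
  ultimately have "?u = e" using e by (auto simp: primitive_def)
  then show ?thesis using y(1) by blast
qed

lemma primitive_no_zero_divisors:
  assumes e: "primitive e" and "x \<in> ideal e" "y \<in> ideal e" "x \<odot> y = 0" "x \<noteq> 0"
  shows "y = 0"
proof -
  obtain b where "x \<odot> b = e" using primitive_inverse[OF e] assms by blast
  moreover have "(x \<odot> b) \<odot> y = b \<odot> (x \<odot> y)" by (simp add: mul_ac)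
  ultimately have "y = b \<odot> (x \<odot> y)" using assms(3) by (simp add: ideal_def)
  then show ?thesis using assms by (simp add: mul_simps)
qed

text \<open>The ideal of a primitive idempotent has no zero divisors, so one factor of an
  annihilating polynomial already annihilates \<open>a\<close>. A complex root provides a real
  factor of degree 1 or 2, and the induction on the degree ends with such a factor.\<close>

lemma primitive_quadratic:
  assumes e: "primitive e" and a: "a \<in> ideal e" and p: "p \<noteq> 0" "aeval (\<odot>) e a p = 0"
  shows "(\<exists>s. a = s *\<^sub>R e) \<or> (\<exists>s t i. i \<in> ideal e \<and> i \<odot> i = - e \<and> a = s *\<^sub>R e + t *\<^sub>R i)"
  using p
proof (induction "degree p" arbitrary: p rule: less_induct)
  case less
  have ea: "e \<odot> (a \<odot> x) = a \<odot> x" "a \<odot> e = a" "e \<odot> a = a" for x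
    using a assoc[of e a x] comm[of a e] by (simp_all add: ideal_def)
  have ee: "e \<odot> e = e" "e \<noteq> 0" using e by (auto simp: primitive_def)
  have in_ideal: "aeval (\<odot>) e a q \<in> ideal e" for q
    by (cases q) (simp add: aeval_pCons mul_simps ideal_def ea ee)
  have split: ?case if pq: "p = q * r" and q: "degree q > 0" and zero: "aeval (\<odot>) e a q = 0 \<Longrightarrow> ?case" for q r
  proof (cases "aeval (\<odot>) e a q = 0")
    case False
    have "aeval (\<odot>) e a q \<odot> aeval (\<odot>) e a r = 0"
      using less.prems(2) aeval_mult[OF ea(1) ee(1)] pq by simp
    then have "aeval (\<odot>) e a r = 0"
      using primitive_no_zero_divisors[OF e in_ideal in_ideal] False by blast
    moreover have "r \<noteq> 0" "degree r < degree p"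
      using less.prems(1) q pq by (auto simp: degree_mult_eq)
    ultimately show ?thesis using less.hyps by blast
  qed (use zero in blast)
  have "degree p > 0"
  proof (rule ccontr)
    assume "\<not> degree p > 0"
    then obtain c where "p = [:c:]" by (metis degree_eq_zeroE gr0I)
    then show False using less.prems ee by (simp add: aeval_pCons mul_simps)
  qed
  then have "\<not> constant (poly (map_poly complex_of_real p))"
    by (simp add: constant_degree degree_map_poly)
  then obtain z where "poly (map_poly complex_of_real p) z = 0"
    using fundamental_theorem_of_algebra by blast
  then obtain s t where z: "aeval (*) 1 (Complex s t) p = 0"
    by (metis aeval_complex complex.exhaust)
  show ?case
  proof (cases "t = 0")
    case True
    have "poly p s = 0"
      using z unfolding True aeval_complex_of_real by simp
    then obtain r where "p = [:-s, 1:] * r" by (metis poly_eq_0_iff_dvd dvdE)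
    then show ?thesis
    proof (rule split)
      assume "aeval (\<odot>) e a [:-s, 1:] = 0"
      then have "a = s *\<^sub>R e" by (simp add: aeval_pCons mul_simps ea)
      then show ?thesis by blast
    qed simp
  next
    case False
    obtain r where "p = [:s\<^sup>2 + t\<^sup>2, -2 * s, 1:] * r" using complex_root_factor[OF z False] by (rule dvdE)
    then show ?thesis
    proof (rule split)
      assume "aeval (\<odot>) e a [:s\<^sup>2 + t\<^sup>2, -2 * s, 1:] = 0"
      then have q: "a \<odot> a = (2 * s) *\<^sub>R a - (s\<^sup>2 + t\<^sup>2) *\<^sub>R e"
        by (simp add: aeval_pCons mul_simps ea algebra_simps)
      \<comment> \<open>Completion of the square: \<open>b\<close> has square
        \<open>- t\<^sup>2 *\<^sub>R e\<close>, so division by \<open>t\<close> gives a square root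
        of \<open>- e\<close>.\<close>
      define b where "b = a - s *\<^sub>R e"
      have bb: "b \<odot> b = - (t\<^sup>2 *\<^sub>R e)"
        unfolding b_def by (simp add: mul_simps ea ee q algebra_simps power2_eq_square)
          (simp only: mult_2_right scaleR_add_left)
      let ?i = "(1 / t) *\<^sub>R b"
      have "?i \<odot> ?i = - e" using False by (simp add: mul_simps bb power2_eq_square)
      moreover have "?i \<in> ideal e" using ea ee by (simp add: b_def ideal_def mul_simps)
      moreover have "a = s *\<^sub>R e + t *\<^sub>R ?i" using False by (simp add: b_def)
      ultimately show ?thesis by blast
    qed simp
  qed
qed

text \<open>\<open>primitive_quadratic\<close> yields a square root of \<open>- e\<close> that
  depends on \<open>a\<close>. Two of them, \<open>i\<close> and \<open>k\<close>, satisfy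
  \<open>(i - k) \<odot> (i + k) = 0\<close>, so they agree up to sign and one choice serves the
  whole ideal.\<close>

lemma primitive_ideal_cases:
  assumes e: "primitive e"
  obtains "\<And>a. a \<in> ideal e \<Longrightarrow> \<exists>s. a = s *\<^sub>R e"
  | i where "i \<in> ideal e" "i \<odot> i = - e" "\<And>a. a \<in> ideal e \<Longrightarrow> \<exists>s t. a = s *\<^sub>R e + t *\<^sub>R i"
proof (cases "\<exists>i. i \<in> ideal e \<and> i \<odot> i = - e")
  case False
  then have "\<exists>s. a = s *\<^sub>R e" if "a \<in> ideal e" for a
    using primitive_quadratic[OF e that] exists_annihilating_polynomial[of e a] by blast
  then show ?thesis using that by blast
next
  case True
  then obtain i where i: "i \<in> ideal e" "i \<odot> i = - e" by blast
  have "\<exists>s t. a = s *\<^sub>R e + t *\<^sub>R i" if a: "a \<in> ideal e" for a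
  proof -
    consider s where "a = s *\<^sub>R e" | s t k where "k \<in> ideal e" "k \<odot> k = - e" "a = s *\<^sub>R e + t *\<^sub>R k"
      using primitive_quadratic[OF e a] exists_annihilating_polynomial[of e a] by blast
    then show ?thesis
    proof cases
      case 1 then show ?thesis by (intro exI[of _ s] exI[of _ 0]) simp
    next
      case 2
      have "(i - k) \<odot> (i + k) = 0" using i 2 by (simp add: mul_simps comm)
      moreover have "i - k \<in> ideal e" "i + k \<in> ideal e"
        using subspace_ideal i 2 by (auto intro: subspace_diff subspace_add)
      ultimately have "i = k \<or> i + k = 0" using primitive_no_zero_divisors[OF e] by fastforce
      then have "k = i \<or> k = - i" by (auto simp: add_eq_0_iff)
      then show ?thesis
      proof
        assume "k = - i" then show ?thesis using 2(3) by (intro exI[of _ s] exI[of _ "-t"]) simp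
      qed (use 2(3) in blast)
    qed
  qed
  then show ?thesis using that i by blast
qed

lemma ideal_mult_zero:
  assumes "a \<in> ideal e" "b \<in> ideal u" "e \<odot> u = 0"
  shows "a \<odot> b = 0"
proof -
  have "a \<odot> b = (e \<odot> a) \<odot> (u \<odot> b)" using assms by (simp add: ideal_def)
  also have "\<dots> = (e \<odot> u) \<odot> (a \<odot> b)" by (simp add: mul_ac)
  finally show ?thesis using assms(3) by (simp add: mul_simps)
qed

text \<open>The algebra is a product of copies of the reals and the complex numbers. If a real factor
  occurs, signs can be distributed over the factors so that the two eigenspaces get the same
  dimension; otherwise a square root of \<open>-1\<close> is chosen in every factor.\<close>
lemma balanced_square_root:
  assumes dim: "DIM('a) = 2 * m"
  obtains (imaginary) j B where "j \<odot> j = - one" "finite B" "card B = m" "inj_on ((\<odot>) j) B"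
      "B \<inter> (\<odot>) j ` B = {}" "independent (B \<union> (\<odot>) j ` B)"
  | (signs) j B B' where "finite B" "finite B'" "card B = m" "card B' = m" "B \<inter> B' = {}"
      "independent (B \<union> B')" "\<And>x. x \<in> B \<Longrightarrow> j \<odot> x = x" "\<And>x. x \<in> B' \<Longrightarrow> j \<odot> x = - x"
proof -
  obtain P where P: "finite P" "\<And>a. a \<in> P \<Longrightarrow> primitive a"
    "\<And>a b. a \<in> P \<Longrightarrow> b \<in> P \<Longrightarrow> a \<noteq> b \<Longrightarrow> a \<odot> b = 0" "\<Sum>P = one"
    using idempotent_sum_of_primitives[OF one[of one]] by blast
  have idem: "e \<odot> e = e" "e \<noteq> 0" "e \<in> ideal e" if "e \<in> P" for e
    using P(2)[OF that] by (auto simp: primitive_def ideal_def)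
  \<comment> \<open>\<open>R\<close> collects the units of the real factors; those in
    \<open>K\<close> belong to complex factors.\<close>
  define R where "R = {e \<in> P. \<forall>a\<in>ideal e. \<exists>s. a = s *\<^sub>R e}"
  define K where "K = P - R"
  have "\<forall>e\<in>K. \<exists>i. i \<in> ideal e \<and> i \<odot> i = - e \<and> (\<forall>a\<in>ideal e. \<exists>s t. a = s *\<^sub>R e + t *\<^sub>R i)"
  proof
    fix e assume e: "e \<in> K"
    then have "primitive e" using P(2) by (auto simp: K_def)
    then show "\<exists>i. i \<in> ideal e \<and> i \<odot> i = - e \<and> (\<forall>a\<in>ideal e. \<exists>s t. a = s *\<^sub>R e + t *\<^sub>R i)"
    proof (cases rule: primitive_ideal_cases)
      case 1
      then show ?thesis using e by (auto simp: K_def R_def)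
    qed blast
  qed
  from bchoice[OF this] obtain i where i: "\<And>e. e \<in> K \<Longrightarrow> i e \<in> ideal e"
      "\<And>e. e \<in> K \<Longrightarrow> i e \<odot> i e = - e" "\<And>e a. e \<in> K \<Longrightarrow> a \<in> ideal e \<Longrightarrow> \<exists>s t. a = s *\<^sub>R e + t *\<^sub>R i e"
    by blast
  have KP: "K \<subseteq> P" "R \<subseteq> P" "P = R \<union> K" "R \<inter> K = {}" by (auto simp: K_def R_def)
  have fin: "finite K" "finite R" using P(1) KP finite_subset by blast+
  have orth: "e \<odot> u = (if e = u then e else 0)" if "e \<in> P" "u \<in> P" for e u
    using that P(3) idem by auto
  have ei: "e \<odot> a = (if e = u then a else 0)" if "e \<in> P" "u \<in> P" "a \<in> ideal u" for e u a
  proof (cases "e = u")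
    case False
    then show ?thesis using ideal_mult_zero[OF idem(3)[OF that(1)] that(3)] orth[OF that(1,2)] by simp
  qed (use that in \<open>simp add: ideal_def\<close>)
  have ii: "i e \<odot> i u = (if e = u then - e else 0)" if "e \<in> K" "u \<in> K" for e u
  proof (cases "e = u")
    case False
    then show ?thesis using ideal_mult_zero[OF i(1)[OF that(1)] i(1)[OF that(2)]] orth[of e u] KP that by auto
  qed (use that i(2) in simp)
  have inj: "inj_on i K"
  proof (rule inj_onI, rule ccontr)
    fix e u assume "e \<in> K" "u \<in> K" "i e = i u" "e \<noteq> u"
    then have "e = 0" using ii[of e u] ii[of e e] by simp
    then show False using idem(2) \<open>e \<in> K\<close> KP by auto
  qed
  have disj: "P \<inter> i ` K = {}"
  proof (rule ccontr)
    assume "P \<inter> i ` K \<noteq> {}"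
    then obtain e where e: "e \<in> K" "i e \<in> P" by auto
    then have ne: "- e = i e" using idem(1)[of "i e"] i(2)[of e] by simp
    have "i e \<odot> i e = e" using idem(1)[of e] e KP unfolding ne[symmetric] by (auto simp: mul_simps)
    then have "2 *\<^sub>R e = 0" using i(2) e by (simp add: scaleR_2 neg_eq_iff_add_eq_0)
    then show False using idem(2) e KP by auto
  qed
  have indep: "independent (P \<union> i ` K)"
  proof -
    have "u v = 0" if z: "(\<Sum>v\<in>P \<union> i ` K. u v *\<^sub>R v) = 0" and v: "v \<in> P \<union> i ` K" for u v
    proof -
      have split: "(\<Sum>v\<in>P. u v *\<^sub>R v) + (\<Sum>e\<in>K. u (i e) *\<^sub>R i e) = 0"
        using z sum.union_disjoint[OF P(1) finite_imageI[OF fin(1)] disj, of "\<lambda>v. u v *\<^sub>R v"]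
        by (simp add: sum.reindex[OF inj])
      \<comment> \<open>Multiplication of the linear relation by \<open>e\<close> isolates its
        component in one factor.\<close>
      have comp: "u e *\<^sub>R e + (if e \<in> K then u (i e) *\<^sub>R i e else 0) = 0" if e: "e \<in> P" for e
      proof -
        have "e \<odot> ((\<Sum>v\<in>P. u v *\<^sub>R v) + (\<Sum>u'\<in>K. u (i u') *\<^sub>R i u')) =
           (\<Sum>v\<in>P. if e = v then u e *\<^sub>R e else 0) + (\<Sum>u'\<in>K. if e = u' then u (i e) *\<^sub>R i e else 0)"
          unfolding mul_simps mul_sum_right
        proof (intro arg_cong2[of _ _ _ _ "(+)"] sum.cong refl)
          fix v assume "v \<in> P"
          then show "u v *\<^sub>R (e \<odot> v) = (if e = v then u e *\<^sub>R e else 0)" using orth[OF e, of v] by auto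
        next
          fix v assume "v \<in> K"
          then show "u (i v) *\<^sub>R (e \<odot> i v) = (if e = v then u (i e) *\<^sub>R i e else 0)"
            using ei[OF e, of v "i v"] KP i(1) by auto
        qed
        then show ?thesis using split e P(1) fin by (simp add: mul_simps)
      qed
      have K0: "u e = 0 \<and> u (i e) = 0" if e: "e \<in> K" for e
      proof -
        have ie: "e \<odot> i e = i e" "i e \<odot> e = i e" "e \<odot> e = e" "i e \<odot> i e = - e" "e \<noteq> 0"
          using i[OF e] idem[of e] KP e by (auto simp: ideal_def comm)
        have c: "u e *\<^sub>R e + u (i e) *\<^sub>R i e = 0" using comp[of e] KP e by auto
        \<comment> \<open>The product with the complex conjugate is the squared modulus times
          \<open>e\<close>.\<close>
        have "(u e *\<^sub>R e + u (i e) *\<^sub>R i e) \<odot> (u e *\<^sub>R e - u (i e) *\<^sub>R i e) = ((u e)\<^sup>2 + (u (i e))\<^sup>2) *\<^sub>R e"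
          by (simp add: mul_simps ie algebra_simps power2_eq_square)
        then have "(u e)\<^sup>2 + (u (i e))\<^sup>2 = 0" using c ie(5) by (simp add: mul_simps)
        then show ?thesis by (simp add: sum_power2_eq_zero_iff)
      qed
      show ?thesis
      proof (cases "v \<in> P")
        case True
        then show ?thesis using comp[OF True] K0[of v] idem(2)[OF True] by (cases "v \<in> K") auto
      qed (use v K0 in auto)
    qed
    then show ?thesis
      using P(1) fin(1) by (subst dependent_finite) auto
  qed
  have "span (P \<union> i ` K) = UNIV"
  proof -
    have "x \<in> span (P \<union> i ` K)" for x
    proof -
      have "x = (\<Sum>e\<in>P. e \<odot> x)" using one[of x] P(4) mul_sum_left[of "\<lambda>e. e" P x] by simp
      moreover have "e \<odot> x \<in> span (P \<union> i ` K)" if e: "e \<in> P" for e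
      proof -
        have ex: "e \<odot> x \<in> ideal e" using assoc[of e e x] idem(1)[OF e] by (simp add: ideal_def)
        have "\<exists>s t. e \<odot> x = s *\<^sub>R e + t *\<^sub>R (if e \<in> K then i e else 0)"
        proof (cases "e \<in> K")
          case True
          then show ?thesis using i(3)[OF True ex] by simp
        next
          case False
          then have "e \<in> R" using e KP by auto
          then obtain s where "e \<odot> x = s *\<^sub>R e" using ex unfolding R_def by blast
          then show ?thesis using False by auto
        qed
        then obtain s t where "e \<odot> x = s *\<^sub>R e + t *\<^sub>R (if e \<in> K then i e else 0)" by blast
        moreover have "(if e \<in> K then i e else 0) \<in> span (P \<union> i ` K)" by (auto intro: span_base span_zero)
        ultimately show ?thesis using e by (auto intro!: span_add span_scale intro: span_base)
      qed
      ultimately show ?thesis by (metis (no_types, lifting) span_sum)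
    qed
    then show ?thesis by auto
  qed
  then have card: "card P + card K = 2 * m"
    using dim_eq_card_independent[OF indep] dim_span[of "P \<union> i ` K"] dim
      card_Un_disjoint[OF P(1) finite_imageI[OF fin(1)] disj] card_image[OF inj]
    by simp
  have cardP: "card P = card R + card K" using KP fin card_Un_disjoint by metis
  show ?thesis
  proof (cases "R = {}")
    case True
    then have PK: "P = K" using KP by auto
    define j where "j = (\<Sum>e\<in>P. i e)"
    have je: "j \<odot> e = i e" if e: "e \<in> P" for e
    proof -
      have "i u \<odot> e = (if u = e then i e else 0)" if "u \<in> P" for u
        using ei[OF e that, of "i u"] i(1)[of u] that PK by (auto simp: comm)
      then show ?thesis using e P(1) by (simp add: j_def mul_sum_left)
    qed
    have ji: "j \<odot> i e = - e" if e: "e \<in> P" for e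
    proof -
      have "i u \<odot> i e = (if u = e then - e else 0)" if "u \<in> P" for u
        using ii[of u e] that e PK by auto
      then show ?thesis using e P(1) by (simp add: j_def mul_sum_left)
    qed
    have "j \<odot> j = (\<Sum>e\<in>P. j \<odot> i e)" by (subst (2) j_def) (simp add: mul_sum_right)
    also have "\<dots> = - one" using ji P(4) by (simp add: sum_negf)
    finally have jj: "j \<odot> j = - one" .
    have im: "(\<odot>) j ` P = i ` K" using je PK by auto
    have "inj_on ((\<odot>) j) P" using inj je PK by (simp add: inj_on_def)
    moreover have "card P = m" using card PK by simp
    ultimately show ?thesis
      using imaginary[OF jj P(1)] disj indep im by simp
  next
    case False
    then have "card R > 0" using fin by (simp add: card_gt_0_iff)
    \<comment> \<open>The dimension is \<open>card R + 2 * card K = 2 * m\<close>. Hence the number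
      of real factors is even, and it is at least 2 because it is positive.\<close>
    then have R2: "card R = 2 * (card R div 2)" "card R div 2 \<ge> 1" "m = card R div 2 + card K"
      using card cardP by presburger+
    have "card K div 2 \<le> card K" by simp
    then obtain K' where K': "K' \<subseteq> K" "card K' = card K div 2"
      by (rule obtain_subset_with_card_n)
    \<comment> \<open>When the number of complex factors is odd, the sign +1 goes to one complex
      factor fewer than the sign -1. One additional real factor with sign +1 restores the balance,
      and the two real factors at hand leave room for it.\<close>
    have "card R div 2 + card K mod 2 \<le> card R"
      using R2(1,2) mod_less_divisor[of 2 "card K"] by linarith
    then obtain R' where R': "R' \<subseteq> R" "card R' = card R div 2 + card K mod 2"
      by (rule obtain_subset_with_card_n)
    define S where "S = K' \<union> R'"
    have SP: "S \<subseteq> P" using K' R' KP by (auto simp: S_def)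
    define j where "j = \<Sum>S - \<Sum>(P - S)"
    have j: "j \<odot> a = (if e \<in> S then a else - a)" if "e \<in> P" "a \<in> ideal e" for e a
    proof -
      have "\<Sum>T \<odot> a = (if e \<in> T then a else 0)" if T: "T \<subseteq> P" for T
      proof -
        have "\<Sum>T \<odot> a = (\<Sum>u\<in>T. if u = e then a else 0)"
          unfolding mul_sum_left by (rule sum.cong) (use ei[OF _ \<open>e \<in> P\<close> \<open>a \<in> ideal e\<close>] T in auto)
        then show ?thesis using finite_subset[OF T P(1)] by simp
      qed
      from this[OF SP] this[of "P - S"] show ?thesis using that by (auto simp: j_def mul_simps)
    qed
    define B where "B = S \<union> i ` K'"
    define B' where "B' = (P - S) \<union> i ` (K - K')"
    have BB: "B \<union> B' = P \<union> i ` K" using SP K' by (auto simp: B_def B'_def)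
    have "i ` K' \<inter> i ` (K - K') = {}" using inj K' by (auto simp: inj_on_def)
    then have dBB: "B \<inter> B' = {}"
      using disj SP K'(1) unfolding B_def B'_def by blast
    have fB: "finite B" "finite B'" using P(1) fin SP K' finite_subset by (auto simp: B_def B'_def)
    have fK': "finite K'" "finite R'" using K' R' fin finite_subset by blast+
    have "card S = card K' + card R'"
      unfolding S_def using K' R' KP fK' by (intro card_Un_disjoint) auto
    moreover have "card (i ` K') = card K'" using inj K'(1) by (meson card_image inj_on_subset)
    moreover have "card B = card S + card (i ` K')"
      unfolding B_def using disj SP K' fK' finite_subset[OF SP P(1)] by (intro card_Un_disjoint) auto
    ultimately have cB: "card B = m" using K'(2) R'(2) R2(3) mult_div_mod_eq[of 2 "card K"] by linarith
    have "card B + card B' = 2 * m"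
      using card_Un_disjoint[OF fB dBB] BB card card_Un_disjoint[OF P(1) finite_imageI[OF fin(1)] disj]
        card_image[OF inj] by simp
    then have cB': "card B' = m" using cB by simp
    have jB: "j \<odot> x = x" if "x \<in> B" for x
      using that unfolding B_def
    proof
      assume x: "x \<in> S" then show ?thesis using j[of x x] SP idem(3)[of x] by auto
    next
      assume "x \<in> i ` K'"
      then obtain e where "x = i e" "e \<in> K'" by auto
      then show ?thesis using j[of e x] K' KP i(1)[of e] by (auto simp: S_def)
    qed
    have jB': "j \<odot> x = - x" if "x \<in> B'" for x
      using that unfolding B'_def
    proof
      assume x: "x \<in> P - S" then show ?thesis using j[of x x] idem(3)[of x] by auto
    next
      assume "x \<in> i ` (K - K')"
      then obtain e where "x = i e" "e \<in> K" "e \<notin> K'" by auto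
      moreover have "e \<notin> S" using calculation R' KP by (auto simp: S_def)
      ultimately show ?thesis using j[of e x] KP i(1)[of e] by auto
    qed
    have "independent (B \<union> B')" using indep BB by simp
    then show ?thesis using signs[OF fB cB cB' dBB _ jB jB'] by blast
  qed
qed

end

text \<open>A generalized inverse \<open>g\<close> with \<open>A g A = A\<close> gives
  \<open>tr A = tr (A g A) = tr (g A A) = 0\<close>.\<close>

lemma trace_square_zero:
  fixes A :: "real^'n^'n"
  assumes "A ** A = 0"
  shows "trace A = 0"
proof -
  obtain g where g: "linear g" "\<And>v. A *v g (A *v v) = A *v v"
    using linear_exists_right_inverse_on[OF matrix_vector_mul_linear[of A] subspace_UNIV] by auto
  have "A ** (matrix g ** A) = A"
    by (rule matrix_eq[THEN iffD2]) (simp add: g matrix_works flip: matrix_vector_mul_assoc)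
  then have "trace A = trace (matrix g ** A ** A)" by (metis trace_mul_sym)
  also have "\<dots> = trace (matrix g ** (A ** A))" by (simp add: matrix_mul_assoc)
  also have "\<dots> = 0" unfolding assms by (simp add: trace_def matrix_matrix_mult_def)
  finally show ?thesis .
qed

section \<open>Conjugation to the standard structures\<close>

text \<open>A nonzero multiple of an intertwining map still intertwines, while its determinant is
  multiplied by a power of the factor; a root of \<open>1 / \<bar>det (matrix L)\<bar>\<close>
  normalizes it.\<close>

lemma unimodular_rescaling:
  fixes L J J0 :: "real^'d \<Rightarrow> real^'d"
  assumes L: "linear L" "bij L" and J0: "linear J0" and inter: "\<And>x. L (J x) = J0 (L x)"
  shows "\<exists>L. linear L \<and> bij L \<and> \<bar>det (matrix L)\<bar> = 1 \<and> (\<forall>x. L (J x) = J0 (L x))"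
proof -
  have d: "det (matrix L) \<noteq> 0"
    using L by (metis bij_is_inj det_nz_iff_inj)
  define t where "t = root CARD('d) (1 / \<bar>det (matrix L)\<bar>)"
  have t: "t ^ CARD('d) = 1 / \<bar>det (matrix L)\<bar>" "t > 0" using d by (simp_all add: t_def)
  define L' where "L' x = t *\<^sub>R L x" for x
  have lin: "linear L'" unfolding L'_def[abs_def] by (rule linear_compose_scale_right[OF L(1)])
  have "matrix L' = t *\<^sub>R matrix L" by (simp add: matrix_def L'_def vec_eq_iff)
  then have "matrix L' = (\<chi> i. t *s matrix L $ i)" by (simp add: vec_eq_iff)
  then have "det (matrix L') = t ^ CARD('d) * det (matrix L)"
    using det_rows_mul[of "\<lambda>_. t" "\<lambda>i. matrix L $ i"] by simp
  then have "\<bar>det (matrix L')\<bar> = 1" using t d by (simp add: abs_mult)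
  moreover have "bij L'"
  proof -
    have "inj L'" using t(2) bij_is_inj[OF L(2)] by (auto simp: L'_def inj_on_def)
    then show ?thesis using linear_injective_imp_surjective[OF lin] by (simp add: bij_def)
  qed
  moreover have "L' (J x) = J0 (L' x)" for x by (simp add: L'_def inter linear_scale[OF J0])
  ultimately show ?thesis using lin by blast
qed

text \<open>\<open>J\<close> and \<open>J0\<close> act on their numbered bases by the same pattern:
  \<open>k\<close> goes to \<open>s k\<close> with coefficient \<open>c k\<close>. The linear map
  from one basis to the other therefore intertwines them.\<close>

lemma unimodular_intertwiner:
  fixes J J0 :: "real^'d \<Rightarrow> real^'d" and b b0 :: "nat \<Rightarrow> real^'d"
  assumes J: "linear J" "linear J0" and I: "finite I" "card I = CARD('d)" "s ` I \<subseteq> I"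
    and b: "inj_on b I" "independent (b ` I)" and b0: "span (b0 ` I) = UNIV"
    and Jb: "\<And>k. k \<in> I \<Longrightarrow> J (b k) = c k *\<^sub>R b (s k)" "\<And>k. k \<in> I \<Longrightarrow> J0 (b0 k) = c k *\<^sub>R b0 (s k)"
  shows "\<exists>L. linear L \<and> bij L \<and> \<bar>det (matrix L)\<bar> = 1 \<and> (\<forall>x. L (J x) = J0 (L x))"
proof -
  obtain L where L: "linear L" "\<And>x. x \<in> b ` I \<Longrightarrow> L x = b0 (inv_into I b x)"
    using linear_independent_extend[OF b(2), of "\<lambda>x. b0 (inv_into I b x)"] by blast
  have Lb: "L (b k) = b0 k" if "k \<in> I" for k using L(2) that b(1) by simp
  have sp: "span (b ` I) = UNIV"
    using card_eq_dim[of "b ` I" UNIV] b(2) I(1,2) card_image[OF b(1)] by auto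
  have "b0 ` I \<subseteq> range L" using Lb by (metis image_subset_iff rangeI)
  then have "UNIV \<subseteq> range L"
    using b0 span_minimal linear_subspace_image[OF L(1) subspace_UNIV] by metis
  then have surj: "surj L" by auto
  then have bij: "bij L" using linear_surjective_imp_injective[OF L(1)] by (simp add: bij_def)
  have inter: "L (J x) = J0 (L x)" for x
  proof -
    have "x \<in> span (b ` I)" using sp by simp
    moreover have "linear (\<lambda>x. L (J x))" "linear (\<lambda>x. J0 (L x))"
      using linear_compose[OF J(1) L(1)] linear_compose[OF L(1) J(2)] by (simp_all add: o_def)
    moreover have "L (J y) = J0 (L y)" if "y \<in> b ` I" for y
      using that I(3) by (auto simp: Jb Lb linear_scale[OF L(1)])
    ultimately show ?thesis using linear_eq_on_span by blast
  qed
  show ?thesis by (rule unimodular_rescaling[OF L(1) bij J(2) inter])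
qed

section \<open>Bases adapted to the standard structures\<close>

lemma linear_para_complex_structure: "linear (para_complex_structure n (e :: nat \<Rightarrow> 'd::finite))"
  by (rule linearI) (auto simp: para_complex_structure_def vec_eq_iff Let_def)

lemma linear_complex_structure: "linear (complex_structure n (e :: nat \<Rightarrow> 'd::finite))"
  by (rule linearI) (auto simp: complex_structure_def vec_eq_iff Let_def)

context
  fixes n :: nat and e :: "nat \<Rightarrow> 'd::finite"
  assumes e: "bij_betw e {1..2*n+2} UNIV"
begin

lemma e_eq_iff: "k \<in> {1..2*n+2} \<Longrightarrow> l \<in> {1..2*n+2} \<Longrightarrow> e k = e l \<longleftrightarrow> k = l"
  using e by (auto simp: bij_betw_def inj_on_def)

lemma ex_index: obtains k where "k \<in> {1..n+1}" "r = e k" | k where "k \<in> {1..n+1}" "r = e (n + 1 + k)"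
proof -
  obtain l where l: "l \<in> {1..2*n+2}" "r = e l" using e unfolding bij_betw_def by (metis UNIV_I imageE)
  show ?thesis
  proof (cases "l \<le> n + 1")
    case True then show ?thesis using that(1)[of l] l by auto
  next
    case False
    then have "l - (n + 1) \<in> {1..n+1}" "n + 1 + (l - (n + 1)) = l" using l(1) by auto
    then show ?thesis using that(2) l(2) by metis
  qed
qed

lemma structure_axis:
  assumes k: "k \<in> {1..n+1}"
  shows "para_complex_structure n e (axis (e k) 1) = axis (e (n + 1 + k)) 1"
    "para_complex_structure n e (axis (e (n + 1 + k)) 1) = axis (e k) 1"
    "complex_structure n e (axis (e k) 1) = axis (e (n + 1 + k)) 1"
    "complex_structure n e (axis (e (n + 1 + k)) 1) = - axis (e k) 1"
proof -
  have eq: "v = w" if "\<And>k. k \<in> {1..n+1} \<Longrightarrow> v $ e k = w $ e k \<and> v $ e (n + 1 + k) = w $ e (n + 1 + k)" for v w :: "real^'d"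
    unfolding vec_eq_iff using that ex_index by metis
  have ne: "e l = e k' \<longleftrightarrow> l = k'" "e (n+1+l) = e (n+1+k') \<longleftrightarrow> l = k'" "e (n+1+l) \<noteq> e k'" "e k' \<noteq> e (n+1+l)"
    if "l \<in> {1..n+1}" "k' \<in> {1..n+1}" for l k'
    using e_eq_iff[of l k'] e_eq_iff[of "n+1+l" "n+1+k'"] e_eq_iff[of "n+1+l" k'] that by auto
  show "para_complex_structure n e (axis (e k) 1) = axis (e (n + 1 + k)) 1"
    by (rule eq) (use k ne para_complex_structure_nth[OF e] in \<open>simp add: axis_def\<close>)
  show "para_complex_structure n e (axis (e (n + 1 + k)) 1) = axis (e k) 1"
    by (rule eq) (use k ne para_complex_structure_nth[OF e] in \<open>simp add: axis_def\<close>)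
  show "complex_structure n e (axis (e k) 1) = axis (e (n + 1 + k)) 1"
    by (rule eq) (use k ne complex_structure_nth[OF e] in \<open>simp add: axis_def\<close>)
  show "complex_structure n e (axis (e (n + 1 + k)) 1) = - axis (e k) 1"
    by (rule eq) (use k ne complex_structure_nth[OF e] in \<open>simp add: axis_def\<close>)
qed

lemma span_axes: 
  assumes "\<And>k. k \<in> {1..n+1} \<Longrightarrow> axis (e k) 1 \<in> span S \<and> axis (e (n + 1 + k)) 1 \<in> span S"
  shows "span S = (UNIV :: (real^'d) set)"
proof -
  have "x \<in> span S" for x :: "real^'d"
  proof -
    have "axis r 1 \<in> span S" for r by (rule ex_index[of r]) (use assms in auto)
    then have "(\<Sum>r\<in>UNIV. x $ r *\<^sub>R axis r 1) \<in> span S" by (intro span_sum span_scale)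
    moreover have "(\<Sum>r\<in>UNIV. x $ r *\<^sub>R axis r 1) = x"
      by (simp add: vec_eq_iff axis_def if_distrib cong: if_cong)
    ultimately show ?thesis by simp
  qed
  then show ?thesis by auto
qed

lemma index_cases:
  assumes "k \<in> {1..2*n+2}"
  obtains "k \<in> {1..n+1}" | l where "l \<in> {1..n+1}" "k = n + 1 + l" "\<not> n + 1 + l \<le> n + 1"
proof (cases "k \<le> n + 1")
  case False
  then have "k - (n + 1) \<in> {1..n+1}" "k = n + 1 + (k - (n + 1))" using assms by auto
  then show ?thesis using that(2) by auto
qed (use assms that(1) in auto)

lemma conjugate_complex_structure:
  fixes J :: "real^'d \<Rightarrow> real^'d"
  assumes J: "linear J" "\<And>x. J (J x) = - x" and B: "finite B" "card B = n + 1" "inj_on J B"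
    "B \<inter> J ` B = {}" "independent (B \<union> J ` B)"
  shows "\<exists>L. linear L \<and> bij L \<and> \<bar>det (matrix L)\<bar> = 1 \<and> (\<forall>x. L (J x) = complex_structure n e (L x))"
proof -
  obtain h where h: "bij_betw h {1..n+1} B"
    using B(1,2) by (metis ex_bij_betw_nat_finite_1)
  \<comment> \<open>The basis lists \<open>B\<close> first and then its image under
    \<open>J\<close>, in the order in which \<open>complex_structure\<close> sends the first half of
    the axes to the second half.\<close>
  define b where "b k = (if k \<le> n + 1 then h k else J (h (k - (n + 1))))" for k
  define s where "s k = (if k \<le> n + 1 then n + 1 + k else k - (n + 1))" for k
  define c where "c k = (if k \<le> n + 1 then 1 else (-1::real))" for k
  have I: "{1..2*n+2} = {1..n+1} \<union> (\<lambda>k. n + 1 + k) ` {1..n+1}"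
    by (auto simp: image_iff) presburger
  have bk: "b k = h k" "b (n + 1 + k) = J (h k)" if "k \<in> {1..n+1}" for k
    using that by (auto simp: b_def)
  have hB: "h ` {1..n+1} = B" using h by (simp add: bij_betw_def)
  have bI: "b ` {1..n+1} = B" "b ` (\<lambda>k. n + 1 + k) ` {1..n+1} = J ` B"
    unfolding hB[symmetric] image_image using bk by (auto intro!: image_cong)
  have bim: "b ` {1..2*n+2} = B \<union> J ` B"
    unfolding I image_Un bI ..
  have card: "card (b ` {1..2*n+2}) = card {1..2*n+2}"
    unfolding bim using card_Un_disjoint[OF B(1) finite_imageI[OF B(1)] B(4)] card_image[OF B(3)] B(2) by simp
  have cd: "card {1..2*n+2} = CARD('d)" using bij_betw_same_card[OF e] .
  show ?thesis
  proof (rule unimodular_intertwiner[where I = "{1..2*n+2}" and b = b and b0 = "\<lambda>k. axis (e k) 1" and s = s and c = c])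
    show "linear J" "linear (complex_structure n e)" by (rule J linear_complex_structure)+
    show "s ` {1..2*n+2} \<subseteq> {1..2*n+2}" by (auto simp: s_def)
    show "inj_on b {1..2*n+2}" by (rule eq_card_imp_inj_on[OF _ card]) simp
    show "independent (b ` {1..2*n+2})" unfolding bim by (rule B)
    show "span ((\<lambda>k. axis (e k) 1) ` {1..2*n+2}) = (UNIV :: (real^'d) set)"
      by (rule span_axes) (auto intro!: span_base)
    show "J (b k) = c k *\<^sub>R b (s k)" if "k \<in> {1..2*n+2}" for k
      using that by (cases rule: index_cases) (auto simp: b_def c_def s_def J(2))
    show "complex_structure n e (axis (e k) 1) = c k *\<^sub>R axis (e (s k)) 1" if "k \<in> {1..2*n+2}" for k
      using that
    proof (cases rule: index_cases)
      case 1 then show ?thesis using structure_axis(3)[of k] by (simp add: c_def s_def)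
    next
      case (2 l) then show ?thesis using structure_axis(4)[of l] by (simp add: c_def s_def)
    qed
  qed (use cd in auto)
qed

lemma conjugate_para_complex_structure:
  fixes J :: "real^'d \<Rightarrow> real^'d"
  assumes J: "linear J" "\<And>x. x \<in> B \<Longrightarrow> J x = x" "\<And>x. x \<in> B' \<Longrightarrow> J x = - x"
    and B: "finite B" "finite B'" "card B = n + 1" "card B' = n + 1" "B \<inter> B' = {}" "independent (B \<union> B')"
  shows "\<exists>L. linear L \<and> bij L \<and> \<bar>det (matrix L)\<bar> = 1 \<and> (\<forall>x. L (J x) = para_complex_structure n e (L x))"
proof -
  obtain h where h: "bij_betw h {1..n+1} B" using B(1,3) by (metis ex_bij_betw_nat_finite_1)
  obtain h' where h': "bij_betw h' {1..n+1} B'" using B(2,4) by (metis ex_bij_betw_nat_finite_1)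
  define b where "b k = (if k \<le> n + 1 then h k else h' (k - (n + 1)))" for k
  \<comment> \<open>Sums and differences of the axes that the para-complex structure exchanges: its
    eigenvectors for the eigenvalues 1 and -1.\<close>
  define b0 :: "nat \<Rightarrow> real^'d" where "b0 k = (if k \<le> n + 1 then axis (e k) 1 + axis (e (n + 1 + k)) 1
      else axis (e (k - (n + 1))) 1 - axis (e k) 1)" for k
  define c where "c k = (if k \<le> n + 1 then 1 else (-1::real))" for k
  have I: "{1..2*n+2} = {1..n+1} \<union> (\<lambda>k. n + 1 + k) ` {1..n+1}"
    by (auto simp: image_iff) presburger
  have bk: "b k = h k" "b (n + 1 + k) = h' k" if "k \<in> {1..n+1}" for k
    using that by (auto simp: b_def)
  have hB: "h ` {1..n+1} = B" "h' ` {1..n+1} = B'" using h h' by (simp_all add: bij_betw_def)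
  have bI: "b ` {1..n+1} = B" "b ` (\<lambda>k. n + 1 + k) ` {1..n+1} = B'"
    unfolding hB[symmetric] image_image using bk by (auto intro!: image_cong)
  have bim: "b ` {1..2*n+2} = B \<union> B'"
    unfolding I image_Un bI ..
  have card: "card (b ` {1..2*n+2}) = card {1..2*n+2}"
    unfolding bim using card_Un_disjoint[OF B(1,2) B(5)] B(3,4) by simp
  have cd: "card {1..2*n+2} = CARD('d)" using bij_betw_same_card[OF e] .
  show ?thesis
  proof (rule unimodular_intertwiner[where I = "{1..2*n+2}" and b = b and b0 = b0 and s = "\<lambda>k. k" and c = c])
    show "linear J" "linear (para_complex_structure n e)" by (rule J linear_para_complex_structure)+
    show "inj_on b {1..2*n+2}" by (rule eq_card_imp_inj_on[OF _ card]) simp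
    show "independent (b ` {1..2*n+2})" unfolding bim by (rule B)
    show "span (b0 ` {1..2*n+2}) = (UNIV :: (real^'d) set)"
    proof (rule span_axes)
      fix k assume k: "k \<in> {1..n+1}"
      have 1: "b0 k \<in> span (b0 ` {1..2*n+2})" "b0 (n + 1 + k) \<in> span (b0 ` {1..2*n+2})"
        using k by (auto intro!: span_base)
      have "axis (e k) 1 = (1/2) *\<^sub>R (b0 k + b0 (n + 1 + k))"
        "axis (e (n + 1 + k)) 1 = (1/2) *\<^sub>R (b0 k - b0 (n + 1 + k))"
        using k by (simp_all add: b0_def vec_eq_iff)
      then show "axis (e k) 1 \<in> span (b0 ` {1..2*n+2}) \<and> axis (e (n + 1 + k)) 1 \<in> span (b0 ` {1..2*n+2})"
        using span_scale[OF span_add[OF 1], of "1/2"] span_scale[OF span_diff[OF 1], of "1/2"] by simp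
    qed
    show "J (b k) = c k *\<^sub>R b k" if k: "k \<in> {1..2*n+2}" for k
      using k
    proof (cases rule: index_cases)
      case 1
      then have "h k \<in> B" using hB by blast
      then show ?thesis using 1 by (simp add: bk(1)[OF 1] c_def J(2))
    next
      case (2 l)
      then have "h' l \<in> B'" using hB by blast
      then show ?thesis using 2 bk(2)[OF 2(1)] by (simp add: c_def J(3))
    qed
    show "para_complex_structure n e (b0 k) = c k *\<^sub>R b0 k" if k: "k \<in> {1..2*n+2}" for k
      using k
    proof (cases rule: index_cases)
      case 1 then show ?thesis using structure_axis(1,2)[OF 1]
        by (simp add: b0_def c_def linear_add[OF linear_para_complex_structure])
    next
      case (2 l) then show ?thesis using structure_axis(1,2)[OF 2(1)]
        by (simp add: b0_def c_def linear_diff[OF linear_para_complex_structure])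
    qed
  qed (use cd in auto)
qed

end

section \<open>Flat frames with a parallel product\<close>

lemmas mat_simps =
  bounded_bilinear.add_left[OF bounded_bilinear_matrix_matrix_mult]
  bounded_bilinear.add_right[OF bounded_bilinear_matrix_matrix_mult]
  bounded_bilinear.diff_left[OF bounded_bilinear_matrix_matrix_mult]
  bounded_bilinear.diff_right[OF bounded_bilinear_matrix_matrix_mult]
  bounded_bilinear.minus_left[OF bounded_bilinear_matrix_matrix_mult]
  bounded_bilinear.minus_right[OF bounded_bilinear_matrix_matrix_mult]
  bounded_bilinear.scaleR_left[OF bounded_bilinear_matrix_matrix_mult]
  bounded_bilinear.scaleR_right[OF bounded_bilinear_matrix_matrix_mult]
  bounded_bilinear.zero_left[OF bounded_bilinear_matrix_matrix_mult]
  bounded_bilinear.zero_right[OF bounded_bilinear_matrix_matrix_mult]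

lemmas vmat_simps =
  bounded_bilinear.add_left[OF bounded_bilinear_vector_matrix_mult]
  bounded_bilinear.add_right[OF bounded_bilinear_vector_matrix_mult]
  bounded_bilinear.diff_left[OF bounded_bilinear_vector_matrix_mult]
  bounded_bilinear.diff_right[OF bounded_bilinear_vector_matrix_mult]
  bounded_bilinear.minus_left[OF bounded_bilinear_vector_matrix_mult]
  bounded_bilinear.minus_right[OF bounded_bilinear_vector_matrix_mult]
  bounded_bilinear.scaleR_left[OF bounded_bilinear_vector_matrix_mult]
  bounded_bilinear.scaleR_right[OF bounded_bilinear_vector_matrix_mult]
  bounded_bilinear.zero_left[OF bounded_bilinear_vector_matrix_mult]
  bounded_bilinear.zero_right[OF bounded_bilinear_vector_matrix_mult]

lemma transpose_simps:
  fixes A B :: "real^'n^'m"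
  shows "transpose (A + B) = transpose A + transpose B" "transpose (A - B) = transpose A - transpose B"
    "transpose (- A) = - transpose A"
  by (simp_all add: vec_eq_iff transpose_def)

lemma trace_simps:
  fixes A B :: "real^'n^'n"
  shows "trace (A + B) = trace A + trace B" "trace (A - B) = trace A - trace B" "trace (c *\<^sub>R A) = c * trace A"
  by (simp_all add: trace_def sum.distrib sum_subtractf sum_distrib_left)

lemma dot_vector_matrix: "(x v* (A :: real^'n^'m)) \<bullet> y = x \<bullet> (A *v y)"
  by (metis dot_lmul_matrix)

lemma matrix_eq_left:
  fixes A B :: "real^'n^'m"
  assumes "\<And>x. x v* A = x v* B" shows "A = B"
proof -
  have "(axis i 1 v* A) = A $ i" for i and A :: "real^'n^'m"
    by (simp add: vec_eq_iff vector_matrix_mult_def axis_def if_distrib if_distribR cong: if_cong)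
  then show ?thesis using assms by (metis vec_eq_iff)
qed

subsection \<open>Two algebraic facts on bilinear forms\<close>

text \<open>For a commutative product and \<open>F a b c d = h (a b, c d)\<close>, vanishing of the sectional
  curvature is the hypothesis \<open>sec\<close>, and the conclusion is associativity.\<close>
lemma sectional_polarization:
  fixes F :: "'v::ab_group_add \<Rightarrow> 'v \<Rightarrow> 'v \<Rightarrow> 'v \<Rightarrow> real"
  assumes add: "\<And>a a' b c d. F (a + a') b c d = F a b c d + F a' b c d"
    and sym: "\<And>a b c d. F a b c d = F b a c d" "\<And>a b c d. F a b c d = F c d a b"
    and sec: "\<And>v w. F w v w v = F w w v v"
  shows "F a b c d = F a c b d"
proof -
  have add2: "F b (a + a') c d = F b a c d + F b a' c d"
    "F c d (a + a') b = F c d a b + F c d a' b" "F c d b (a + a') = F c d b a + F c d b a'" for a a' b c d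
    by (metis add sym)+
  \<comment> \<open>First polarization, in the variable \<open>w\<close> of
    \<open>sec\<close>.\<close>
  have h1: "F w v u v = F w u v v" for u v w
  proof -
    have "F (w + u) v (w + u) v = F w v w v + F u v u v + 2 * F w v u v"
      unfolding add add2 using sym(2)[of w v u v] by simp
    moreover have "F (w + u) (w + u) v v = F w w v v + F u u v v + 2 * F w u v v"
      unfolding add add2 using sym(1)[of w u v v] by simp
    ultimately show ?thesis using sec[of "w + u" v] sec[of w v] sec[of u v] by simp
  qed
  \<comment> \<open>Second polarization, in the repeated variable \<open>v\<close> of
    \<open>h1\<close>.\<close>
  have h2: "F w v u z + F w z u v = 2 * F w u v z" for u v w z
  proof -
    have "F w (v + z) u (v + z) = F w v u v + F w z u z + F w v u z + F w z u v"
      unfolding add add2 by simp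
    moreover have "F w u (v + z) (v + z) = F w u v v + F w u z z + 2 * F w u v z"
    proof -
      have "F w u z v = F w u v z" by (metis sym)
      then show ?thesis unfolding add add2 by simp
    qed
    ultimately show ?thesis using h1[of w "v + z" u] h1[of w v u] h1[of w z u] by simp
  qed
  \<comment> \<open>Two instances of \<open>h2\<close> share the middle term: from
    \<open>x + y = 2 * z\<close> and \<open>z + y = 2 * x\<close> follows
    \<open>x = z\<close>.\<close>
  have "F a b c d + F a d c b = 2 * F a c b d" by (rule h2)
  moreover have "F a c b d + F a d b c = 2 * F a b c d" by (rule h2)
  moreover have "F a d c b = F a d b c" by (metis sym)
  ultimately show ?thesis by linarith
qed

text \<open>Polarization gives a vector \<open>v\<close> with \<open>g v v \<noteq> 0\<close>. If
  all vectors orthogonal to \<open>v\<close> were isotropic, \<open>g\<close> would vanish on the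
  orthogonal complement, and the projection \<open>pr x\<close> of a vector outside the line of
  \<open>v\<close> would lie in the radical.\<close>

lemma exists_nondegenerate_plane:
  fixes g :: "'v::euclidean_space \<Rightarrow> 'v \<Rightarrow> real"
  assumes g: "bilinear g" "\<And>u v. g u v = g v u" "\<And>u. (\<And>v. g u v = 0) \<Longrightarrow> u = 0" and d: "DIM('v) \<ge> 2"
  shows "\<exists>v w. g v v * g w w - (g v w)\<^sup>2 \<noteq> 0"
proof -
  note gs = bilinear_ladd[OF g(1)] bilinear_radd[OF g(1)] bilinear_lsub[OF g(1)] bilinear_rsub[OF g(1)]
    bilinear_lmul[OF g(1)] bilinear_rmul[OF g(1)] bilinear_lzero[OF g(1)]
  obtain x0 :: 'v where x0: "x0 \<noteq> 0" using nonzero_Basis SOME_Basis by blast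
  obtain v where v: "g v v \<noteq> 0"
  proof -
    obtain y where y: "g x0 y \<noteq> 0" using g(3) x0 by blast
    have "g (x0 + y) (x0 + y) = g x0 x0 + g y y + 2 * g x0 y" using g(2)[of x0 y] by (simp add: gs)
    then have "g (x0 + y) (x0 + y) \<noteq> 0 \<or> g x0 x0 \<noteq> 0 \<or> g y y \<noteq> 0" using y by auto
    then show ?thesis using that by blast
  qed
  have "span {v} \<noteq> UNIV"
  proof
    assume "span {v} = UNIV"
    then have "dim (UNIV :: 'v set) \<le> card {v}" by (metis dim_le_card finite.emptyI finite_insert order_refl)
    then show False using d by simp
  qed
  then obtain x where x: "x \<notin> span {v}" by blast
  define pr where "pr y = y - (g v y / g v v) *\<^sub>R v" for y
  have orth: "g v (pr y) = 0" for y using v by (simp add: pr_def gs)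
  have w0: "pr x \<noteq> 0"
  proof
    assume "pr x = 0"
    then have "x = (g v x / g v v) *\<^sub>R v" by (simp add: pr_def)
    also have "\<dots> \<in> span {v}" by (intro span_scale span_base) simp
    finally show False using x by simp
  qed
  have "\<exists>w. g v w = 0 \<and> g w w \<noteq> 0"
  proof (rule ccontr)
    assume "\<not> ?thesis"
    then have z: "g w w = 0" if "g v w = 0" for w using that by blast
    have "g (pr x) y = 0" for y
    proof -
      have y: "y = pr y + (g v y / g v v) *\<^sub>R v" by (simp add: pr_def)
      have "g (pr x + pr y) (pr x + pr y) = 0" by (rule z) (simp add: gs orth)
      then have "g (pr x) (pr y) = 0"
        using z[OF orth[of x]] z[OF orth[of y]] g(2)[of "pr x" "pr y"] by (simp add: gs)
      then have "g (pr x) (pr y + (g v y / g v v) *\<^sub>R v) = 0"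
        using orth[of x] g(2)[of "pr x" v] by (simp only: gs) simp
      then show ?thesis using y by simp
    qed
    then show False using g(3) w0 by blast
  qed
  then show ?thesis using v by (metis diff_zero mult_eq_0_iff power_zero_numeral)
qed

text \<open>Nondegenerate planes are dense: on the line of planes from \<open>v, w\<close> in the
  direction of a nondegenerate plane \<open>v', w'\<close>, the Gram determinant is a polynomial in
  \<open>t\<close> whose coefficient of degree 4 is the Gram determinant of \<open>v', w'\<close>.
  It has finitely many zeros, so \<open>q\<close> vanishes on a punctured neighbourhood of 0 and, by
  continuity, at 0.\<close>

lemma zero_of_nondegenerate_planes:
  fixes g :: "'v::euclidean_space \<Rightarrow> 'v \<Rightarrow> real" and q :: "'v \<Rightarrow> 'v \<Rightarrow> real"
  assumes g: "bilinear g" "\<And>u v. g u v = g v u" "\<And>u. (\<And>v. g u v = 0) \<Longrightarrow> u = 0" and d: "DIM('v) \<ge> 2"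
    and q: "\<And>v w v' w'. isCont (\<lambda>t. q (v + t *\<^sub>R v') (w + t *\<^sub>R w')) 0"
    and z: "\<And>v w. g v v * g w w - (g v w)\<^sup>2 \<noteq> 0 \<Longrightarrow> q v w = 0"
  shows "q v w = 0"
proof -
  note gs = bilinear_ladd[OF g(1)] bilinear_radd[OF g(1)] bilinear_lmul[OF g(1)] bilinear_rmul[OF g(1)]
  obtain v' w' where ne: "g v' v' * g w' w' - (g v' w')\<^sup>2 \<noteq> 0"
    using exists_nondegenerate_plane[OF g d] by blast
  define P where "P = [:g v v, g v v' + g v' v, g v' v':] * [:g w w, g w w' + g w' w, g w' w':]
      - [:g v w, g v w' + g v' w, g v' w':]\<^sup>2"
  have P: "poly P t = g (v + t *\<^sub>R v') (v + t *\<^sub>R v') * g (w + t *\<^sub>R w') (w + t *\<^sub>R w')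
      - (g (v + t *\<^sub>R v') (w + t *\<^sub>R w'))\<^sup>2" for t
    by (simp add: P_def gs algebra_simps power2_eq_square)
  have "coeff P 4 = g v' v' * g w' w' - (g v' w')\<^sup>2"
    by (simp add: P_def power2_eq_square numeral_eq_Suc)
  then have "P \<noteq> 0" using ne by auto
  then have fin: "finite {t. poly P t = 0}" by (rule poly_roots_finite)
  let ?f = "\<lambda>t. q (v + t *\<^sub>R v') (w + t *\<^sub>R w')"
  have "eventually (\<lambda>t. ?f t = 0) (at 0)"
  proof -
    have "open (- ({t. poly P t = 0} - {0}))"
      by (intro open_Compl finite_imp_closed finite_Diff fin)
    then have "eventually (\<lambda>t. t \<notin> {t. poly P t = 0} - {0}) (at 0)"
      by (intro eventually_at_topological[THEN iffD2] exI[of _ "- ({t. poly P t = 0} - {0})"]) auto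
    then have "eventually (\<lambda>t. poly P t \<noteq> 0) (at 0)"
      by (auto elim!: eventually_elim2[OF eventually_neq_at_within[of 0]] simp: eventually_at_filter)
    then show ?thesis by eventually_elim (rule z, use P in metis)
  qed
  then have "(?f \<longlongrightarrow> 0) (at 0)" by (rule tendsto_eventually)
  moreover have "(?f \<longlongrightarrow> ?f 0) (at 0)" using q by (simp add: isCont_def)
  ultimately have "?f 0 = 0" using tendsto_unique[of "at (0::real)"] by (metis at_neq_bot)
  then show ?thesis by simp
qed

section \<open>The equations of Gauss and Codazzi in matrix form\<close>

abbreviation dird :: "('a::euclidean_space \<Rightarrow> 'b::euclidean_space) \<Rightarrow> 'a \<Rightarrow> 'a \<Rightarrow> 'b" where
  "dird F p v \<equiv> frechet_derivative F (at p) v"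

text \<open>The integrability condition of \<open>dT = A T\<close>, that is, vanishing curvature of
  the ambient connection. It is the symmetry of the second derivatives of \<open>T\<close>, with the
  invertible \<open>T\<close> cancelled.\<close>

lemma connection_matrix_flat:
  fixes T :: "real^'m \<Rightarrow> real^'k^'k"
  assumes U: "open U" and smooth: "smooth_on U T" "\<And>w. smooth_on U (A w)"
    and invT: "\<And>p. p \<in> U \<Longrightarrow> invertible (T p)"
    and DT: "\<And>p w. p \<in> U \<Longrightarrow> dird T p w = A w p ** T p" and p: "p \<in> U"
  shows "dird (A w) p v + A w p ** A v p = dird (A v) p w + A v p ** A w p"
proof -
  have DD: "dird (\<lambda>q. dird T q w) p v = (dird (A w) p v + A w p ** A v p) ** T p" for v w
  proof -
    have "dird (\<lambda>q. dird T q w) p v = dird (\<lambda>q. A w q ** T q) p v"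
      using frechet_derivative_cong_open[OF U p DT] by simp
    then show ?thesis
      by (simp add: frechet_derivative_bilinear[OF bounded_bilinear_matrix_matrix_mult
            smooth_on_differentiable[OF smooth(2) p] smooth_on_differentiable[OF smooth(1) p]]
          DT[OF p] mat_simps matrix_mul_assoc)
  qed
  have "(dird (A w) p v + A w p ** A v p) ** T p = (dird (A v) p w + A v p ** A w p) ** T p"
    using second_derivative_symmetric[OF U p smooth(1), of w v] unfolding DD .
  then have "(dird (A w) p v + A w p ** A v p) ** T p ** matrix_inv (T p)
      = (dird (A v) p w + A v p ** A w p) ** T p ** matrix_inv (T p)" by simp
  then show ?thesis by (simp add: matrix_inv_left_right[OF invT[OF p]] flip: matrix_mul_assoc)
qed

text \<open>Matrices act on row vectors. \<open>T\<close> is a frame of the ambient space with connection matrices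
  \<open>A\<close>, \<open>Gam\<close> the Levi-Civita connection of a metric, extended by the flat direction \<open>None\<close>,
  and \<open>G\<close> the Gram matrix. The difference \<open>M\<close> is the multiplication of a commutative algebra.\<close>
locale parallel_frame =
  fixes U :: "(real^'m::finite) set" and T G :: "real^'m \<Rightarrow> real^'m option^'m option"
    and A Gam :: "real^'m \<Rightarrow> real^'m \<Rightarrow> real^'m option^'m option"
  assumes U: "open U"
    and smooth: "smooth_on U T" "smooth_on U G" "\<And>w. smooth_on U (A w)" "\<And>w. smooth_on U (Gam w)"
    and invT: "\<And>p. p \<in> U \<Longrightarrow> invertible (T p)" and invG: "\<And>p. p \<in> U \<Longrightarrow> invertible (G p)"
    and DT: "\<And>p w. p \<in> U \<Longrightarrow> dird T p w = A w p ** T p"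
    and DG: "\<And>p w. p \<in> U \<Longrightarrow> dird G p w = Gam w p ** G p + G p ** transpose (Gam w p)"
    and G_sym: "\<And>p. p \<in> U \<Longrightarrow> transpose (G p) = G p"
    and G_None: "\<And>p y. p \<in> U \<Longrightarrow> (y v* G p) $ None = y $ None"
    and lin: "\<And>p. p \<in> U \<Longrightarrow> linear (\<lambda>w. A w p)" "\<And>p. p \<in> U \<Longrightarrow> linear (\<lambda>w. Gam w p)"
    and AG_sym: "\<And>p w. p \<in> U \<Longrightarrow> transpose ((A w p - Gam w p) ** G p) = (A w p - Gam w p) ** G p"
    and A_None: "\<And>p w. p \<in> U \<Longrightarrow> axis None 1 v* A w p = hat w"
    and Gam_None: "\<And>p w. p \<in> U \<Longrightarrow> axis None 1 v* Gam w p = 0"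
    and Gam_col: "\<And>p w y. p \<in> U \<Longrightarrow> (y v* Gam w p) $ None = 0"
    and A_comm: "\<And>p v w. p \<in> U \<Longrightarrow> hat v v* A w p = hat w v* A v p"
    and Gam_comm: "\<And>p v w. p \<in> U \<Longrightarrow> hat v v* Gam w p = hat w v* Gam v p"
    and trace_free: "\<And>p w. p \<in> U \<Longrightarrow> trace (A w p - Gam w p) = 0"
begin

definition M where "M w p = A w p - Gam w p"

text \<open>The curvature of \<open>Gam\<close> on constant fields. The products appear in reversed
  order because matrices act on row vectors.\<close>

definition R where "R v w p = dird (Gam w) p v + Gam w p ** Gam v p - (dird (Gam v) p w + Gam v p ** Gam w p)"

lemma smooth_M: "smooth_on U (M w)"
  unfolding M_def[abs_def] by (intro smooth_on_diff U smooth)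

lemma DAB: 
  fixes F H :: "real^'m \<Rightarrow> real^'m option^'m option"
  assumes "smooth_on U F" "smooth_on U H" "p \<in> U"
  shows "dird (\<lambda>q. F q ** H q) p v = F p ** dird H p v + dird F p v ** H p"
  by (rule frechet_derivative_bilinear[OF bounded_bilinear_matrix_matrix_mult
        smooth_on_differentiable[OF assms(1,3)] smooth_on_differentiable[OF assms(2,3)]])

lemma Dcong: "p \<in> U \<Longrightarrow> (\<And>q. q \<in> U \<Longrightarrow> F q = H q) \<Longrightarrow> dird F p v = dird H p v"
  using frechet_derivative_cong_open[OF U] by metis

lemma Dadd:
  assumes "smooth_on U F" "smooth_on U H" "p \<in> U"
  shows "dird (\<lambda>q. F q + H q) p v = dird F p v + dird H p v"
  using assms by (intro frechet_derivative_eqI has_derivative_add smooth_on_has_derivative)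

lemma DA_symmetric:
  "p \<in> U \<Longrightarrow> dird (A w) p v + A w p ** A v p = dird (A v) p w + A v p ** A w p"
  by (rule connection_matrix_flat[OF U smooth(1) smooth(3) invT DT])

text \<open>Symmetry of the second derivatives of \<open>G\<close>, with \<open>DG\<close>
  substituted twice: the curvature of a metric connection is skew for the metric.\<close>

lemma R_skew:
  assumes p: "p \<in> U"
  shows "transpose (R v w p ** G p) = - (R v w p ** G p)"
proof -
  have DD: "dird (\<lambda>q. dird G q w) p v = dird (Gam w) p v ** G p + Gam w p ** (Gam v p ** G p + G p ** transpose (Gam v p))
     + (Gam v p ** G p + G p ** transpose (Gam v p)) ** transpose (Gam w p) + G p ** transpose (dird (Gam w) p v)" for v w
  proof -
    have sT: "smooth_on U (\<lambda>q. transpose (Gam w q))"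
      by (intro smooth_on_linear[OF U bounded_linear_transpose] smooth)
    have "dird (\<lambda>q. dird G q w) p v = dird (\<lambda>q. Gam w q ** G q + G q ** transpose (Gam w q)) p v"
      by (rule Dcong[OF p DG])
    also have "\<dots> = dird (\<lambda>q. Gam w q ** G q) p v + dird (\<lambda>q. G q ** transpose (Gam w q)) p v"
      by (intro Dadd smooth_on_bilinear[OF U bounded_bilinear_matrix_matrix_mult] smooth sT p)
    finally show ?thesis
      by (simp add: DAB[OF smooth(4,2) p] DAB[OF smooth(2) sT p] DG[OF p]
          frechet_derivative_linear[OF bounded_linear_transpose smooth_on_differentiable[OF smooth(4) p]])
  qed
  have "R v w p ** G p + G p ** transpose (R v w p) = 0"
    using second_derivative_symmetric[OF U p smooth(2), of w v] unfolding DD R_def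
    by (simp add: mat_simps transpose_simps matrix_transpose_mul matrix_mul_assoc algebra_simps)
  then have "G p ** transpose (R v w p) = - (R v w p ** G p)" by (simp add: eq_neg_iff_add_eq_0 add.commute)
  then show ?thesis by (simp add: matrix_transpose_mul G_sym[OF p])
qed

text \<open>The covariant derivative of the endomorphism \<open>M w\<close> along \<open>v\<close>,
  with the label \<open>w\<close> held constant; \<open>Pi\<close> below also differentiates the
  label.\<close>

definition DM where "DM v w p = dird (M w) p v + M w p ** Gam v p - Gam v p ** M w p"

lemma MG_sym: "p \<in> U \<Longrightarrow> transpose (M w p ** G p) = M w p ** G p"
  using AG_sym by (simp add: M_def)

lemma G_transpose_M: "p \<in> U \<Longrightarrow> G p ** transpose (M w p) = M w p ** G p"
  using MG_sym by (simp add: matrix_transpose_mul G_sym)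

lemma DM_sym_G:
  assumes p: "p \<in> U"
  shows "transpose (DM v w p ** G p) = DM v w p ** G p"
proof -
  let ?X = "M w p ** G p"
  have sMG: "smooth_on U (\<lambda>q. M w q ** G q)"
    by (intro smooth_on_bilinear[OF U bounded_bilinear_matrix_matrix_mult] smooth smooth_M)
  have "dird (\<lambda>q. transpose (M w q ** G q)) p v = dird (\<lambda>q. M w q ** G q) p v"
    by (rule Dcong[OF p MG_sym])
  then have "transpose (dird (\<lambda>q. M w q ** G q) p v) = dird (\<lambda>q. M w q ** G q) p v"
    by (simp add: frechet_derivative_linear[OF bounded_linear_transpose smooth_on_differentiable[OF sMG p]])
  then have D: "transpose (dird (M w) p v ** G p + M w p ** Gam v p ** G p + ?X ** transpose (Gam v p))
     = dird (M w) p v ** G p + M w p ** Gam v p ** G p + ?X ** transpose (Gam v p)"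
    by (simp add: DAB[OF smooth_M smooth(2) p] DG[OF p] mat_simps matrix_mul_assoc algebra_simps)
  have X: "transpose ?X = ?X" by (rule MG_sym[OF p])
  let ?P = "dird (M w) p v ** G p + M w p ** Gam v p ** G p + ?X ** transpose (Gam v p)"
    and ?Q = "?X ** transpose (Gam v p) + Gam v p ** ?X"
  have "DM v w p ** G p = (dird (M w) p v ** G p + M w p ** Gam v p ** G p + ?X ** transpose (Gam v p))
     - (?X ** transpose (Gam v p) + Gam v p ** ?X)"
    by (simp add: DM_def mat_simps matrix_mul_assoc)
  moreover have "transpose (?X ** transpose (Gam v p) + Gam v p ** ?X) = ?X ** transpose (Gam v p) + Gam v p ** ?X"
    by (simp only: transpose_simps matrix_transpose_mul[of ?X] matrix_transpose_mul[of _ ?X] X transpose_transpose)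
      (rule add.commute)
  ultimately show ?thesis using D transpose_simps(2)[of ?P ?Q] by (simp only:)
qed

lemma curvature_decomposition:
  assumes p: "p \<in> U"
  shows "R v w p + (DM v w p - DM w v p) + (M w p ** M v p - M v p ** M w p) = 0"
proof -
  have A: "A w p = Gam w p + M w p" for w by (simp add: M_def)
  have DA: "dird (A w) p v = dird (Gam w) p v + dird (M w) p v" for v w
  proof -
    have "dird (A w) p v = dird (\<lambda>q. Gam w q + M w q) p v" by (rule Dcong[OF p]) (simp add: M_def)
    then show ?thesis using Dadd[OF smooth(4) smooth_M p] by simp
  qed
  show ?thesis
    using DA_symmetric[OF p, of w v] unfolding DA A R_def DM_def
    by (simp add: mat_simps algebra_simps)
qed

text \<open>After multiplication by \<open>G\<close>, the curvature and the commutator in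
  \<open>curvature_decomposition\<close> are skew, whereas the difference of the derivatives of
  \<open>M\<close> is symmetric. The symmetric part of the equation is Codazzi, the skew part is
  Gauss.\<close>

lemma
  assumes p: "p \<in> U"
  shows codazzi: "DM v w p = DM w v p" and gauss: "R v w p = - (M w p ** M v p - M v p ** M w p)"
proof -
  let ?X = "R v w p ** G p" and ?Y = "(DM v w p - DM w v p) ** G p"
    and ?Z = "(M w p ** M v p - M v p ** M w p) ** G p"
  have sum: "?X + ?Y + ?Z = 0"
    using arg_cong[OF curvature_decomposition[OF p, of v w], of "\<lambda>x. x ** G p"] by (simp add: mat_simps)
  have Y: "transpose ?Y = ?Y" by (simp add: mat_simps transpose_simps DM_sym_G[OF p])
  have MM: "transpose (M w p ** M v p ** G p) = M v p ** M w p ** G p" for v w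
  proof -
    have "transpose (M w p ** M v p ** G p) = G p ** transpose (M v p) ** transpose (M w p)"
      by (simp add: matrix_transpose_mul G_sym[OF p] matrix_mul_assoc)
    also have "\<dots> = M v p ** G p ** transpose (M w p)" by (simp only: G_transpose_M[OF p])
    also have "\<dots> = M v p ** (G p ** transpose (M w p))" by (simp only: matrix_mul_assoc)
    finally show ?thesis unfolding G_transpose_M[OF p] by (simp add: matrix_mul_assoc)
  qed
  have Z: "transpose ?Z = - ?Z" by (simp add: mat_simps transpose_simps MM)
  have "transpose (?X + ?Y + ?Z) = 0" unfolding sum by (simp add: vec_eq_iff transpose_def)
  then have "- ?X + ?Y - ?Z = 0" by (simp add: transpose_simps(1) Y Z R_skew[OF p])
  moreover have "?Y + ?Y = (?X + ?Y + ?Z) + (- ?X + ?Y - ?Z)" by simp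
  ultimately have "?Y + ?Y = 0" using sum by (simp only: add_0_left)
  then have Y0: "?Y = 0" by (simp flip: scaleR_2)
  then have X0: "?X = - ?Z" using sum by (simp add: eq_neg_iff_add_eq_0)
  have canc: "B = C" if "B ** G p = C ** G p" for B C
    using arg_cong[OF that, of "\<lambda>x. x ** matrix_inv (G p)"]
    by (simp add: matrix_inv_left_right[OF invG[OF p]] flip: matrix_mul_assoc)
  show "DM v w p = DM w v p" by (rule canc) (use Y0 in \<open>simp add: mat_simps\<close>)
  show "R v w p = - (M w p ** M v p - M v p ** M w p)" by (rule canc) (use X0 in \<open>simp add: mat_simps\<close>)
qed

end

lemma symmetric_matrix_dot:
  fixes S :: "real^'n^'n"
  assumes "transpose S = S"
  shows "(x v* S) \<bullet> y = (y v* S) \<bullet> x"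
proof -
  have "(x v* S) \<bullet> y = x \<bullet> (S *v y)" by (rule dot_vector_matrix)
  also have "S *v y = y v* transpose S" by simp
  finally show ?thesis unfolding assms by (simp add: inner_commute)
qed

text \<open>Gronwall's argument: the sum of squares \<open>s\<close> satisfies
  \<open>s' \<le> K * s\<close>, so \<open>exp (- K * t) * s t\<close> does not increase from its
  value 0.\<close>

lemma linear_ode_zero:
  fixes y :: "'m::finite \<Rightarrow> real \<Rightarrow> real"
  assumes dy: "\<And>j t. 0 \<le> t \<Longrightarrow> t \<le> 1 \<Longrightarrow> (y j has_real_derivative (\<Sum>k\<in>UNIV. c j k t * y k t)) (at t)"
    and B: "\<And>j k t. t \<in> {0..1} \<Longrightarrow> \<bar>c j k t\<bar> \<le> B" and y0: "\<And>j. y j 0 = 0"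
  shows "y j 1 = 0"
proof -
  define s where "s t = (\<Sum>j\<in>UNIV. (y j t)\<^sup>2)" for t
  \<comment> \<open>Each term of the double sum is at most
    \<open>B * ((y j t)\<^sup>2 + (y k t)\<^sup>2)\<close>, and both squares add up to
    \<open>CARD('m)\<close> times \<open>s t\<close>.\<close>
  define K where "K = 2 * B * CARD('m)"
  let ?s' = "\<lambda>t. \<Sum>j\<in>UNIV. 2 * y j t * (\<Sum>k\<in>UNIV. c j k t * y k t)"
  have ds: "(s has_real_derivative ?s' t) (at t)" if "0 \<le> t" "t \<le> 1" for t
    unfolding s_def by (auto intro!: derivative_eq_intros dy[OF that] sum.cong simp: mult_ac)
  have le: "?s' t \<le> K * s t" if t: "0 \<le> t" "t \<le> 1" for t
  proof -
    have "2 * (y j t * (c j k t * y k t)) \<le> B * ((y j t)\<^sup>2 + (y k t)\<^sup>2)" for j k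
    proof -
      have "2 * (y j t * (c j k t * y k t)) \<le> \<bar>c j k t\<bar> * (2 * \<bar>y j t\<bar> * \<bar>y k t\<bar>)"
        using abs_ge_self[of "2 * (y j t * (c j k t * y k t))"] by (simp add: abs_mult ac_simps)
      also have "\<dots> \<le> B * ((y j t)\<^sup>2 + (y k t)\<^sup>2)"
        using B[of t j k] t sum_squares_bound[of "\<bar>y j t\<bar>" "\<bar>y k t\<bar>"] by (intro mult_mono) auto
      finally show ?thesis .
    qed
    then have "(\<Sum>j\<in>UNIV. \<Sum>k\<in>UNIV. 2 * (y j t * (c j k t * y k t))) \<le> (\<Sum>j\<in>UNIV. \<Sum>k\<in>UNIV. B * ((y j t)\<^sup>2 + (y k t)\<^sup>2))"
      by (intro sum_mono)
    also have "\<dots> = K * s t"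
      by (simp add: K_def s_def sum.distrib sum_distrib_left[symmetric] distrib_left)
    finally show ?thesis by (simp add: sum_distrib_left mult.assoc)
  qed
  define F where "F t = exp (- K * t) * s t" for t
  have "F 1 \<le> F 0"
  proof (rule DERIV_nonpos_imp_nonincreasing[of 0 1 F])
    fix t :: real assume t: "0 \<le> t" "t \<le> 1"
    have "(F has_real_derivative exp (- K * t) * (?s' t - K * s t)) (at t)"
      unfolding F_def by (auto intro!: derivative_eq_intros ds[OF t] simp: algebra_simps)
    moreover have "exp (- K * t) * (?s' t - K * s t) \<le> 0"
      using le[OF t] by (intro mult_nonneg_nonpos) auto
    ultimately show "\<exists>y. (F has_real_derivative y) (at t) \<and> y \<le> 0" by blast
  qed simp
  then have "s 1 \<le> 0" by (simp add: F_def s_def y0 mult_le_0_iff)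
  then have "s 1 = 0" using sum_nonneg[of UNIV "\<lambda>j. (y j 1)\<^sup>2"] by (simp add: s_def)
  then have "(y j 1)\<^sup>2 = 0" unfolding s_def by (subst (asm) sum_nonneg_eq_0_iff) auto
  then show ?thesis by simp
qed

section \<open>Flatness and associativity of the product\<close>

locale flat_parallel_frame = parallel_frame U T G A Gam
  for U :: "(real^'m::finite) set" and T G :: "real^'m \<Rightarrow> real^'m option^'m option"
    and A Gam :: "real^'m \<Rightarrow> real^'m \<Rightarrow> real^'m option^'m option" +
  assumes dim: "CARD('m) \<ge> 2"
    and sectional: "\<And>p v w. p \<in> U \<Longrightarrow> ((hat v v* G p) \<bullet> hat v) * ((hat w v* G p) \<bullet> hat w) - ((hat v v* G p) \<bullet> hat w)\<^sup>2 \<noteq> 0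
      \<Longrightarrow> (hat w v* R v w p v* G p) \<bullet> hat v = 0"
begin

abbreviation e0 :: "real^'m option" where "e0 \<equiv> axis None 1"

text \<open>The invariant form of the algebra. By \<open>G_None\<close> the unit \<open>e0\<close>
  has length 1 and is orthogonal to the tangential coordinates.\<close>

definition b where "b p x y = (x v* G p) \<bullet> y"

lemma b_sym: "p \<in> U \<Longrightarrow> b p x y = b p y x"
  unfolding b_def by (rule symmetric_matrix_dot[OF G_sym])

lemma bM: "p \<in> U \<Longrightarrow> b p (x v* M w p) y = b p x (y v* M w p)"
  using symmetric_matrix_dot[OF MG_sym, of p x w y]
  by (simp add: b_def vector_matrix_mul_assoc b_sym[unfolded b_def] inner_commute)
    (metis b_def b_sym inner_commute vector_matrix_mul_assoc)

lemma b_simps: "b p (x + y) z = b p x z + b p y z" "b p (x - y) z = b p x z - b p y z"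
  "b p (c *\<^sub>R x) z = c * b p x z" "b p z (x + y) = b p z x + b p z y" "b p z (x - y) = b p z x - b p z y"
  "b p z (c *\<^sub>R x) = c * b p z x"
  by (simp_all add: b_def vmat_simps inner_simps)

lemma b_e0: "p \<in> U \<Longrightarrow> b p x e0 = x $ None"
  by (simp add: b_def inner_axis G_None)

lemma b_nondeg: "p \<in> U \<Longrightarrow> (\<And>y. b p x y = 0) \<Longrightarrow> x = 0"
proof -
  assume p: "p \<in> U" and "\<And>y. b p x y = 0"
  then have "x v* G p = 0" by (metis b_def inner_eq_zero_iff)
  then have "x v* G p v* matrix_inv (G p) = 0" by (simp add: vmat_simps)
  then show "x = 0" by (simp add: vector_matrix_mul_assoc matrix_inv_left_right[OF invG[OF p]])
qed

lemma hat_simps: "hat (u + v) = hat u + hat v" "hat (c *\<^sub>R u) = c *\<^sub>R hat u" "hat 0 = 0"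
  by (simp_all add: vec_eq_iff all_option)

lemma M_linear: "p \<in> U \<Longrightarrow> linear (\<lambda>w. M w p)"
  unfolding M_def by (intro linear_compose_sub lin)

lemma M_add: "p \<in> U \<Longrightarrow> M (u + v) p = M u p + M v p"
  and M_scale: "p \<in> U \<Longrightarrow> M (c *\<^sub>R u) p = c *\<^sub>R M u p"
  using linear_add[OF M_linear] linear_scale[OF M_linear] by auto

lemma M_axis: "p \<in> U \<Longrightarrow> M a p = (\<Sum>j\<in>UNIV. a $ j *\<^sub>R M (axis j 1) p)"
  by (rule linear_as_sum_axis[OF M_linear])

lemma e0_M: "p \<in> U \<Longrightarrow> e0 v* M w p = hat w"
  by (simp add: M_def vmat_simps A_None Gam_None)

lemma M_comm: "p \<in> U \<Longrightarrow> hat u v* M v p = hat v v* M u p"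
  using A_comm[of p u v] Gam_comm[of p u v] by (simp add: M_def vmat_simps)

text \<open>By the Gauss equation and self-adjointness of multiplications, the numerator of the
  sectional curvature is the difference of the two sides up to sign. It vanishes on nondegenerate
  planes, which are dense.\<close>

lemma sectional_b:
  assumes p: "p \<in> U"
  shows "b p (hat w v* M v p) (hat w v* M v p) = b p (hat w v* M w p) (hat v v* M v p)"
proof -
  define q where "q v w = b p (hat w v* M v p) (hat w v* M v p) - b p (hat w v* M w p) (hat v v* M v p)" for v w
  define g where "g u v = b p (hat u) (hat v)" for u v
  have gq: "q v w = 0"
  proof (rule zero_of_nondegenerate_planes[of g q])
    show "bilinear g" unfolding bilinear_def g_def
      by (auto intro!: linearI simp: hat_simps b_simps)
    show "g u v = g v u" for u v unfolding g_def by (rule b_sym[OF p])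
    show "u = 0" if "\<And>v. g u v = 0" for u
    proof -
      have "b p (hat u) y = 0" for y
      proof -
        have "b p (hat u) (hat (drop_None y) + y $ None *\<^sub>R e0) = 0"
          using that[of "drop_None y"] by (simp add: b_simps g_def b_e0[OF p])
        then show ?thesis using hat_drop_None[of y] by simp
      qed
      then have "hat u = 0" by (rule b_nondeg[OF p])
      then show ?thesis by (metis drop_None_hat hat_simps(3))
    qed
    have "DIM(real^'m) = CARD('m)" by simp
    then show "2 \<le> DIM(real^'m)" using dim by linarith
    show "isCont (\<lambda>t. q (v + t *\<^sub>R v') (w + t *\<^sub>R w')) 0" for v w v' w'
      unfolding q_def
      by (simp only: M_add[OF p] M_scale[OF p] hat_simps vmat_simps b_simps) (intro continuous_intros)
    show "q v w = 0" if "g v v * g w w - (g v w)\<^sup>2 \<noteq> 0" for v w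
    proof -
      have "(hat w v* R v w p v* G p) \<bullet> hat v = 0" using that sectional[OF p, of v w] by (simp add: g_def b_def)
      then have "b p (hat w v* M w p v* M v p) (hat v) = b p (hat w v* M v p v* M w p) (hat v)"
        unfolding gauss[OF p] by (simp add: b_def vmat_simps inner_simps vector_matrix_mul_assoc)
      then show ?thesis by (simp add: q_def bM[OF p] M_comm[OF p, of v w])
    qed
  qed
  then show ?thesis by (simp add: q_def)
qed

text \<open>For a commutative product, associativity says that multiplications commute. On
  tangential arguments this is \<open>sectional_polarization\<close>; an argument \<open>e0\<close>
  is covered by self-adjointness and commutativity, as \<open>e0 v* M u p\<close> is
  \<open>hat u\<close>.\<close>

lemma M_commute:
  assumes p: "p \<in> U"
  shows "M u p ** M v p = M v p ** M u p"
proof -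
  define F where "F a c d d' = b p (hat a v* M c p) (hat d v* M d' p)" for a c d d'
  have F: "F a c d d' = F a d c d'" for a c d d'
  proof (rule sectional_polarization[of F])
    show "F (a + a') c d d' = F a c d d' + F a' c d d'" for a a' c d d'
      by (simp add: F_def hat_simps vmat_simps b_simps)
    show "F a c d d' = F c a d d'" for a c d d' by (simp add: F_def M_comm[OF p, of a c])
    show "F a c d d' = F d d' a c" for a c d d' unfolding F_def by (rule b_sym[OF p])
    show "F w v w v = F w w v v" for v w unfolding F_def by (rule sectional_b[OF p])
  qed
  have F2: "F a c d d' = F a c d' d" for a c d d' by (simp add: F_def M_comm[OF p, of d d'])
  have key: "b p (x v* M u p) (y v* M v p) = b p (x v* M v p) (y v* M u p)" for x y
  proof -
    have 1: "b p (hat a v* M u p) (hat c v* M v p) = b p (hat a v* M v p) (hat c v* M u p)" for a c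
      using F[of a u c v] F2[of a c u v] F[of a c v u] by (simp add: F_def)
    have 2: "b p (e0 v* M u p) (z v* M v p) = b p (e0 v* M v p) (z v* M u p)" for z
      using bM[OF p, of "hat u" v z] bM[OF p, of "hat v" u z] M_comm[OF p, of u v] by (simp add: e0_M[OF p])
    have 3: "b p (z v* M u p) (e0 v* M v p) = b p (z v* M v p) (e0 v* M u p)" for z
      using 2[of z] b_sym[OF p] by simp
    have "b p ((hat a + s *\<^sub>R e0) v* M u p) ((hat c + t *\<^sub>R e0) v* M v p)
        = b p ((hat a + s *\<^sub>R e0) v* M v p) ((hat c + t *\<^sub>R e0) v* M u p)" for a c s t
      unfolding vmat_simps b_simps 1 2 3 by simp
    from this[of "drop_None x" "x $ None" "drop_None y" "y $ None"]
    show ?thesis by (simp flip: hat_drop_None)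
  qed
  show ?thesis
  proof (rule matrix_eq_left)
    fix x
    have "x v* (M u p ** M v p) - x v* (M v p ** M u p) = 0"
    proof (rule b_nondeg[OF p])
      fix y
      show "b p (x v* (M u p ** M v p) - x v* (M v p ** M u p)) y = 0"
        using key[of x y] by (simp add: b_simps bM[OF p] flip: vector_matrix_mul_assoc)
    qed
    then show "x v* (M u p ** M v p) = x v* (M v p ** M u p)" by simp
  qed
qed

text \<open>Multiplication by an arbitrary element: \<open>e0\<close> is adjoined as unit, with the
  \<open>None\<close> coordinate as its coefficient.\<close>

definition L where "L x p = x $ None *\<^sub>R mat 1 + M (drop_None x) p"

lemma L_hat: "p \<in> U \<Longrightarrow> L (hat u) p = M u p"
  by (simp add: L_def)

lemma drop_None_simps: "drop_None (x + y) = drop_None x + drop_None y" "drop_None (c *\<^sub>R x) = c *\<^sub>R drop_None x"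
  by (simp_all add: vec_eq_iff)

lemma L_add: "p \<in> U \<Longrightarrow> L (x + y) p = L x p + L y p"
  and L_scale: "p \<in> U \<Longrightarrow> L (c *\<^sub>R x) p = c *\<^sub>R L x p"
  by (simp_all add: L_def drop_None_simps M_add M_scale algebra_simps)

lemma e0_L: "p \<in> U \<Longrightarrow> e0 v* L x p = x"
  using hat_drop_None[of x] by (simp add: L_def vmat_simps e0_M add.commute)

lemma L_comm:
  assumes p: "p \<in> U"
  shows "x v* L y p = y v* L x p"
proof -
  have "(hat a + s *\<^sub>R e0) v* L (hat c + t *\<^sub>R e0) p = (hat c + t *\<^sub>R e0) v* L (hat a + s *\<^sub>R e0) p" for a c s t
  proof -
    have [simp]: "drop_None (hat c + t *\<^sub>R e0) = c" "(hat c + t *\<^sub>R e0) $ None = t" for c t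
      by (simp_all add: vec_eq_iff axis_def)
    show ?thesis
      by (simp add: L_def vmat_simps e0_M[OF p] M_comm[OF p, of a c] algebra_simps)
  qed
  from this[of "drop_None x" "x $ None" "drop_None y" "y $ None"]
  show ?thesis by (simp flip: hat_drop_None)
qed

lemma L_commute: "p \<in> U \<Longrightarrow> L x p ** L y p = L y p ** L x p"
  by (simp add: L_def mat_simps M_commute[of p "drop_None x" "drop_None y"] algebra_simps)

text \<open>Associativity: \<open>L\<close> is a homomorphism to matrices. It follows by moving the
  test vector \<open>z\<close> to the other side with \<open>L_comm\<close> and exchanging the
  multiplications.\<close>

lemma L_mult:
  assumes p: "p \<in> U"
  shows "L x p ** L y p = L (x v* L y p) p"
proof (rule matrix_eq_left)
  fix z
  have "z v* (L x p ** L y p) = x v* (L z p ** L y p)"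
    by (simp add: L_comm[OF p, of z x] flip: vector_matrix_mul_assoc)
  also have "\<dots> = (x v* L y p) v* L z p"
    by (simp add: L_commute[OF p, of z y] vector_matrix_mul_assoc)
  also have "\<dots> = z v* L (x v* L y p) p" by (rule L_comm[OF p])
  finally show "z v* (L x p ** L y p) = z v* L (x v* L y p) p" .
qed

lemma bL: "p \<in> U \<Longrightarrow> b p (x v* L w p) y = b p x (y v* L w p)"
  by (simp add: L_def vmat_simps b_simps bM)

lemma mult_None: "p \<in> U \<Longrightarrow> (x v* L y p) $ None = b p x y"
  using b_e0[of p "x v* L y p"] by (simp add: bL e0_L)

section \<open>The trace form and the covariant derivative of the product\<close>

lemma trace_M: "p \<in> U \<Longrightarrow> trace (M w p) = 0"
  by (simp add: M_def trace_free)

text \<open>Only the unit part has a trace. With \<open>L_mult\<close> and \<open>mult_None\<close>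
  the trace form of the algebra is the dimension times \<open>b\<close>.\<close>

lemma trace_L: "p \<in> U \<Longrightarrow> trace (L x p) = CARD('m option) * x $ None"
  by (simp add: L_def trace_simps trace_M) (simp add: trace_def mat_def)

text \<open>The Christoffel map: the covariant derivative along \<open>w\<close> of the constant
  field \<open>u\<close>.\<close>

definition Chr where "Chr w u p = drop_None (hat u v* Gam w p)"

lemma hat_Chr: "p \<in> U \<Longrightarrow> hat (Chr w u p) = hat u v* Gam w p"
  by (simp add: vec_eq_iff all_option Chr_def Gam_col)

text \<open>The covariant derivative of the product.\<close>
definition Pi where "Pi w u p = DM w u p - M (Chr w u p) p"

text \<open>The Codazzi equation gives symmetry of \<open>DM\<close>, and the correction term is
  symmetric since the connection has no torsion.\<close>

lemma Pi_sym: "p \<in> U \<Longrightarrow> Pi w u p = Pi u w p"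
  using codazzi[of p w u] Gam_comm[of p u w] by (simp add: Pi_def Chr_def)

lemma Pi_G_sym: "p \<in> U \<Longrightarrow> transpose (Pi w u p ** G p) = Pi w u p ** G p"
  by (simp add: Pi_def mat_simps transpose_simps DM_sym_G MG_sym)

text \<open>The trace of \<open>M u\<close> is constantly zero, and the commutator with the
  connection matrix contributes no trace.\<close>

lemma trace_Pi:
  assumes p: "p \<in> U" shows "trace (Pi w u p) = 0"
proof -
  have "trace (dird (M u) p w) = dird (\<lambda>q. trace (M u q)) p w"
    by (simp add: frechet_derivative_linear[OF bounded_linear_trace smooth_on_differentiable[OF smooth_M p]])
  also have "\<dots> = dird (\<lambda>q. 0) p w" by (rule Dcong[OF p trace_M])
  finally have "trace (dird (M u) p w) = 0" by simp
  then show ?thesis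
    using trace_mul_sym[of "M u p" "Gam w p"] by (simp add: Pi_def DM_def trace_simps trace_M[OF p])
qed

lemma e0_Pi:
  assumes p: "p \<in> U" shows "e0 v* Pi w u p = 0"
proof -
  have bl: "bounded_linear (\<lambda>X. e0 v* X)"
    by (rule bounded_bilinear.bounded_linear_right[OF bounded_bilinear_vector_matrix_mult])
  have "e0 v* dird (M u) p w = dird (\<lambda>q. e0 v* M u q) p w"
    by (simp add: frechet_derivative_linear[OF bl smooth_on_differentiable[OF smooth_M p]])
  also have "\<dots> = dird (\<lambda>q. hat u) p w" by (rule Dcong[OF p e0_M])
  finally have "e0 v* dird (M u) p w = 0" by simp
  then show ?thesis
    by (simp add: Pi_def DM_def vmat_simps e0_M[OF p] hat_Chr[OF p] Gam_None[OF p] flip: vector_matrix_mul_assoc)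
qed

lemma dird_M: "dird (M u) p w = Pi w u p + M (Chr w u p) p + Gam w p ** M u p - M u p ** Gam w p"
  by (simp add: Pi_def DM_def)

text \<open>The identity \<open>M u ** M v = L (K q)\<close>, with the product \<open>K q\<close>
  depending on the point, is differentiated covariantly. All terms that are themselves
  multiplications, in particular those from the derivative of \<open>K\<close>, are collected in
  \<open>L q\<close>; the element \<open>q\<close> is identified later by evaluation at the
  unit.\<close>

lemma Pi_Leibniz:
  assumes p: "p \<in> U"
  shows "\<exists>q. M u p ** Pi w v p + Pi w u p ** M v p = Pi w (drop_None (hat u v* M v p)) p + L q p"
proof -
  define K where "K q = hat u v* M v q" for q
  have sK: "smooth_on U K" unfolding K_def[abs_def]
    by (intro smooth_on_bilinear[OF U bounded_bilinear_vector_matrix_mult] smooth_on_const smooth_M)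
  have K: "M u q ** M v q = L (K q) q" if "q \<in> U" for q
    using L_mult[OF that, of "hat u" "hat v"] by (simp add: L_hat[OF that] K_def)
  let ?a = "drop_None (K p)"
  have der: "dird (\<lambda>q. L (K q) q) p w = L (dird K p w) p + dird (M ?a) p w"
  proof -
    let ?m = "\<lambda>j. M (axis j 1)"
    have comp: "((\<lambda>q. K q $ i) has_derivative (\<lambda>v. dird K p v $ i)) (at p)" for i
      by (rule bounded_linear.has_derivative[OF bounded_linear_vec_nth smooth_on_has_derivative[OF sK p]])
    have "((\<lambda>q. K q $ None *\<^sub>R mat 1 + (\<Sum>j\<in>UNIV. K q $ Some j *\<^sub>R ?m j q)) has_derivative
        (\<lambda>v. dird K p v $ None *\<^sub>R mat 1 + (\<Sum>j\<in>UNIV. K p $ Some j *\<^sub>R dird (?m j) p v + dird K p v $ Some j *\<^sub>R ?m j p))) (at p)"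
      by (intro has_derivative_add has_derivative_sum comp bounded_linear.has_derivative[OF bounded_linear_scaleR_left]
          bounded_bilinear.FDERIV[OF bounded_bilinear_scaleR] smooth_on_has_derivative[OF smooth_M p])
    from frechet_derivative_eqI[OF this]
    have "dird (\<lambda>q. L (K q) q) p w = dird K p w $ None *\<^sub>R mat 1 +
        (\<Sum>j\<in>UNIV. K p $ Some j *\<^sub>R dird (?m j) p w + dird K p w $ Some j *\<^sub>R ?m j p)"
      using Dcong[OF p, of "\<lambda>q. L (K q) q" "\<lambda>q. K q $ None *\<^sub>R mat 1 + (\<Sum>j\<in>UNIV. K q $ Some j *\<^sub>R ?m j q)" w]
        M_axis by (simp add: L_def)
    moreover have "dird (M ?a) p w = (\<Sum>j\<in>UNIV. K p $ Some j *\<^sub>R dird (?m j) p w)"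
    proof -
      have "((\<lambda>q. \<Sum>j\<in>UNIV. ?a $ j *\<^sub>R ?m j q) has_derivative (\<lambda>v. \<Sum>j\<in>UNIV. ?a $ j *\<^sub>R dird (?m j) p v)) (at p)"
        by (intro has_derivative_sum bounded_linear.has_derivative[OF bounded_linear_scaleR_right]
            smooth_on_has_derivative[OF smooth_M p])
      from frechet_derivative_eqI[OF this]
      have "dird (\<lambda>q. \<Sum>j\<in>UNIV. ?a $ j *\<^sub>R ?m j q) p w = (\<Sum>j\<in>UNIV. ?a $ j *\<^sub>R dird (?m j) p w)" .
      moreover have "dird (M ?a) p w = dird (\<lambda>q. \<Sum>j\<in>UNIV. ?a $ j *\<^sub>R ?m j q) p w"
        by (rule Dcong[OF p M_axis])
      ultimately show ?thesis by simp
    qed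
    ultimately show ?thesis
      using M_axis[OF p, of "drop_None (dird K p w)"] by (simp add: L_def sum.distrib)
  qed
  have "dird (\<lambda>q. M u q ** M v q) p w = dird (\<lambda>q. L (K q) q) p w" by (rule Dcong[OF p K])
  then have eq: "M u p ** dird (M v) p w + dird (M u) p w ** M v p = L (dird K p w) p + dird (M ?a) p w"
    unfolding der DAB[OF smooth_M smooth_M p] .
  have MM: "M u p ** M v p = K p $ None *\<^sub>R mat 1 + M ?a p" using K[OF p] by (simp add: L_def)
  \<comment> \<open>The part of the product along the unit acts as a scalar and commutes with the
    connection matrix.\<close>
  have comm: "Gam w p ** M u p ** M v p - M u p ** M v p ** Gam w p = Gam w p ** M ?a p - M ?a p ** Gam w p"
  proof -
    have "Gam w p ** M u p ** M v p - M u p ** M v p ** Gam w p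
       = Gam w p ** (M u p ** M v p) - (M u p ** M v p) ** Gam w p" by (simp add: matrix_mul_assoc)
    also have "\<dots> = Gam w p ** M ?a p - M ?a p ** Gam w p" unfolding MM by (simp add: mat_simps)
    finally show ?thesis .
  qed
  let ?q = "dird K p w + hat (Chr w ?a p) - hat u v* M (Chr w v p) p - hat (Chr w u p) v* M v p"
  have Lq: "L ?q p = L (dird K p w) p + M (Chr w ?a p) p - M u p ** M (Chr w v p) p - M (Chr w u p) p ** M v p"
  proof -
    have d: "L (x - y) p = L x p - L y p" for x y
      using L_add[OF p, of "x - y" y] by simp
    show ?thesis
      using L_mult[OF p, of "hat u" "hat (Chr w v p)"] L_mult[OF p, of "hat (Chr w u p)" "hat v"]
      by (simp add: d L_add[OF p] L_hat[OF p])
  qed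
  have "(M u p ** Pi w v p + Pi w u p ** M v p) + (Gam w p ** M u p ** M v p - M u p ** M v p ** Gam w p)
      = (Pi w ?a p + L ?q p) + (Gam w p ** M ?a p - M ?a p ** Gam w p)"
    using eq unfolding dird_M Lq by (simp add: mat_simps matrix_mul_assoc algebra_simps)
  then have "M u p ** Pi w v p + Pi w u p ** M v p = Pi w ?a p + L ?q p"
    unfolding comm by (rule add_right_imp_eq)
  then show ?thesis by (auto simp: K_def)
qed

text \<open>The trilinear trace \<open>t\<close> is symmetric in the first two slots and skew in the
  last two, hence zero. So \<open>Pi\<close> is orthogonal to all multiplications under the trace
  pairing, and the Leibniz rule paired with \<open>L y\<close> leaves \<open>b\<close> of
  \<open>hat u v* Pi w v p\<close> and \<open>y\<close>, which must then vanish for all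
  \<open>y\<close>.\<close>

lemma Pi_zero:
  assumes p: "p \<in> U"
  shows "Pi w u p = 0"
proof -
  define t where "t w u v = trace (Pi w u p ** M v p)" for w u v
  have None0: "(x v* Pi w u p) $ None = 0" for x w u
  proof -
    have "(x v* Pi w u p) $ None = (x v* (Pi w u p ** G p)) \<bullet> e0"
      using b_e0[OF p, of "x v* Pi w u p"] by (simp add: b_def vector_matrix_mul_assoc)
    also have "\<dots> = (e0 v* (Pi w u p ** G p)) \<bullet> x" by (rule symmetric_matrix_dot[OF Pi_G_sym[OF p]])
    also have "\<dots> = 0" by (simp add: e0_Pi[OF p] vmat_simps flip: vector_matrix_mul_assoc)
    finally show ?thesis .
  qed
  \<comment> \<open>Applied to \<open>e0\<close>, which \<open>Pi\<close> annihilates and which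
    \<open>L q p\<close> maps to \<open>q\<close>, the Leibniz rule determines
    \<open>q\<close>.\<close>
  have Leib: "M u p ** Pi w v p + Pi w u p ** M v p
     = Pi w (drop_None (hat u v* M v p)) p + L (hat u v* Pi w v p) p" for u v w
  proof -
    obtain q where q: "M u p ** Pi w v p + Pi w u p ** M v p = Pi w (drop_None (hat u v* M v p)) p + L q p"
      using Pi_Leibniz[OF p] by blast
    have "e0 v* (M u p ** Pi w v p + Pi w u p ** M v p) = hat u v* Pi w v p"
      by (simp add: vmat_simps e0_M[OF p] e0_Pi[OF p] flip: vector_matrix_mul_assoc)
    moreover have "e0 v* (Pi w (drop_None (hat u v* M v p)) p + L q p) = q"
      by (simp add: vmat_simps e0_Pi[OF p] e0_L[OF p])
    ultimately show ?thesis using q by simp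
  qed
  \<comment> \<open>The right side of the Leibniz rule has trace zero: \<open>Pi\<close> is
    trace-free and \<open>None0\<close> removes the unit component of \<open>q\<close>.\<close>
  have t1: "t w u v = - t w v u" for w u v
    using arg_cong[OF Leib[of u w v], of trace] trace_mul_sym[of "M u p" "Pi w v p"]
    by (simp add: trace_simps trace_Pi[OF p] trace_L[OF p] None0 t_def)
  have t2: "t w u v = t u w v" for w u v by (simp add: t_def Pi_sym[OF p, of w u])
  \<comment> \<open>The two exchange rules, applied alternately three times each, return to the same
    arguments with the opposite sign.\<close>
  have t0: "t w u v = 0" for w u v
    using t1[of w u v] t2[of w v u] t1[of v w u] t2[of v u w] t1[of u v w] t2[of u w v] by linarith
  have tL: "trace (Pi w u p ** L x p) = 0" for w u x
    using t0[of w u "drop_None x"] by (simp add: L_def mat_simps trace_simps trace_Pi[OF p] t_def)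
  have "hat u v* Pi w v p = 0" for u v w
  proof (rule b_nondeg[OF p])
    fix y
    let ?q = "hat u v* Pi w v p"
    have 1: "trace (M u p ** Pi w v p ** L y p) = 0"
    proof -
      have "trace (M u p ** Pi w v p ** L y p) = trace (Pi w v p ** (L y p ** L (hat u) p))"
        using trace_mul_sym[of "M u p" "Pi w v p ** L y p"] by (simp add: matrix_mul_assoc L_hat[OF p])
      then show ?thesis by (simp add: L_mult[OF p] tL)
    qed
    have 2: "trace (Pi w u p ** M v p ** L y p) = 0"
      using tL[of w u "hat v v* L y p"] L_mult[OF p, of "hat v" y] by (simp add: L_hat[OF p] flip: matrix_mul_assoc)
    have "trace ((M u p ** Pi w v p + Pi w u p ** M v p) ** L y p) = 0"
      using 1 2 by (simp add: mat_simps trace_simps)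
    then have "trace (L ?q p ** L y p) = 0" unfolding Leib by (simp add: mat_simps trace_simps tL)
    then show "b p ?q y = 0" by (simp add: L_mult[OF p] trace_L[OF p] mult_None[OF p])
  qed
  note hat0 = this
  show ?thesis
  proof (rule matrix_eq_left)
    fix x
    have "x v* Pi w u p = (hat (drop_None x) + x $ None *\<^sub>R e0) v* Pi w u p" by (simp flip: hat_drop_None)
    also have "\<dots> = 0" by (simp only: vmat_simps hat0 e0_Pi[OF p]) simp
    finally show "x v* Pi w u p = x v* 0" by (simp add: vmat_simps)
  qed
qed

text \<open>The multiplications in the ambient space.\<close>
definition N where "N u p = matrix_inv (T p) ** M u p ** T p"

lemma smooth_N: "smooth_on U (N u)"
  unfolding N_def[abs_def]
  by (intro smooth_on_bilinear[OF U bounded_bilinear_matrix_matrix_mult] smooth_on_matrix_inv U smooth smooth_M invT)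

lemma T_N: "p \<in> U \<Longrightarrow> T p ** N u p = M u p ** T p"
  by (simp add: N_def matrix_mul_assoc matrix_inv_left_right[OF invT])

text \<open>The ambient connection matrix is \<open>Gam + M\<close>, and its \<open>M\<close> part
  commutes with \<open>M u\<close>; since \<open>Pi\<close> vanishes, only the multiplication by the
  Christoffel term remains. The derivatives of the matrices \<open>N u\<close> thus stay in their
  span and form a closed linear system.\<close>

lemma dird_N:
  assumes p: "p \<in> U"
  shows "dird (N u) p w = N (Chr w u p) p"
proof -
  have "dird (\<lambda>q. T q ** N u q) p w = dird (\<lambda>q. M u q ** T q) p w" by (rule Dcong[OF p T_N])
  then have "T p ** dird (N u) p w + A w p ** (T p ** N u p) = M u p ** A w p ** T p + dird (M u) p w ** T p"
    by (simp add: DAB[OF smooth(1) smooth_N p] DAB[OF smooth_M smooth(1) p] DT[OF p] matrix_mul_assoc)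
  then have eq: "T p ** dird (N u) p w + A w p ** M u p ** T p = M u p ** A w p ** T p + dird (M u) p w ** T p"
    by (simp add: T_N[OF p] matrix_mul_assoc)
  have "A w p = Gam w p + M w p" by (simp add: M_def)
  then have "T p ** dird (N u) p w = M (Chr w u p) p ** T p"
    using eq M_commute[OF p, of u w] unfolding dird_M Pi_zero[OF p]
    by (simp add: mat_simps algebra_simps)
  then have "T p ** dird (N u) p w = T p ** N (Chr w u p) p" by (simp add: T_N[OF p])
  then have "matrix_inv (T p) ** T p ** dird (N u) p w = matrix_inv (T p) ** T p ** N (Chr w u p) p"
    by (simp flip: matrix_mul_assoc)
  then show ?thesis by (simp add: matrix_inv_left_right[OF invT[OF p]])
qed

lemma N_linear: "p \<in> U \<Longrightarrow> linear (\<lambda>u. N u p)"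
  by (rule linearI) (simp_all add: N_def M_add M_scale mat_simps)

lemma N_inj:
  assumes p: "p \<in> U" shows "inj (\<lambda>u. N u p)"
proof -
  have "u = 0" if "N u p = 0" for u
  proof -
    have "M u p ** T p = 0" using T_N[OF p, of u] that by (simp add: mat_simps)
    then have "M u p ** T p ** matrix_inv (T p) = 0" by (simp add: mat_simps)
    then have "M u p = 0" by (simp add: matrix_inv_left_right[OF invT[OF p]] flip: matrix_mul_assoc)
    then have "hat u = 0" using e0_M[OF p, of u] by (simp add: vmat_simps)
    then show ?thesis by (metis drop_None_hat hat_simps(3))
  qed
  then show ?thesis using linear_injective_0[OF N_linear[OF p]] by blast
qed

lemma smooth_Chr: "smooth_on U (Chr w u)"
  unfolding Chr_def[abs_def]
  by (intro smooth_on_linear[OF U bounded_linear_drop_None]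
      smooth_on_bilinear[OF U bounded_bilinear_vector_matrix_mult] smooth_on_const smooth)

text \<open>On the segment from \<open>p0\<close> to \<open>p\<close>, the inner products of
  \<open>z\<close> with the matrices \<open>N (axis j 1)\<close> solve a homogeneous linear system
  with continuous, hence bounded, coefficients, and they vanish at the start.\<close>

lemma N_annihilated:
  assumes r: "ball p0 r \<subseteq> U" and p: "p \<in> ball p0 r" and z: "\<And>u. N u p0 \<bullet> z = 0"
  shows "N u p \<bullet> z = 0"
proof -
  define d where "d = p - p0"
  define c where "c t = p0 + t *\<^sub>R d" for t :: real
  have cU: "c t \<in> U" if "0 \<le> t" "t \<le> 1" for t
  proof -
    have "c t = (1 - t) *\<^sub>R p0 + t *\<^sub>R p" by (simp add: c_def d_def algebra_simps)
    moreover have "p0 \<in> ball p0 r" using p by (simp add: le_less_trans[OF zero_le_dist])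
    ultimately have "c t \<in> ball p0 r" using convexD_alt[OF convex_ball _ p that] by simp
    then show ?thesis using r by auto
  qed
  have dc: "(c has_derivative (\<lambda>h. h *\<^sub>R d)) (at t)" for t
    unfolding c_def by (auto intro!: derivative_eq_intros)
  define y where "y j t = N (axis j 1) (c t) \<bullet> z" for j t
  have dy: "(y j has_real_derivative (\<Sum>k\<in>UNIV. Chr d (axis j 1) (c t) $ k * y k t)) (at t)"
    if t: "0 \<le> t" "t \<le> 1" for j t
  proof -
    have "((\<lambda>s. N (axis j 1) (c s)) has_derivative (\<lambda>h. dird (N (axis j 1)) (c t) (h *\<^sub>R d))) (at t)"
      by (rule has_derivative_compose[OF dc smooth_on_has_derivative[OF smooth_N cU[OF t]]])
    then have "(y j has_derivative (\<lambda>h. dird (N (axis j 1)) (c t) (h *\<^sub>R d) \<bullet> z)) (at t)"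
      unfolding y_def[abs_def] by (rule bounded_linear.has_derivative[OF bounded_linear_inner_left])
    moreover have "dird (N (axis j 1)) (c t) (h *\<^sub>R d) \<bullet> z = (\<Sum>k\<in>UNIV. Chr d (axis j 1) (c t) $ k * y k t) * h" for h
    proof -
      have "dird (N (axis j 1)) (c t) (h *\<^sub>R d) = h *\<^sub>R dird (N (axis j 1)) (c t) d"
        by (rule linear_scale[OF linear_frechet_derivative[OF smooth_on_differentiable[OF smooth_N cU[OF t]]]])
      also have "dird (N (axis j 1)) (c t) d = (\<Sum>k\<in>UNIV. Chr d (axis j 1) (c t) $ k *\<^sub>R N (axis k 1) (c t))"
        unfolding dird_N[OF cU[OF t]] by (rule linear_as_sum_axis[OF N_linear[OF cU[OF t]]])
      finally show ?thesis by (simp add: y_def inner_sum_left mult.commute)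
    qed
    ultimately show ?thesis by (simp add: has_field_derivative_def)
  qed
  have cont: "continuous_on {0..1} (\<lambda>t. \<Sum>j\<in>UNIV. \<Sum>k\<in>UNIV. \<bar>Chr d (axis j 1) (c t) $ k\<bar>)"
  proof (intro continuous_on_sum continuous_on_rabs continuous_on_component)
    fix j
    have "continuous_on (c ` {0..1}) (Chr d (axis j 1))"
      by (rule continuous_on_subset[OF smooth_on_continuous[OF smooth_Chr]]) (use cU in auto)
    moreover have "continuous_on {0..1} c" unfolding c_def by (intro continuous_intros)
    ultimately show "continuous_on {0..1} (\<lambda>t. Chr d (axis j 1) (c t))" by (metis continuous_on_compose2 order_refl)
  qed
  have "{0..1::real} \<noteq> {}" by simp
  from continuous_attains_sup[OF compact_Icc this cont] obtain B where B: "\<And>t. t \<in> {0..1} \<Longrightarrow> (\<Sum>j\<in>UNIV. \<Sum>k\<in>UNIV. \<bar>Chr d (axis j 1) (c t) $ k\<bar>) \<le> B"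
    by blast
  have Bjk: "\<bar>Chr d (axis j 1) (c t) $ k\<bar> \<le> B" if "t \<in> {0..1}" for j k t
  proof -
    have "\<bar>Chr d (axis j 1) (c t) $ k\<bar> \<le> (\<Sum>k\<in>UNIV. \<bar>Chr d (axis j 1) (c t) $ k\<bar>)"
      by (rule member_le_sum) auto
    also have "\<dots> \<le> (\<Sum>j\<in>UNIV. \<Sum>k\<in>UNIV. \<bar>Chr d (axis j 1) (c t) $ k\<bar>)"
      by (rule member_le_sum[of j UNIV "\<lambda>j. \<Sum>k\<in>UNIV. \<bar>Chr d (axis j 1) (c t) $ k\<bar>"]) (auto intro: sum_nonneg)
    finally show ?thesis using B[OF that] by linarith
  qed
  have y0: "y j 0 = 0" for j by (simp add: y_def c_def z)
  have "y j 1 = 0" for j by (rule linear_ode_zero[OF dy Bjk y0])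
  then have "N (axis j 1) p \<bullet> z = 0" for j by (simp add: y_def c_def d_def)
  moreover have "p \<in> U" using r p by auto
  ultimately show ?thesis
    by (subst linear_as_sum_axis[OF N_linear]) (simp_all add: inner_sum_left)
qed

text \<open>The part of \<open>N u p\<close> orthogonal to the span at \<open>p0\<close> annihilates
  that span, hence by \<open>N_annihilated\<close> also \<open>N u p\<close>, so it is zero. The
  inclusion of spans is an equality because both have dimension \<open>CARD('m)\<close>.\<close>

lemma N_range_constant:
  assumes r: "ball p0 r \<subseteq> U" "p0 \<in> U" and p: "p \<in> ball p0 r"
  shows "\<exists>y. N x p0 = N y p"
proof -
  let ?S = "\<lambda>p. range (\<lambda>u. N u p)"
  have pU: "p \<in> U" using r p by auto
  have sub: "subspace (?S p)" if "p \<in> U" for p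
    by (rule linear_subspace_image[OF N_linear[OF that] subspace_UNIV])
  have "?S p \<subseteq> ?S p0"
  proof (rule image_subsetI)
    fix u
    obtain y z where yz: "y \<in> span (?S p0)" "\<And>w. w \<in> span (?S p0) \<Longrightarrow> orthogonal z w" "N u p = y + z"
      using orthogonal_subspace_decomp_exists[of "?S p0" "N u p"] by metis
    have "N v p0 \<bullet> z = 0" for v
      using yz(2)[OF span_base, of "N v p0"] by (simp add: orthogonal_def inner_commute)
    then have "N u p \<bullet> z = 0" by (rule N_annihilated[OF r(1) p])
    moreover have "y \<bullet> z = 0" using yz(2)[OF yz(1)] by (simp add: orthogonal_def inner_commute)
    ultimately have "z = 0" by (simp add: yz(3) inner_left_distrib)
    then show "N u p \<in> ?S p0" using yz sub[OF r(2)] by (metis add.right_neutral span_eq_iff)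
  qed
  moreover have "dim (?S p) = CARD('m)" if "p \<in> U" for p
    using dim_image_eq[OF N_linear[OF that], of UNIV] N_inj[OF that] by simp
  ultimately have "?S p = ?S p0"
    using subspace_dim_equal[OF sub[OF pU] sub[OF r(2)]] pU r(2) by simp
  then show ?thesis by blast
qed

end

section \<open>Flat proper affine hyperspheres\<close>

lemma linear_vecI:
  fixes F :: "'a::real_vector \<Rightarrow> 'b::real_vector ^ 'n"
  assumes "\<And>i. linear (\<lambda>w. F w $ i)"
  shows "linear F"
  by (rule linearI) (simp_all add: vec_eq_iff linear_add[OF assms] linear_scale[OF assms])

lemma dird_nth:
  assumes "F differentiable at p"
  shows "dird F p w $ i = dird (\<lambda>q. (F q :: 'b::euclidean_space ^ 'n) $ i) p w"
  using frechet_derivative_linear[OF bounded_linear_vec_nth assms, of i w] by simp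

lemma matrix_mult_row: "(A ** B) $ i = A $ i v* (B :: real^'n^'m)"
  by (simp add: vec_eq_iff matrix_matrix_mult_def vector_matrix_mult_def mult.commute)

lemma axis_vmult: "axis i 1 v* (A :: real^'n^'m) = A $ i"
  by (simp add: vec_eq_iff vector_matrix_mult_def axis_def if_distrib if_distribR cong: if_cong)

lemma hat_vmult: "hat u v* (A :: real^'n^('m::finite option)) = (\<Sum>j\<in>UNIV. u $ j *\<^sub>R A $ Some j)"
  by (simp add: vector_matrix_mult_rows UNIV_option_sum)

locale proper_flat_sphere = transversal_immersion U f C
  for U :: "(real ^ 'm) set" and f :: "real ^ 'm \<Rightarrow> real ^ ('m::finite option)"
    and C :: "real ^ 'm \<Rightarrow> real ^ ('m option)" +
  fixes \<kappa> :: real and LC :: "(real ^ 'm \<Rightarrow> real ^ 'm) \<Rightarrow> (real ^ 'm \<Rightarrow> real ^ 'm) \<Rightarrow> real ^ 'm \<Rightarrow> real ^ 'm"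
  assumes data: "sphere_data \<kappa>" and \<kappa>: "\<kappa> \<noteq> 0" and dim2: "CARD('m) \<ge> 2"
    and LC: "levi_civita U (affine_metric f C) LC"
    and flat: "\<And>X Y p. smooth_on U X \<Longrightarrow> smooth_on U Y \<Longrightarrow> p \<in> U \<Longrightarrow> plane_gram (affine_metric f C) X Y p \<noteq> 0
      \<Longrightarrow> sectional_curvature (affine_metric f C) LC X Y p = 0"
begin

section \<open>The Levi-Civita connection on constant fields\<close>

definition Ga where "Ga p u v = LC (\<lambda>_. u) (\<lambda>_. v) p"

lemma LC_smooth: "smooth_on U X \<Longrightarrow> smooth_on U Y \<Longrightarrow> smooth_on U (LC X Y)"
  using LC by (simp add: levi_civita_def)

lemma Ga_smooth: "smooth_on U (\<lambda>p. Ga p u v)"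
  unfolding Ga_def by (rule LC_smooth) (rule smooth_on_const)+

lemma LC_add_right: "smooth_on U X \<Longrightarrow> smooth_on U Y \<Longrightarrow> smooth_on U Y' \<Longrightarrow> p \<in> U \<Longrightarrow>
    LC X (\<lambda>q. Y q + Y' q) p = LC X Y p + LC X Y' p"
  and LC_scale_right: "smooth_on U \<phi> \<Longrightarrow> smooth_on U X \<Longrightarrow> smooth_on U Y \<Longrightarrow> p \<in> U \<Longrightarrow>
    LC X (\<lambda>q. \<phi> q *\<^sub>R Y q) p = dder X \<phi> p *\<^sub>R Y p + \<phi> p *\<^sub>R LC X Y p"
  and LC_add_left: "smooth_on U X \<Longrightarrow> smooth_on U X' \<Longrightarrow> smooth_on U Y \<Longrightarrow> p \<in> U \<Longrightarrow>
    LC (\<lambda>q. X q + X' q) Y p = LC X Y p + LC X' Y p"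
  and LC_scale_left: "smooth_on U \<phi> \<Longrightarrow> smooth_on U X \<Longrightarrow> smooth_on U Y \<Longrightarrow> p \<in> U \<Longrightarrow>
    LC (\<lambda>q. \<phi> q *\<^sub>R X q) Y p = \<phi> p *\<^sub>R LC X Y p"
  and LC_torsion: "smooth_on U X \<Longrightarrow> smooth_on U Y \<Longrightarrow> p \<in> U \<Longrightarrow> LC X Y p - LC Y X p = lie X Y p"
  and LC_metric: "smooth_on U X \<Longrightarrow> smooth_on U Y \<Longrightarrow> smooth_on U Z \<Longrightarrow> p \<in> U \<Longrightarrow>
    dder X (affine_metric f C Y Z) p = affine_metric f C (LC X Y) Z p + affine_metric f C Y (LC X Z) p"
  using LC unfolding levi_civita_def by simp_all

lemma bilinear_Ga: assumes p: "p \<in> U" shows "bilinear (Ga p)"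
proof -
  have c: "smooth_on U (\<lambda>_. u)" for u :: "real^'m" by (rule smooth_on_const)
  have r: "smooth_on U (\<lambda>_. a)" for a :: real by (rule smooth_on_const)
  have "Ga p (u + u') v = Ga p u v + Ga p u' v" "Ga p (a *\<^sub>R u) v = a *\<^sub>R Ga p u v"
    "Ga p u (v + v') = Ga p u v + Ga p u v'" "Ga p u (a *\<^sub>R v) = a *\<^sub>R Ga p u v" for u u' v v' a
    unfolding Ga_def using LC_add_left[OF c c c p] LC_scale_left[OF r c c p] LC_add_right[OF c c c p]
      LC_scale_right[OF r c c p] by (simp_all add: dder_def)
  then show ?thesis unfolding bilinear_def by (auto intro!: linearI)
qed

lemma Ga_sym: assumes p: "p \<in> U" shows "Ga p u v = Ga p v u"
  using LC_torsion[OF smooth_on_const smooth_on_const p, of u v] by (simp add: Ga_def lie_def dder_def)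

lemma d_metric:
  assumes p: "p \<in> U"
  shows "dird (\<lambda>q. metric q u v) p w = metric p (Ga p w u) v + metric p u (Ga p w v)"
proof -
  have c: "smooth_on U (\<lambda>_. u)" for u :: "real^'m" by (rule smooth_on_const)
  have "dird (\<lambda>q. metric q u v) p w = affine_metric f C (LC (\<lambda>_. w) (\<lambda>_. u)) (\<lambda>_. v) p
      + affine_metric f C (\<lambda>_. u) (LC (\<lambda>_. w) (\<lambda>_. v)) p"
    using LC_metric[OF c c c p, of w u v] by (simp add: dder_def)
  then show ?thesis
    using affine_metric_pointwise[OF p, of "\<lambda>_. v" "LC (\<lambda>_. w) (\<lambda>_. u)"]
      affine_metric_pointwise[OF p smooth_on_differentiable[OF LC_smooth[OF c c] p], of "\<lambda>_. u" w v]
    by (simp add: Ga_def)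
qed

text \<open>Expansion of \<open>W\<close> in constant fields. Only additivity in two summands is
  given, hence the induction over finite sets of coordinates.\<close>

lemma LC_field:
  assumes p: "p \<in> U" and W: "smooth_on U W"
  shows "LC (\<lambda>_. v) W p = dird W p v + Ga p v (W p)"
proof -
  have c: "smooth_on U (\<lambda>_. u)" for u :: "real^'m" by (rule smooth_on_const)
  have Wj: "smooth_on U (\<lambda>q. W q $ j)" for j by (rule smooth_on_vec_nth[OF openU W])
  have sum: "LC (\<lambda>_. v) (\<lambda>q. \<Sum>j\<in>J. W q $ j *\<^sub>R axis j 1) p
     = (\<Sum>j\<in>J. dird W p v $ j *\<^sub>R axis j 1 + W p $ j *\<^sub>R Ga p v (axis j 1))" if "finite J" for J
    using that
  proof induction
    case empty
    \<comment> \<open>The zero field is written as a multiple by the function 0, so that the Leibniz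
      rule applies to it.\<close>
    have "LC (\<lambda>_. v) (\<lambda>q. (0::real) *\<^sub>R (\<lambda>_. v) q) p = 0"
      by (subst LC_scale_right[OF smooth_on_const c c p]) (simp add: dder_def)
    then show ?case by simp
  next
    case (insert j J)
    have s1: "smooth_on U (\<lambda>q. W q $ j *\<^sub>R (axis j 1 :: real^'m))" for j by (intro smooth_on_scaleR openU Wj c)
    have "LC (\<lambda>_. v) (\<lambda>q. W q $ j *\<^sub>R axis j 1 + (\<Sum>j\<in>J. W q $ j *\<^sub>R axis j 1)) p
      = LC (\<lambda>_. v) (\<lambda>q. W q $ j *\<^sub>R axis j 1) p + LC (\<lambda>_. v) (\<lambda>q. \<Sum>j\<in>J. W q $ j *\<^sub>R axis j 1) p"
      by (rule LC_add_right[OF c s1 smooth_on_sum[OF openU s1] p])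
    moreover have "LC (\<lambda>_. v) (\<lambda>q. W q $ j *\<^sub>R axis j 1) p = dird W p v $ j *\<^sub>R axis j 1 + W p $ j *\<^sub>R Ga p v (axis j 1)"
      using LC_scale_right[OF Wj[of j] c[of v] c[of "axis j 1"] p] dird_nth[OF smooth_on_differentiable[OF W p]]
      by (simp add: dder_def Ga_def)
    ultimately show ?case using insert by simp
  qed
  have ax: "(\<Sum>j\<in>UNIV. x $ j *\<^sub>R axis j 1) = x" for x :: "real^'m"
    by (simp add: vec_eq_iff axis_def if_distrib cong: if_cong)
  have "linear (Ga p v)" using bilinear_Ga[OF p] by (simp add: bilinear_def)
  from linear_as_sum_axis[OF this, of "W p"] sum[of UNIV] show ?thesis
    by (simp add: sum.distrib ax)
qed

text \<open>Constant fields have zero bracket, so the last term of the curvature disappears and the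
  rest is expressed by the Christoffel map \<open>Ga\<close>.\<close>

lemma sectional_vanishes:
  assumes p: "p \<in> U" and ne: "metric p v v * metric p w w - (metric p v w)\<^sup>2 \<noteq> 0"
  shows "metric p (dird (\<lambda>q. Ga q w w) p v + Ga p v (Ga p w w) - (dird (\<lambda>q. Ga q v w) p w + Ga p w (Ga p v w))) v = 0"
proof -
  have c: "smooth_on U (\<lambda>_. u)" for u :: "real^'m" by (rule smooth_on_const)
  have lie0: "lie (\<lambda>_. v) (\<lambda>_. w) = (\<lambda>_. 0)" by (simp add: lie_def dder_def fun_eq_iff)
  have LC0: "LC (\<lambda>_. 0) (\<lambda>_. w) p = 0"
    using LC_scale_left[OF smooth_on_const c c p, of 0 0 w] by simp
  have "curvature LC (\<lambda>_. v) (\<lambda>_. w) (\<lambda>_. w) p =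
      dird (\<lambda>q. Ga q w w) p v + Ga p v (Ga p w w) - (dird (\<lambda>q. Ga q v w) p w + Ga p w (Ga p v w))"
    unfolding curvature_def lie0 LC0 LC_field[OF p LC_smooth[OF c c]] by (simp add: Ga_def[abs_def])
  moreover have "affine_metric f C (curvature LC (\<lambda>_. v) (\<lambda>_. w) (\<lambda>_. w)) (\<lambda>_. v) p = 0"
    using flat[OF c c p, of v w] ne by (simp add: plane_gram_def sectional_curvature_def)
  ultimately show ?thesis
    using affine_metric_pointwise[OF p, of "\<lambda>_. v" "curvature LC (\<lambda>_. v) (\<lambda>_. w) (\<lambda>_. w)"] by simp
qed

text \<open>The position vector, up to a translation.\<close>
definition E where "E p = (- 1 / \<kappa>) *\<^sub>R C p"

lemma C_E: "C p = - \<kappa> *\<^sub>R E p"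
  using \<kappa> by (simp add: E_def)

lemma smooth_E: "smooth_on U E"
  unfolding E_def[abs_def] by (intro smooth_on_scaleR openU smooth_on_const smooth_C)

lemma dE: "p \<in> U \<Longrightarrow> dird E p w = dird f p w"
  using frechet_derivative_linear[OF bounded_linear_scaleR_right smooth_on_differentiable[OF smooth_C], of p "- 1 / \<kappa>" w]
    data \<kappa> by (simp add: E_def[abs_def] sphere_data_def)

sublocale E: transversal_immersion U f E
proof
  show "immersion_on U f" by (rule imm)
  show "transversal_on U f E"
    unfolding transversal_on_def
  proof (intro conjI ballI smooth_E notI)
    fix p assume p: "p \<in> U" and "E p \<in> tangent_space f p"
    then obtain v where "E p = dird f p v" by (auto simp: tangent_space_def)
    then have "C p = dird f p (- \<kappa> *\<^sub>R v)"
      using C_E[of p] linear_scale[OF linear_df[OF p], of "- \<kappa>" v] by simp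
    then show False using transv p by (auto simp: transversal_on_def tangent_space_def)
  qed
qed

section \<open>The frame completed by the position vector\<close>

abbreviation T where "T \<equiv> frame f E"

text \<open>The rows are coordinates in \<open>T\<close>. The row \<open>None\<close> is
  \<open>dE = df\<close>; the others come from the Gauss formula, where the coefficient is
  multiplied by \<open>- \<kappa>\<close> since \<open>C = - \<kappa> E\<close>.\<close>

definition A where "A w p = (\<chi> i. case i of None \<Rightarrow> hat w
   | Some j \<Rightarrow> hat (conn p w (axis j 1)) + (- \<kappa> * metric p w (axis j 1)) *\<^sub>R axis None 1)"

definition Gam where "Gam w p = (\<chi> i. case i of None \<Rightarrow> 0 | Some j \<Rightarrow> hat (Ga p w (axis j 1)))"

text \<open>The factor \<open>- \<kappa>\<close> makes the form on \<open>hat u\<close>,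
  \<open>hat w\<close> equal to the coefficient of \<open>E\<close> in the product of these
  elements, as an invariant form with unit of length 1 requires.\<close>

definition G where "G p = block_mat 1 (- \<kappa> *\<^sub>R metric_matrix f C p)"

lemma hat_A: "p \<in> U \<Longrightarrow> hat u v* A w p = hat (conn p w u) + (- \<kappa> * metric p w u) *\<^sub>R axis None 1"
proof -
  assume p: "p \<in> U"
  have "linear (\<lambda>u. hat (conn p w u) + (- \<kappa> * metric p w u) *\<^sub>R axis None 1)"
    using bilinear_radd[OF bilinear_conn[OF p]] bilinear_rmul[OF bilinear_conn[OF p]]
      bilinear_radd[OF bilinear_metric[OF p]] bilinear_rmul[OF bilinear_metric[OF p]]
    by (intro linearI) (simp_all add: vec_eq_iff all_option axis_def algebra_simps)
  from linear_as_sum_axis[OF this, of u] show ?thesis by (simp add: hat_vmult A_def)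
qed

lemma hat_Gam: "p \<in> U \<Longrightarrow> hat u v* Gam w p = hat (Ga p w u)"
proof -
  assume p: "p \<in> U"
  have "linear (\<lambda>u. hat (Ga p w u))"
    using bilinear_radd[OF bilinear_Ga[OF p]] bilinear_rmul[OF bilinear_Ga[OF p]]
    by (intro linearI) (simp_all add: vec_eq_iff all_option)
  from linear_as_sum_axis[OF this, of u] show ?thesis by (simp add: hat_vmult Gam_def)
qed

lemma e0_A: "axis None 1 v* A w p = hat w"
  by (simp add: axis_vmult A_def)

lemma e0_Gam: "axis None 1 v* Gam w p = 0"
  by (simp add: axis_vmult Gam_def)

lemma smooth_A: "smooth_on U (A w)"
proof (rule smooth_on_vecI[OF openU])
  fix i
  show "smooth_on U (\<lambda>p. A w p $ i)"
  proof (cases i)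
    case (Some j)
    have "smooth_on U (\<lambda>p. hat (conn p w (axis j 1)) + (- \<kappa> * metric p w (axis j 1)) *\<^sub>R axis None 1)"
      by (intro smooth_on_add smooth_on_linear[OF openU bounded_linear_hat] smooth_on_scaleR smooth_on_mult
          openU smooth_on_const smooth_induced_connection smooth_affine_metric)
    then show ?thesis by (simp add: A_def Some)
  qed (simp add: A_def smooth_on_const)
qed

lemma smooth_Gam: "smooth_on U (Gam w)"
proof (rule smooth_on_vecI[OF openU])
  fix i
  show "smooth_on U (\<lambda>p. Gam w p $ i)"
    by (cases i) (simp_all add: Gam_def smooth_on_const smooth_on_linear[OF openU bounded_linear_hat Ga_smooth])
qed

lemma DT: "p \<in> U \<Longrightarrow> dird T p w = A w p ** T p"
proof -
  assume p: "p \<in> U"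
  have "dird T p w $ i = A w p $ i v* T p" for i
  proof (cases i)
    case None
    then show ?thesis using dird_nth[OF smooth_on_differentiable[OF E.smooth_frame p], of w None]
      by (simp add: frame_def A_def E.vmult_frame[OF p, unfolded frame_def] dE[OF p])
  next
    case (Some j)
    have "dird T p w $ i = hess p w (axis j 1)"
      using dird_nth[OF smooth_on_differentiable[OF E.smooth_frame p], of w i] Some
      by (simp add: frame_def hess_def)
    also have "\<dots> = dird f p (conn p w (axis j 1)) + metric p w (axis j 1) *\<^sub>R C p" by (rule hess_decomp[OF p])
    also have "\<dots> = A w p $ i v* T p"
      using C_E[of p] unfolding E.vmult_frame[OF p] Some by (simp add: A_def drop_None_def) 
        (simp add: axis_def vec_lambda_eta flip: drop_None_def)
    finally show ?thesis .
  qed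
  then show ?thesis by (simp add: vec_eq_iff[of "dird T p w"] matrix_mult_row)
qed

lemma hat_G: "(hat u v* G p) \<bullet> hat v = - \<kappa> * metric p u v" if p: "p \<in> U"
proof -
  have "(hat u v* G p) = hat (- \<kappa> *\<^sub>R (u v* metric_matrix f C p))"
    by (simp add: vec_eq_iff all_option G_def block_mat_def vector_matrix_mult_def UNIV_option_sum sum_distrib_left mult_ac sum_negf)
  moreover have "(u v* metric_matrix f C p) \<bullet> v = metric p u v"
    unfolding bilinear_as_matrix[OF bilinear_metric[OF p], of u v]
    by (simp add: inner_vec_def vector_matrix_mult_def metric_matrix_def sum_distrib_right, subst sum.swap) (simp add: mult_ac)
  moreover have "hat a \<bullet> hat b = a \<bullet> b" for a b :: "real^'m"
    by (simp add: inner_vec_def UNIV_option_sum)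
  ultimately show ?thesis by simp
qed

lemma G_None: "(y v* G p) $ None = y $ None"
  by (simp add: G_def block_mat_def vector_matrix_mult_def UNIV_option_sum)

lemma G_sym: "p \<in> U \<Longrightarrow> transpose (G p) = G p"
  by (simp add: vec_eq_iff all_option G_def block_mat_def transpose_def metric_matrix_def metric_sym)

lemma det_G: "det (G p) = (- \<kappa>) ^ CARD('m) * det (metric_matrix f C p)"
proof -
  have "- \<kappa> *\<^sub>R metric_matrix f C p = (\<chi> i. (- \<kappa>) *s metric_matrix f C p $ i)" by (simp add: vec_eq_iff)
  then show ?thesis
    using det_rows_mul[of "\<lambda>_. - \<kappa>" "\<lambda>i. metric_matrix f C p $ i"] by (simp add: G_def det_block_mat)
qed

lemma det_T: "det (T p) = - det (frame f C p) / \<kappa>"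
proof -
  have "T p = block_mat (- 1 / \<kappa>) (mat 1) ** frame f C p"
    by (simp add: vec_eq_iff[of "T p"] all_option matrix_mult_row)
      (simp add: vec_eq_iff frame_def block_mat_def vector_matrix_mult_def UNIV_option_sum mat_def E_def
        if_distrib if_distribR cong: if_cong)
  then show ?thesis by (simp add: det_mul det_block_mat)
qed

text \<open>The Blaschke normalization, squared to remove the absolute value so that it can be
  differentiated. The powers of \<open>\<kappa>\<close> come from the scaling of \<open>h\<close> to
  \<open>G\<close> and of \<open>C\<close> to \<open>E\<close>.\<close>

lemma det_relation: "p \<in> U \<Longrightarrow> (det (G p))\<^sup>2 = (\<kappa> ^ CARD('m) * \<kappa>\<^sup>2)\<^sup>2 * (det (T p)) ^ 4"
proof -
  assume "p \<in> U"
  then have "\<bar>det (metric_matrix f C p)\<bar> = (det (frame f C p))\<^sup>2" using data by (simp add: sphere_data_def)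
  then have "(det (metric_matrix f C p))\<^sup>2 = (det (frame f C p)) ^ 4" by (metis power2_abs power_mult num_double numeral_times_numeral)
  then show ?thesis using \<kappa> by (simp add: det_G det_T power_mult_distrib power_divide field_simps flip: power_mult)
qed

lemma invertible_G: "p \<in> U \<Longrightarrow> invertible (G p)"
  using det_relation[of p] \<kappa> E.det_frame_nz[of p] by (auto simp: invertible_det_nz)

lemma smooth_G: "smooth_on U G"
proof -
  have "smooth_on U (\<lambda>p. G p $ i $ j)" for i j
    by (cases i; cases j) (simp_all add: G_def block_mat_def metric_matrix_def smooth_on_const smooth_on_mult[OF openU]
       smooth_on_minus[OF openU] smooth_affine_metric)
  then show ?thesis by (intro smooth_on_vecI[OF openU])
qed

lemma DG: "p \<in> U \<Longrightarrow> dird G p w = Gam w p ** G p + G p ** transpose (Gam w p)"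
proof -
  assume p: "p \<in> U"
  have row: "(Gam w p ** G p) $ Some i $ Some j = - \<kappa> * metric p (Ga p w (axis i 1)) (axis j 1)" for i j
  proof -
    have "(Gam w p ** G p) $ Some i $ Some j = (hat (axis i 1) v* Gam w p v* G p) \<bullet> hat (axis j 1)"
    proof -
      have h: "hat (axis i 1) = (axis (Some i) 1 :: real^'m option)" for i :: 'm
        by (simp add: vec_eq_iff all_option axis_def)
      show ?thesis by (simp add: h axis_vmult matrix_mult_row inner_axis)
    qed
    then show ?thesis by (simp add: hat_Gam[OF p] hat_G[OF p])
  qed
  have tr: "G p ** transpose (Gam w p) = transpose (Gam w p ** G p)"
    by (simp add: matrix_transpose_mul G_sym[OF p])
  have None1: "(Gam w p ** G p) $ None $ j = 0" for j
    by (simp add: matrix_mult_row Gam_def vmat_simps)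
  have None2: "(Gam w p ** G p) $ i $ None = 0" for i
    by (cases i) (simp_all add: matrix_mult_row G_None Gam_def)
  have ent: "dird G p w $ i $ j = dird (\<lambda>q. G q $ i $ j) p w" for i j
    by (simp add: dird_nth[OF smooth_on_differentiable[OF smooth_G p]]
      dird_nth[OF smooth_on_differentiable[OF smooth_on_vec_nth[OF openU smooth_G] p]])
  have Ge: "G q $ None $ j = (case j of None \<Rightarrow> 1 | Some _ \<Rightarrow> 0)" "G q $ Some k $ None = 0"
    "G q $ Some k $ Some l = - \<kappa> * metric q (axis k 1) (axis l 1)" for q j k l
    by (auto simp: G_def block_mat_def metric_matrix_def split: option.splits)
  have "dird G p w $ i $ j = (Gam w p ** G p + G p ** transpose (Gam w p)) $ i $ j" for i j
  proof (cases i)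
    case None
    then show ?thesis unfolding tr ent
      by (cases j) (simp_all add: None1 None2 transpose_def Ge)
  next
    case (Some k)
    show ?thesis
    proof (cases j)
      case None
      then show ?thesis unfolding tr ent using Some
        by (simp add: None1 None2 transpose_def Ge)
    next
      case (Some l)
      have "dird (\<lambda>q. - \<kappa> * metric q (axis k 1) (axis l 1)) p w = - \<kappa> * dird (\<lambda>q. metric q (axis k 1) (axis l 1)) p w"
        by (rule frechet_derivative_linear[OF bounded_linear_mult_right smooth_on_differentiable[OF smooth_affine_metric[OF smooth_on_const smooth_on_const] p]])
      then show ?thesis unfolding tr ent using \<open>i = Some k\<close> Some
        by (simp add: Ge row transpose_def d_metric[OF p] algebra_simps metric_sym[OF p, of "axis k 1"])
    qed
  qed
  then show ?thesis by (simp add: vec_eq_iff)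
qed

text \<open>Apolarity, as the logarithmic derivative of \<open>det_relation\<close>: the left side
  contributes 4 times the trace of \<open>Gam\<close>, the right side 4 times the trace of
  \<open>A\<close>.\<close>

lemma trace_eq: assumes p: "p \<in> U" shows "trace (A w p) = trace (Gam w p)"
proof -
  have dT: "((\<lambda>q. det (T q)) has_derivative (\<lambda>w. trace (A w p) * det (T p))) (at p)"
    using det_has_derivative[OF smooth_on_has_derivative[OF E.smooth_frame p]]
    by (simp add: DT[OF p] ddet_mult_left)
  have dG: "((\<lambda>q. det (G q)) has_derivative (\<lambda>w. 2 * trace (Gam w p) * det (G p))) (at p)"
  proof -
    have "trace (transpose (Gam w p)) = trace (Gam w p)" for w by (simp add: trace_def transpose_def)
    then show ?thesis
      by (intro has_derivative_eq_rhs[OF det_has_derivative[OF smooth_on_has_derivative[OF smooth_G p]]])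
        (simp add: fun_eq_iff DG[OF p] ddet_add ddet_mult_left ddet_mult_right[OF invertible_G[OF p]])
  qed
  let ?k = "(\<kappa> ^ CARD('m) * \<kappa>\<^sup>2)\<^sup>2"
  have D1: "((\<lambda>q. (det (G q))\<^sup>2) has_derivative (\<lambda>w. 4 * trace (Gam w p) * (det (G p))\<^sup>2)) (at p)"
    by (rule has_derivative_eq_rhs[OF has_derivative_power[OF dG, of 2]]) (simp add: power2_eq_square fun_eq_iff)
  have D2: "((\<lambda>q. ?k * (det (T q)) ^ 4) has_derivative (\<lambda>w. 4 * trace (A w p) * (?k * (det (T p)) ^ 4))) (at p)"
    by (rule has_derivative_eq_rhs[OF has_derivative_mult_right[OF has_derivative_power[OF dT, of 4]]])
      (simp add: numeral_eq_Suc fun_eq_iff)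
  have "frechet_derivative (\<lambda>q. (det (G q))\<^sup>2) (at p) = frechet_derivative (\<lambda>q. ?k * (det (T q)) ^ 4) (at p)"
    by (rule frechet_derivative_cong_open[OF openU p det_relation])
  from fun_cong[OF this, of w]
  have "4 * trace (Gam w p) * (det (G p))\<^sup>2 = 4 * trace (A w p) * (?k * (det (T p)) ^ 4)"
    unfolding frechet_derivative_eqI[OF D1] frechet_derivative_eqI[OF D2] .
  moreover have "(det (G p))\<^sup>2 \<noteq> 0" using invertible_G[OF p] by (simp add: invertible_det_nz)
  ultimately show ?thesis using det_relation[OF p] by simp
qed

definition K where "K p w u = conn p w u - Ga p w u"

lemma hat_M: "p \<in> U \<Longrightarrow> hat u v* (A w p - Gam w p) = hat (K p w u) + (- \<kappa> * metric p w u) *\<^sub>R axis None 1"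
  by (simp add: vmat_simps hat_A hat_Gam K_def) (simp add: vec_eq_iff all_option)

lemma K_sym: "p \<in> U \<Longrightarrow> K p w u = K p u w"
  by (simp add: K_def conn_sym Ga_sym)

text \<open>The \<open>None\<close> component of the zero-curvature equation is the Codazzi equation
  for \<open>h\<close>. Compatibility with \<open>Ga\<close> replaces the derivative of
  \<open>h\<close>; the terms with \<open>Ga p v w\<close> cancel by symmetry, and the remaining
  ones combine to the difference tensor \<open>K\<close>.\<close>

lemma cubic_form_sym:
  assumes p: "p \<in> U"
  shows "metric p v (K p w u) = metric p w (K p v u)"
proof -
  have flatA: "dird (A w) p v + A w p ** A v p = dird (A v) p w + A v p ** A w p"
    by (rule connection_matrix_flat[OF openU E.smooth_frame smooth_A E.invertible_frame DT p])
  have comp: "(hat u v* (dird (A w) p v + A w p ** A v p)) $ None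
      = - \<kappa> * (metric p (Ga p v w) u + metric p w (Ga p v u) + metric p v (conn p w u))" for v w
  proof -
    have bl: "bounded_linear (\<lambda>X. (hat u v* X) $ None)"
      by (rule bounded_linear_compose[OF bounded_linear_vec_nth bounded_bilinear.bounded_linear_right[OF bounded_bilinear_vector_matrix_mult]])
    have "(hat u v* dird (A w) p v) $ None = dird (\<lambda>q. (hat u v* A w q) $ None) p v"
      using frechet_derivative_linear[OF bl smooth_on_differentiable[OF smooth_A p]] by simp
    also have "\<dots> = dird (\<lambda>q. - \<kappa> * metric q w u) p v"
      by (subst frechet_derivative_cong_open[OF openU p, of _ "\<lambda>q. - \<kappa> * metric q w u"]) (simp_all add: hat_A)
    also have "\<dots> = - \<kappa> * dird (\<lambda>q. metric q w u) p v"
      by (rule frechet_derivative_linear[OF bounded_linear_mult_right smooth_on_differentiable[OF smooth_affine_metric[OF smooth_on_const smooth_on_const] p]])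
    also have "\<dots> = - \<kappa> * (metric p (Ga p v w) u + metric p w (Ga p v u))" by (simp add: d_metric[OF p])
    finally have 1: "(hat u v* dird (A w) p v) $ None = - \<kappa> * (metric p (Ga p v w) u + metric p w (Ga p v u))" .
    have "(hat u v* (A w p ** A v p)) $ None = - \<kappa> * metric p v (conn p w u)"
      by (simp add: hat_A[OF p] e0_A vmat_simps flip: vector_matrix_mul_assoc)
    then show ?thesis using 1 by (simp add: vmat_simps algebra_simps)
  qed
  have "metric p (Ga p v w) u + metric p w (Ga p v u) + metric p v (conn p w u)
      = metric p (Ga p w v) u + metric p v (Ga p w u) + metric p w (conn p v u)"
    using comp[of w v] comp[of v w] \<kappa> unfolding flatA by simp
  then show ?thesis
    by (simp add: K_def bilinear_rsub[OF bilinear_metric[OF p]] Ga_sym[OF p, of w v])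
qed

text \<open>The tangential entries are a multiple of the cubic form. The mixed entries agree because
  the unit coefficient of a product equals the form \<open>G\<close> on its factors.\<close>

lemma AG_sym:
  assumes p: "p \<in> U"
  shows "transpose ((A w p - Gam w p) ** G p) = (A w p - Gam w p) ** G p"
proof -
  let ?X = "(A w p - Gam w p) ** G p"
  have G0: "axis None 1 v* G p = axis None 1"
    unfolding axis_vmult by (simp add: vec_eq_iff all_option G_def block_mat_def axis_def)
  have he: "hat a \<bullet> (axis None 1) = 0" for a :: "real^'m" by (simp add: inner_axis)
  have e: "(x v* G p) \<bullet> axis None 1 = x $ None" for x by (simp add: inner_axis G_None)
  have hG: "(axis None 1 :: real^'m option) \<bullet> hat z = 0" for z :: "real^'m" by (simp add: inner_axis' )
  have 1: "(hat u v* ?X) \<bullet> hat z = - \<kappa> * metric p (K p w u) z" for u z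
    unfolding vector_matrix_mul_assoc[symmetric] hat_M[OF p]
    by (simp add: vmat_simps inner_simps hat_G[OF p] G0 hG)
  have sym1: "(hat u v* ?X) \<bullet> hat z = (hat z v* ?X) \<bullet> hat u" for u z
    using cubic_form_sym[OF p, of z w u] K_sym[OF p] metric_sym[OF p] cubic_form_sym[OF p, of u w z] cubic_form_sym[OF p, of u z w]
    by (simp add: 1)
  have 2: "(hat u v* ?X) \<bullet> axis None 1 = (axis None 1 v* ?X) \<bullet> hat u" for u
    unfolding vector_matrix_mul_assoc[symmetric] hat_M[OF p] e
    by (simp add: vmat_simps hat_G[OF p] e0_A e0_Gam metric_sym[OF p, of u])
  have h: "hat (axis i 1) = (axis (Some i) 1 :: real^'m option)" for i :: 'm
    by (simp add: vec_eq_iff all_option axis_def)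
  have ent: "?X $ i $ j = (axis i 1 v* ?X) \<bullet> axis j 1" for i j by (simp add: axis_vmult inner_axis)
  have "?X $ i $ j = ?X $ j $ i" for i j
    unfolding ent using sym1[of "axis _ 1" "axis _ 1"] 2[of "axis _ 1"] unfolding h
    by (cases i; cases j) auto
  then show ?thesis by (simp add: vec_eq_iff transpose_def)
qed

sublocale P: parallel_frame U T G A Gam
proof (rule parallel_frame.intro)
  show "linear (\<lambda>w. A w p)" if p: "p \<in> U" for p
    by (rule linear_vecI)
      (auto simp: A_def vec_eq_iff all_option axis_def algebra_simps bilinear_ladd[OF bilinear_conn[OF p]]
        bilinear_lmul[OF bilinear_conn[OF p]] bilinear_ladd[OF bilinear_metric[OF p]]
        bilinear_lmul[OF bilinear_metric[OF p]] intro!: linearI split: option.splits)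
  show "linear (\<lambda>w. Gam w p)" if p: "p \<in> U" for p
    by (rule linear_vecI)
      (auto simp: Gam_def vec_eq_iff all_option bilinear_ladd[OF bilinear_Ga[OF p]]
        bilinear_lmul[OF bilinear_Ga[OF p]] intro!: linearI split: option.splits)
  show "(y v* Gam w p) $ None = 0" if "p \<in> U" for p w y
    by (simp add: vector_matrix_mult_def UNIV_option_sum Gam_def)
  show "trace (A w p - Gam w p) = 0" if "p \<in> U" for p w
    using trace_eq[OF that] by (simp add: trace_simps)
qed (simp_all add: openU E.smooth_frame smooth_G smooth_A smooth_Gam E.invertible_frame invertible_G DT DG G_sym G_None
    AG_sym e0_A e0_Gam hat_A hat_Gam conn_sym metric_sym Ga_sym)

sublocale P: flat_parallel_frame U T G A Gam
proof (unfold_locales)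
  show "CARD('m) \<ge> 2" by (rule dim2)
  fix p v w assume p: "p \<in> U"
    and "((hat v v* G p) \<bullet> hat v) * ((hat w v* G p) \<bullet> hat w) - ((hat v v* G p) \<bullet> hat w)\<^sup>2 \<noteq> 0"
  \<comment> \<open>The Gram determinant is quadratic in the form, so it changes by
    \<open>\<kappa>\<^sup>2\<close> and the nondegenerate planes are the same.\<close>
  then have "\<kappa>\<^sup>2 * (metric p v v * metric p w w - (metric p v w)\<^sup>2) \<noteq> 0"
    by (simp add: hat_G[OF p] power2_eq_square algebra_simps)
  then have ne: "metric p v v * metric p w w - (metric p v w)\<^sup>2 \<noteq> 0" by simp
  have D: "hat u v* dird (Gam w) p v = hat (dird (\<lambda>q. Ga q w u) p v)" for u v w
  proof -
    have bl: "bounded_linear (\<lambda>X. hat u v* X)"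
      by (rule bounded_bilinear.bounded_linear_right[OF bounded_bilinear_vector_matrix_mult])
    have "hat u v* dird (Gam w) p v = dird (\<lambda>q. hat u v* Gam w q) p v"
      using frechet_derivative_linear[OF bl smooth_on_differentiable[OF smooth_Gam p]] by simp
    also have "\<dots> = dird (\<lambda>q. hat (Ga q w u)) p v"
      by (subst frechet_derivative_cong_open[OF openU p, of _ "\<lambda>q. hat (Ga q w u)"]) (simp_all add: hat_Gam)
    also have "\<dots> = hat (dird (\<lambda>q. Ga q w u) p v)"
      by (rule frechet_derivative_linear[OF bounded_linear_hat smooth_on_differentiable[OF Ga_smooth p]])
    finally show ?thesis .
  qed
  have hd: "hat (x - y) = hat x - hat y" "hat (x + y) = hat x + hat y" for x y :: "real^'m"
    by (simp_all add: vec_eq_iff all_option)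
  have "hat w v* P.R v w p = hat (dird (\<lambda>q. Ga q w w) p v + Ga p v (Ga p w w) - (dird (\<lambda>q. Ga q v w) p w + Ga p w (Ga p v w)))"
    by (simp add: P.R_def vmat_simps D hat_Gam[OF p] hd flip: vector_matrix_mul_assoc)
  then show "(hat w v* P.R v w p v* G p) \<bullet> hat v = 0"
    using sectional_vanishes[OF p ne] hat_G[OF p] by simp
qed

end

section \<open>From the algebra to the standard structures\<close>

lemma trace_conjugate:
  fixes J J0 L :: "real^'d \<Rightarrow> real^'d"
  assumes lin: "linear J" "linear J0" "linear L" and L: "bij L" and inter: "\<And>x. L (J x) = J0 (L x)"
  shows "trace (matrix J) = trace (matrix J0)"
proof -
  have "matrix (L \<circ> J) = matrix (J0 \<circ> L)" using inter by (simp add: o_def)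
  then have eq: "matrix L ** matrix J = matrix J0 ** matrix L" by (simp add: matrix_compose lin)
  have "det (matrix L) \<noteq> 0" using L lin(3) by (metis bij_is_inj det_nz_iff_inj)
  then have inv: "invertible (matrix L)" by (simp add: invertible_det_nz)
  have "matrix J = matrix_inv (matrix L) ** (matrix L ** matrix J)"
    by (simp add: matrix_mul_assoc matrix_inv_left_right[OF inv])
  then have "trace (matrix J) = trace ((matrix L ** matrix J) ** matrix_inv (matrix L))"
    by (metis trace_mul_sym)
  also have "\<dots> = trace (matrix J0)"
    unfolding eq by (simp add: matrix_inv_left_right[OF inv] flip: matrix_mul_assoc)
  finally show ?thesis .
qed

lemma trace_standard_structures:
  fixes e :: "nat \<Rightarrow> 'd::finite"
  assumes e: "bij_betw e {1..2*n+2} UNIV"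
  shows "trace (matrix (para_complex_structure n e)) = 0" "trace (matrix (complex_structure n e)) = 0"
proof -
  have ne: "e k \<noteq> e (n + 1 + k)" if "k \<in> {1..n+1}" for k
    using e_eq_iff[OF e, of k "n + 1 + k"] that by auto
  have "para_complex_structure n e (axis r 1) $ r = 0 \<and> complex_structure n e (axis r 1) $ r = 0" for r
  proof (cases rule: ex_index[OF e, of r])
    case (1 k)
    then show ?thesis using ne[OF 1(1)] structure_axis(1,3)[OF e 1(1)] by (simp add: axis_def)
  next
    case (2 k)
    then show ?thesis using ne[OF 2(1)] structure_axis(2,4)[OF e 2(1)] by (simp add: axis_def)
  qed
  then show "trace (matrix (para_complex_structure n e)) = 0" "trace (matrix (complex_structure n e)) = 0"
    by (simp_all add: trace_def matrix_def)
qed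

context proper_flat_sphere
begin

definition tmul where "tmul p x y = x v* P.L y p"

text \<open>No element has square zero: if \<open>x\<close> squares to 0, then so does every product
  of \<open>x\<close> with an element \<open>y\<close>, whose multiplication then has trace 0; hence
  \<open>b\<close> vanishes on \<open>x\<close> and all \<open>y\<close>.\<close>

lemma tangent_algebra:
  assumes p: "p \<in> U"
  shows "reduced_algebra (tmul p) (axis None 1)"
proof -
  have assoc: "(x v* P.L y p) v* P.L z p = x v* P.L (y v* P.L z p) p" for x y z
    by (simp add: P.L_mult[OF p, symmetric] vector_matrix_mul_assoc)
  have red: "x = 0" if xx: "x v* P.L x p = 0" for x
  proof (rule P.b_nondeg[OF p])
    fix y
    have "P.L x p ** P.L x p = 0"
      using P.L_mult[OF p, of x x] P.L_scale[OF p, of 0 0] xx by simp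
    then have "(P.L x p ** P.L y p) ** (P.L x p ** P.L y p) = 0"
      using P.L_commute[OF p, of y x] by (metis (no_types) matrix_mul_assoc mat_simps(9))
    then have "trace (P.L x p ** P.L y p) = 0" by (rule trace_square_zero)
    then show "P.b p x y = 0" by (simp add: P.L_mult[OF p] P.trace_L[OF p] P.mult_None[OF p])
  qed
  have bil: "bilinear (tmul p)"
    unfolding bilinear_def by (auto intro!: linearI simp: tmul_def P.L_add[OF p] P.L_scale[OF p] vmat_simps)
  show ?thesis
  proof (intro reduced_algebra.intro comm_algebra.intro reduced_algebra_axioms.intro)
    show "tmul p x y = tmul p y x" for x y unfolding tmul_def by (rule P.L_comm[OF p])
    show "tmul p (tmul p x y) z = tmul p x (tmul p y z)" for x y z unfolding tmul_def by (rule assoc)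
    show "tmul p (axis None 1) x = x" for x unfolding tmul_def by (rule P.e0_L[OF p])
    show "x = 0" if "tmul p x x = 0" for x using that unfolding tmul_def by (rule red)
  qed (rule bil)
qed

text \<open>An element \<open>j\<close> of the algebra at \<open>p0\<close> acts as a fixed endomorphism of the ambient space,
  which stays in the algebra at nearby points because the algebra is locally constant.\<close>
lemma tangent_of_conjugate:
  assumes p0: "p0 \<in> U" and r: "ball p0 r \<subseteq> U" and J0: "linear J0" "trace (matrix J0) = 0"
    and L1: "linear L1" "bij L1" "\<And>x. L1 (x v* P.L j p0) = J0 (L1 x)"
  shows "\<exists>L. linear L \<and> bij L \<and> \<bar>det (matrix L)\<bar> = 1 \<and> (\<forall>p\<in>ball p0 r. \<exists>v. J0 (L (C p)) = L (dird f p v))"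
proof -
  have linj: "linear (\<lambda>x. x v* P.L j p0)" by (intro linearI) (simp_all add: vmat_simps)
  have "trace (matrix (\<lambda>x. x v* P.L j p0)) = 0"
    using trace_conjugate[OF linj J0(1) L1(1,2)] L1(3) J0(2) by simp
  moreover have "matrix (\<lambda>x. x v* P.L j p0) = transpose (P.L j p0)"
    by (simp add: matrix_def vec_eq_iff transpose_def axis_vmult)
  ultimately have "trace (P.L j p0) = 0" by (simp add: trace_def transpose_def)
  \<comment> \<open>The trace of a multiplication is the dimension times the unit coefficient, so
    conjugacy to a trace-free structure forces \<open>j\<close> to be orthogonal to the
    unit.\<close>
  then have "j $ None = 0" using P.trace_L[OF p0, of j] by simp
  then have j: "j = hat (drop_None j)" using hat_drop_None[of j] by simp
  define a where "a = drop_None j"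
  have La: "P.L j p0 = P.M a p0" using P.L_hat[OF p0, of a] j by (simp add: a_def)
  have inv: "matrix_inv (T p0) ** T p0 = mat 1" "T p0 ** matrix_inv (T p0) = mat 1"
    using matrix_inv_left_right[OF E.invertible_frame[OF p0]] by auto
  \<comment> \<open>\<open>L1\<close> conjugates the multiplication in frame coordinates at
    \<open>p0\<close>; the inverse frame translates this to ambient vectors.\<close>
  define L2 where "L2 x = L1 (x v* matrix_inv (T p0))" for x
  have lin2: "linear (\<lambda>x. x v* matrix_inv (T p0))" by (intro linearI) (simp_all add: vmat_simps)
  have L2: "linear L2" unfolding L2_def using linear_compose[OF lin2 L1(1)] by (simp add: o_def)
  have "bij (\<lambda>x. x v* matrix_inv (T p0))"
    by (rule o_bij[of "\<lambda>x. x v* T p0"]) (simp_all add: fun_eq_iff vector_matrix_mul_assoc inv)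
  then have bij2: "bij L2" unfolding L2_def using bij_comp[OF _ L1(2), of "\<lambda>x. x v* matrix_inv (T p0)"] by (simp add: o_def)
  have inter: "L2 (x v* P.N a p0) = J0 (L2 x)" for x
  proof -
    have "x v* P.N a p0 v* matrix_inv (T p0) = x v* matrix_inv (T p0) v* P.L j p0"
      unfolding P.N_def La by (simp add: vector_matrix_mul_assoc inv flip: matrix_mul_assoc)
    then show ?thesis by (simp add: L2_def L1(3))
  qed
  obtain L where L: "linear L" "bij L" "\<bar>det (matrix L)\<bar> = 1" "\<And>x. L (x v* P.N a p0) = J0 (L x)"
    using unimodular_rescaling[where L = L2 and J = "\<lambda>x. x v* P.N a p0" and J0 = J0, OF L2 bij2 J0(1)] inter
    by metis
  have "\<exists>v. J0 (L (C p)) = L (dird f p v)" if p: "p \<in> ball p0 r" for p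
  proof -
    have pU: "p \<in> U" using p r by auto
    obtain y where y: "P.N a p0 = P.N y p" using P.N_range_constant[OF r p0 p] by blast
    \<comment> \<open>\<open>E p\<close> is the row \<open>None\<close> of the frame, that is, the
      unit of the algebra; multiplication by \<open>hat y\<close> sends it to the tangent vector
      with coordinates \<open>y\<close>.\<close>
    have "E p v* P.N y p = axis None 1 v* (T p ** P.N y p)"
      by (simp add: axis_vmult frame_def flip: vector_matrix_mul_assoc)
    also have "\<dots> = hat y v* T p" by (simp add: P.T_N[OF pU] P.e0_M[OF pU] flip: vector_matrix_mul_assoc)
    also have "\<dots> = dird f p y" by (simp add: E.vmult_frame[OF pU])
    finally have "C p v* P.N a p0 = dird f p (- \<kappa> *\<^sub>R y)"
      unfolding y using C_E[of p] linear_scale[OF linear_df[OF pU], of "- \<kappa>" y] by (simp add: vmat_simps)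
    then show ?thesis using L(4)[of "C p"] by metis
  qed
  then show ?thesis using L by blast
qed

lemma tangent_to_standard_structure:
  fixes e :: "nat \<Rightarrow> 'm option"
  assumes card: "CARD('m) = 2 * n + 1" and e: "bij_betw e {1..2*n+2} UNIV" and p0: "p0 \<in> U" and r: "ball p0 r \<subseteq> U"
  shows "\<exists>J0 L. J0 \<in> {para_complex_structure n e, complex_structure n e} \<and> linear L \<and> bij L \<and> \<bar>det (matrix L)\<bar> = 1
    \<and> (\<forall>p\<in>ball p0 r. \<exists>v. J0 (L (C p)) = L (dird f p v))"
proof -
  interpret alg: reduced_algebra "tmul p0" "axis None 1"
    by (rule tangent_algebra[OF p0])
  have d: "DIM(real^'m option) = 2 * (n + 1)" using card by simp
  have flip: "tmul p0 j x = x v* P.L j p0" for j x unfolding tmul_def by (rule P.L_comm[OF p0])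
  from d show ?thesis
  proof (cases rule: alg.balanced_square_root)
    case (imaginary j B)
    have "tmul p0 j (tmul p0 j x) = - x" for x
      using alg.assoc[of j j x] imaginary(1) alg.one[of x] alg.mul_simps(7)[of "axis None 1" x] by simp
    from conjugate_complex_structure[OF e alg.linear_mul this imaginary(2-6)]
    obtain L1 where L1: "linear L1" "bij L1" "\<And>x. L1 (tmul p0 j x) = complex_structure n e (L1 x)"
      by blast
    have "L1 (x v* P.L j p0) = complex_structure n e (L1 x)" for x
      using L1(3)[of x] flip[of j x] by simp
    from tangent_of_conjugate[OF p0 r linear_complex_structure trace_standard_structures(2)[OF e] L1(1,2) this]
    show ?thesis by blast
  next
    case (signs j B B')
    from conjugate_para_complex_structure[OF e alg.linear_mul signs(7,8) signs(1-6)]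
    obtain L1 where L1: "linear L1" "bij L1" "\<And>x. L1 (tmul p0 j x) = para_complex_structure n e (L1 x)"
      by blast
    have "L1 (x v* P.L j p0) = para_complex_structure n e (L1 x)" for x
      using L1(3)[of x] flip[of j x] by simp
    from tangent_of_conjugate[OF p0 r linear_para_complex_structure trace_standard_structures(1)[OF e] L1(1,2) this]
    show ?thesis by blast
  qed
qed

end

lemma affine_transformation_linear: "linear L \<Longrightarrow> bij L \<Longrightarrow> affine_transformation L"
  unfolding affine_transformation_def by (intro exI[of _ L] exI[of _ 0]) auto

lemma structure_tangent_linear_image:
  fixes f :: "real ^ 'm \<Rightarrow> real ^ ('m::finite option)"
  assumes h: "affine_hypersphere_with U f C \<kappa>" and V: "open V" "connected V" "V \<noteq> {}" "V \<subseteq> U"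
    and L: "linear L" "bij L" "\<bar>det (matrix L)\<bar> = 1"
    and t: "\<And>p. p \<in> V \<Longrightarrow> \<exists>v. J (L (C p)) = L (dird f p v)"
  shows "structure_tangent J V (L \<circ> f)"
  unfolding structure_tangent_def
proof (intro exI conjI ballI)
  show "affine_hypersphere_with V (L \<circ> f) (L \<circ> C) \<kappa>"
    by (rule affine_hypersphere_with_linear_image[OF h V L])
  fix p assume p: "p \<in> V"
  obtain v where v: "J (L (C p)) = L (dird f p v)" using t[OF p] by blast
  have "f differentiable at p"
    using h p V(4) smooth_on_differentiable[of U f p] by (auto simp: affine_hypersphere_with_def immersion_on_def)
  then have "J ((L \<circ> C) p) = dird (L \<circ> f) p v" using v by (simp add: frechet_derivative_compose_linear[OF L(1)])
  then show "J ((L \<circ> C) p) \<in> tangent_space (L \<circ> f) p" by (simp add: tangent_space_def)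
qed

theorem proper_flat_affine_hypersphere_structure_tangent:
  fixes n :: nat and e :: "nat \<Rightarrow> 'm::finite option" and f :: "real ^ 'm \<Rightarrow> real ^ ('m option)"
  assumes n: "n \<ge> 1" and card: "CARD('m) = 2 * n + 1" and e: "bij_betw e {1..2*n+2} UNIV"
    and f: "proper_flat_affine_hypersphere U f" and p: "p \<in> U"
  shows "\<exists>V A. open V \<and> connected V \<and> p \<in> V \<and> V \<subseteq> U \<and> affine_transformation A \<and>
     (structure_tangent (para_complex_structure n e) V (A \<circ> f) \<or>
      structure_tangent (complex_structure n e) V (A \<circ> f))"
proof -
  obtain C \<kappa> LC where h: "affine_hypersphere_with U f C \<kappa>" and \<kappa>: "\<kappa> \<noteq> 0"
    and LC: "levi_civita U (affine_metric f C) LC"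
    and flat: "\<And>X Y p. smooth_on U X \<Longrightarrow> smooth_on U Y \<Longrightarrow> p \<in> U \<Longrightarrow> plane_gram (affine_metric f C) X Y p \<noteq> 0
      \<Longrightarrow> sectional_curvature (affine_metric f C) LC X Y p = 0"
    using f unfolding proper_flat_affine_hypersphere_def flat_metric_def by blast
  have "proper_flat_sphere U f C \<kappa> LC"
    by (intro proper_flat_sphere.intro proper_flat_sphere_axioms.intro affine_hypersphere_withD[OF h] \<kappa> LC flat)
      (use n card in auto)
  then interpret proper_flat_sphere U f C \<kappa> LC .
  obtain r where r: "r > 0" "ball p r \<subseteq> U" using openU p open_contains_ball by blast
  obtain J0 L where L: "J0 \<in> {para_complex_structure n e, complex_structure n e}" "linear L" "bij L"
      "\<bar>det (matrix L)\<bar> = 1" "\<forall>q\<in>ball p r. \<exists>v. J0 (L (C q)) = L (dird f q v)"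
    using tangent_to_standard_structure[OF card e p r(2)] by blast
  have "structure_tangent J0 (ball p r) (L \<circ> f)"
    by (rule structure_tangent_linear_image[OF h _ _ _ r(2) L(2-4)]) (use r L(5) in auto)
  moreover have "p \<in> ball p r" using r by simp
  ultimately show ?thesis
    using L(1) affine_transformation_linear[OF L(2,3)] r(2) open_ball connected_ball by (intro exI[of _ "ball p r"] exI[of _ L]) auto
qed

section \<open>Products of circles\<close>

text \<open>The involution exchanges the two coordinates of each circle. Sums and products over
  circles become sums and products over all coordinates, in which every circle is counted
  twice.\<close>

locale pairing =
  fixes \<sigma> :: "'d::finite \<Rightarrow> 'd"
  assumes invol: "\<sigma> (\<sigma> r) = r" and fixfree: "\<sigma> r \<noteq> r"
begin

definition rho :: "real^'d \<Rightarrow> 'd \<Rightarrow> real" where "rho x r = (x $ r)\<^sup>2 + (x $ \<sigma> r)\<^sup>2"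

lemma rho_partner [simp]: "rho x (\<sigma> r) = rho x r"
  by (simp add: rho_def invol)

lemma sum_partner: "(\<Sum>r\<in>UNIV. g (\<sigma> r)) = (\<Sum>r\<in>UNIV. g r)"
  by (rule sum.reindex_bij_betw) (rule bij_betwI[where g = \<sigma>], auto simp: invol)

text \<open>Up to a factor, the differential of \<open>\<Prod>r. rho x r\<close>, divided by this product.\<close>
definition ell :: "real^'d \<Rightarrow> real^'d \<Rightarrow> real" where
  "ell x w = (\<Sum>r\<in>UNIV. x $ r * w $ r / rho x r)"

text \<open>The matrix of the derivative of \<open>\<lambda>x. ell x\<close>.\<close>
definition S :: "real^'d \<Rightarrow> real^'d^'d" where
  "S x = (\<chi> r s. if s = r then ((x $ \<sigma> r)\<^sup>2 - (x $ r)\<^sup>2) / (rho x r)\<^sup>2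
     else if s = \<sigma> r then - 2 * x $ r * x $ \<sigma> r / (rho x r)\<^sup>2 else 0)"

lemma linear_ell: "linear (ell x)"
  by (rule linearI) (simp_all add: ell_def sum.distrib sum_distrib_left algebra_simps add_divide_distrib)

lemma sum_two:
  assumes "\<And>s. s \<noteq> r \<Longrightarrow> s \<noteq> \<sigma> r \<Longrightarrow> g s = 0"
  shows "(\<Sum>s\<in>UNIV. g s) = g r + g (\<sigma> r)"
proof -
  have "(\<Sum>s\<in>UNIV. g s) = (\<Sum>s\<in>{r, \<sigma> r}. g s)"
    by (rule sum.mono_neutral_right) (use assms in auto)
  then show ?thesis using fixfree[of r] by simp
qed

lemma S_entries:
  "S x $ r $ r = ((x $ \<sigma> r)\<^sup>2 - (x $ r)\<^sup>2) / (rho x r)\<^sup>2"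
  "S x $ r $ \<sigma> r = - 2 * x $ r * x $ \<sigma> r / (rho x r)\<^sup>2"
  "s \<noteq> r \<Longrightarrow> s \<noteq> \<sigma> r \<Longrightarrow> S x $ r $ s = 0"
  using fixfree[of r] by (auto simp: S_def)

lemma S_apply:
  "(S x *v c) $ r = (((x $ \<sigma> r)\<^sup>2 - (x $ r)\<^sup>2) * c $ r - 2 * x $ r * x $ \<sigma> r * c $ \<sigma> r) / (rho x r)\<^sup>2"
proof -
  have "(S x *v c) $ r = S x $ r $ r * c $ r + S x $ r $ \<sigma> r * c $ \<sigma> r"
    unfolding matrix_vector_mult_def by (simp, rule sum_two) (simp add: S_entries)
  then show ?thesis by (simp add: S_entries diff_divide_distrib left_diff_distrib)
qed

lemma S_self:
  assumes "\<And>r. rho x r \<noteq> 0"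
  shows "(S x *v x) $ r = - (x $ r / rho x r)"
proof -
  have "((x $ \<sigma> r)\<^sup>2 - (x $ r)\<^sup>2) * x $ r - 2 * x $ r * x $ \<sigma> r * x $ \<sigma> r = - (x $ r * rho x r)"
    by (simp add: rho_def algebra_simps power2_eq_square)
  then show ?thesis unfolding S_apply using assms[of r] by (simp add: power2_eq_square)
qed

text \<open>On each pair of coordinates \<open>S x\<close> is a symmetric trace-free block of size
  2, so its square is a scalar.\<close>

lemma S_square:
  assumes nz: "\<And>r. rho x r \<noteq> 0"
  shows "(S x ** S x) $ r $ s = (if r = s then 1 / (rho x r)\<^sup>2 else 0)"
proof -
  have row: "(S x ** S x) $ r $ s = S x $ r $ r * S x $ r $ s + S x $ r $ \<sigma> r * S x $ \<sigma> r $ s"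
    unfolding matrix_matrix_mult_def by (simp, rule sum_two) (simp add: S_entries)
  consider "s = r" | "s = \<sigma> r" | "s \<noteq> r" "s \<noteq> \<sigma> r" by blast
  then show ?thesis
  proof cases
    case 1
    have "S x $ \<sigma> r $ r = S x $ r $ \<sigma> r"
      using S_entries(2)[of x "\<sigma> r"] S_entries(2)[of x r] by (simp add: invol)
    then have "(S x ** S x) $ r $ s = S x $ r $ r * S x $ r $ r + S x $ r $ \<sigma> r * S x $ r $ \<sigma> r"
      using row 1 by simp
    also have "\<dots> = (((x $ \<sigma> r)\<^sup>2 - (x $ r)\<^sup>2)\<^sup>2 + (2 * x $ r * x $ \<sigma> r)\<^sup>2) / (rho x r) ^ 4"
      by (simp add: S_entries power2_eq_square power4_eq_xxxx add_divide_distrib)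
    also have "((x $ \<sigma> r)\<^sup>2 - (x $ r)\<^sup>2)\<^sup>2 + (2 * x $ r * x $ \<sigma> r)\<^sup>2 = (rho x r)\<^sup>2"
      by (simp add: rho_def power2_eq_square algebra_simps)
    finally show ?thesis using 1 nz[of r] by (simp add: power4_eq_xxxx power2_eq_square)
  next
    case 2
    have "S x $ \<sigma> r $ \<sigma> r = - S x $ r $ r"
      using S_entries(1)[of x "\<sigma> r"] S_entries(1)[of x r] by (simp add: invol minus_divide_left)
    then show ?thesis unfolding row using 2 fixfree[of r] by simp
  next
    case 3
    then have "S x $ \<sigma> r $ s = 0" using S_entries(3)[of s "\<sigma> r"] by (simp add: invol)
    then show ?thesis unfolding row using 3 by (simp add: S_entries)
  qed
qed

text \<open>The square of \<open>S x\<close> is diagonal, and its determinant is the inverse square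
  of the constant product.\<close>

lemma det_S:
  assumes p: "(\<Prod>r\<in>UNIV. rho x r) = 1"
  shows "\<bar>det (S x)\<bar> = 1"
proof -
  have nz: "rho x r \<noteq> 0" for r using p by (metis UNIV_I finite prod_zero_iff zero_neq_one)
  have "det (S x) * det (S x) = (\<Prod>r\<in>UNIV. 1 / (rho x r)\<^sup>2)"
    using det_diagonal[of "S x ** S x"] S_square[OF nz] by (simp add: det_mul)
  also have "\<dots> = 1 / (\<Prod>r\<in>UNIV. rho x r)\<^sup>2" by (simp add: prod_dividef prod_power_distrib)
  finally have "\<bar>det (S x)\<bar>\<^sup>2 = 1" using p by (simp add: power2_eq_square)
  then show ?thesis by (simp add: abs_square_eq_1)
qed

text \<open>The two terms of a pair add up to one value of \<open>c\<close>, while the sum of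
  \<open>c\<close> counts that value twice.\<close>

lemma half_sum:
  assumes nz: "\<And>r. rho x r \<noteq> 0" and s: "\<And>r. c (\<sigma> r) = c r"
  shows "(\<Sum>r\<in>UNIV. c r * (x $ r)\<^sup>2 / rho x r) = (\<Sum>r\<in>UNIV. c r) / 2"
proof -
  have "(\<Sum>r\<in>UNIV. c r * (x $ \<sigma> r)\<^sup>2 / rho x r) = (\<Sum>r\<in>UNIV. c r * (x $ r)\<^sup>2 / rho x r)"
    using sum_partner[of "\<lambda>r. c r * (x $ r)\<^sup>2 / rho x r"] by (simp add: s)
  then have "2 * (\<Sum>r\<in>UNIV. c r * (x $ r)\<^sup>2 / rho x r)
      = (\<Sum>r\<in>UNIV. c r * (x $ r)\<^sup>2 / rho x r + c r * (x $ \<sigma> r)\<^sup>2 / rho x r)"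
    by (simp add: sum.distrib)
  also have "\<dots> = (\<Sum>r\<in>UNIV. c r)"
  proof (rule sum.cong)
    fix r
    have "c r * (x $ r)\<^sup>2 / rho x r + c r * (x $ \<sigma> r)\<^sup>2 / rho x r = c r * rho x r / rho x r"
      by (simp add: rho_def add_divide_distrib distrib_left)
    then show "c r * (x $ r)\<^sup>2 / rho x r + c r * (x $ \<sigma> r)\<^sup>2 / rho x r = c r" using nz by simp
  qed simp
  finally show ?thesis by simp
qed

lemma ell_self: "(\<And>r. rho x r \<noteq> 0) \<Longrightarrow> ell x x = CARD('d) / 2"
  using half_sum[of x "\<lambda>_. 1"] by (simp add: ell_def power2_eq_square)

lemma ell_S_self: "(\<And>r. rho x r \<noteq> 0) \<Longrightarrow> c \<bullet> (S x *v x) = - ell x c"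
  by (simp add: inner_vec_def S_self ell_def sum_negf mult.commute)

lemma rho_has_derivative:
  assumes "(f has_derivative f') (at p)"
  shows "((\<lambda>q. rho (f q) r) has_derivative (\<lambda>v. 2 * (f p $ r * f' v $ r + f p $ \<sigma> r * f' v $ \<sigma> r))) (at p)"
proof -
  have c: "((\<lambda>q. f q $ i) has_derivative (\<lambda>v. f' v $ i)) (at p)" for i
    by (rule bounded_linear.has_derivative[OF bounded_linear_vec_nth assms])
  show ?thesis unfolding rho_def power2_eq_square
    by (rule has_derivative_eq_rhs[OF has_derivative_add[OF has_derivative_mult[OF c c] has_derivative_mult[OF c c]]])
      (simp add: fun_eq_iff algebra_simps)
qed

lemma ell_has_derivative:
  assumes f: "(f has_derivative f') (at p)" and F: "(F has_derivative F') (at p)" and nz: "\<And>r. rho (f p) r \<noteq> 0"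
  shows "((\<lambda>q. ell (f q) (F q)) has_derivative (\<lambda>v. ell (f p) (F' v) + F p \<bullet> (S (f p) *v f' v))) (at p)"
proof -
  have cf: "((\<lambda>q. f q $ i) has_derivative (\<lambda>v. f' v $ i)) (at p)" for i
    by (rule bounded_linear.has_derivative[OF bounded_linear_vec_nth f])
  have cF: "((\<lambda>q. F q $ i) has_derivative (\<lambda>v. F' v $ i)) (at p)" for i
    by (rule bounded_linear.has_derivative[OF bounded_linear_vec_nth F])
  have "((\<lambda>q. f q $ r * F q $ r / rho (f q) r) has_derivative
     (\<lambda>v. f p $ r * F' v $ r / rho (f p) r + F p $ r * (S (f p) *v f' v) $ r)) (at p)" for r
  proof (rule has_derivative_eq_rhs[OF has_derivative_divide'[OF has_derivative_mult[OF cf cF] rho_has_derivative[OF f] nz]])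
    let ?x = "f p"
    have "((?x $ r * F' v $ r + f' v $ r * F p $ r) * rho ?x r - ?x $ r * F p $ r * (2 * (?x $ r * f' v $ r + ?x $ \<sigma> r * f' v $ \<sigma> r))) / (rho ?x r * rho ?x r)
      = ?x $ r * F' v $ r / rho ?x r + F p $ r * (S ?x *v f' v) $ r" for v
    proof -
      have "(?x $ r * F' v $ r + f' v $ r * F p $ r) * rho ?x r - ?x $ r * F p $ r * (2 * (?x $ r * f' v $ r + ?x $ \<sigma> r * f' v $ \<sigma> r))
        = ?x $ r * F' v $ r * rho ?x r + F p $ r * (((?x $ \<sigma> r)\<^sup>2 - (?x $ r)\<^sup>2) * f' v $ r - 2 * ?x $ r * ?x $ \<sigma> r * f' v $ \<sigma> r)"
        by (simp add: rho_def power2_eq_square algebra_simps)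
      then show ?thesis unfolding S_apply using nz[of r]
        by (simp add: add_divide_distrib power2_eq_square)
    qed
    then show "(\<lambda>v. ((?x $ r * F' v $ r + f' v $ r * F p $ r) * rho ?x r - ?x $ r * F p $ r * (2 * (?x $ r * f' v $ r + ?x $ \<sigma> r * f' v $ \<sigma> r))) / (rho ?x r * rho ?x r))
      = (\<lambda>v. ?x $ r * F' v $ r / rho ?x r + F p $ r * (S ?x *v f' v) $ r)" by blast
  qed
  then have "((\<lambda>q. \<Sum>r\<in>UNIV. f q $ r * F q $ r / rho (f q) r) has_derivative
     (\<lambda>v. \<Sum>r\<in>UNIV. f p $ r * F' v $ r / rho (f p) r + F p $ r * (S (f p) *v f' v) $ r)) (at p)"
    by (intro has_derivative_sum)
  then show ?thesis by (simp add: ell_def[abs_def] sum.distrib inner_vec_def)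
qed

text \<open>The logarithmic derivative of the product of all \<open>rho\<close> is
  \<open>4 * ell\<close>: a factor 2 from the squares and another 2 because each circle occurs
  twice.\<close>

lemma ell_of_constant_product:
  assumes f: "(f has_derivative f') (at p)" and U: "open U" "p \<in> U" and prod: "\<And>q. q \<in> U \<Longrightarrow> (\<Prod>r\<in>UNIV. rho (f q) r) = 1"
  shows "ell (f p) (f' v) = 0"
proof -
  have nz: "rho (f p) r \<noteq> 0" for r using prod[OF U(2)] by (metis UNIV_I finite prod_zero_iff zero_neq_one)
  let ?d = "\<lambda>v r. 2 * (f p $ r * f' v $ r + f p $ \<sigma> r * f' v $ \<sigma> r)"
  have d1: "((\<lambda>q. \<Prod>r\<in>UNIV. rho (f q) r) has_derivative (\<lambda>v. \<Sum>r\<in>UNIV. ?d v r * (\<Prod>s\<in>UNIV - {r}. rho (f p) s))) (at p)"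
    by (intro has_derivative_prod rho_has_derivative f)
  have d2: "((\<lambda>q. \<Prod>r\<in>UNIV. rho (f q) r) has_derivative (\<lambda>v. 0)) (at p)"
    by (rule has_derivative_transform_within_open[OF has_derivative_const U]) (simp add: prod)
  have "(\<Sum>r\<in>UNIV. ?d v r * (\<Prod>s\<in>UNIV - {r}. rho (f p) s)) = 0"
    using fun_cong[OF has_derivative_unique[OF d1 d2], of v] .
  moreover have "(\<Prod>s\<in>UNIV - {r}. rho (f p) s) = 1 / rho (f p) r" for r
    using prod[OF U(2)] prod.remove[of UNIV r "rho (f p)"] nz[of r] by (simp add: field_simps)
  ultimately have "0 = (\<Sum>r\<in>UNIV. 2 * (f p $ r * f' v $ r / rho (f p) r) + 2 * (f p $ \<sigma> r * f' v $ \<sigma> r / rho (f p) (\<sigma> r)))"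
    by (simp add: add_divide_distrib)
  also have "\<dots> = 4 * ell (f p) (f' v)"
    using sum_partner[of "\<lambda>r. f p $ r * f' v $ r / rho (f p) r"]
    by (simp add: sum.distrib ell_def flip: sum_distrib_left del: times_divide_eq_right)
  finally show ?thesis by simp
qed

end

text \<open>Differentiation of \<open>ell (f q) (dird f q u) = 0\<close> expresses \<open>h\<close>
  by the explicit matrix \<open>S\<close>. The Gram matrix of the frame with respect to
  \<open>S\<close> is block diagonal, and its determinant relates the determinants of the frame and
  of \<open>h\<close> by a constant.\<close>

lemma circle_product_affine_hypersphere:
  fixes f :: "real ^ 'm \<Rightarrow> real ^ ('m::finite option)" and \<sigma> :: "'m option \<Rightarrow> 'm option"
  assumes \<sigma>: "pairing \<sigma>" and f: "immersion_on U f"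
    and prod: "\<And>q. q \<in> U \<Longrightarrow> (\<Prod>r\<in>UNIV. pairing.rho \<sigma> (f q) r) = 1"
  shows "\<exists>\<kappa>. affine_hypersphere_with U f (\<lambda>p. - \<kappa> *\<^sub>R f p) \<kappa> \<and>
    (\<forall>p\<in>U. \<forall>w. pairing.ell \<sigma> (f p) w = 0 \<longrightarrow> w \<in> tangent_space f p)"
proof -
  interpret pairing \<sigma> by (rule \<sigma>)
  \<comment> \<open>The value of \<open>ell x x\<close> on the hypersurface.\<close>
  define c where "c = real CARD('m option) / 2"
  \<comment> \<open>The determinant of \<open>gram\<close> yields the factor
    \<open>\<kappa> ^ (CARD('m) + 2) * c ^ (CARD('m) + 1)\<close> in the volume condition; this
    \<open>\<kappa>\<close> makes it 1.\<close>
  define \<kappa> where "\<kappa> = root (CARD('m) + 2) (1 / c ^ (CARD('m) + 1))"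
  have c: "c > 0" by (simp add: c_def)
  have "\<kappa> ^ (CARD('m) + 2) = 1 / c ^ (CARD('m) + 1)"
    unfolding \<kappa>_def by (rule real_root_pow_pos2) (use c in auto)
  then have \<kappa>: "\<kappa> > 0" "\<kappa> ^ (CARD('m) + 2) * c ^ (CARD('m) + 1) = 1"
    using c by (simp_all add: \<kappa>_def)
  define C where "C p = - \<kappa> *\<^sub>R f p" for p
  have U: "open U" and sf: "smooth_on U f" using f by (auto simp: immersion_on_def)
  have df: "(f has_derivative dird f p) (at p)" if "p \<in> U" for p
    by (rule smooth_on_has_derivative[OF sf that])
  have nz: "rho (f p) r \<noteq> 0" if "p \<in> U" for p r
    using prod[OF that] by (metis UNIV_I finite prod_zero_iff zero_neq_one)
  have tang: "ell (f p) (dird f p v) = 0" if "p \<in> U" for p v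
    by (rule ell_of_constant_product[OF df[OF that] U that prod])
  have ellC: "ell (f p) (C p) = - \<kappa> * c" if "p \<in> U" for p
    using linear_scale[OF linear_ell, of "f p" "- \<kappa>" "f p"] ell_self[OF nz[OF that]] by (simp add: C_def c_def)
  interpret transversal_immersion U f C
  proof
    show "transversal_on U f C"
      unfolding transversal_on_def
    proof (intro conjI ballI notI)
      show "smooth_on U C" unfolding C_def[abs_def] by (intro smooth_on_scaleR U sf smooth_on_const)
      fix p assume p: "p \<in> U" "C p \<in> tangent_space f p"
      then have "ell (f p) (C p) = 0" using tang by (auto simp: tangent_space_def)
      then show False using ellC[OF p(1)] \<kappa> c by simp
    qed
  qed (rule f)
  have metric: "(dird f p u) \<bullet> (S (f p) *v dird f p w) = \<kappa> * c * metric p w u" if p: "p \<in> U" for p u w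
  proof -
    let ?F = "\<lambda>q. dird f q u"
    have dF: "(?F has_derivative (\<lambda>w. hess p w u)) (at p)"
      unfolding hess_def by (rule smooth_on_has_derivative[OF smooth_on_frechet_derivative[OF sf] p])
    have "dird (\<lambda>q. ell (f q) (?F q)) p w = dird (\<lambda>q. 0) p w"
      using frechet_derivative_cong_open[OF U p, of "\<lambda>q. ell (f q) (?F q)" "\<lambda>q. 0"] tang by simp
    then have "ell (f p) (hess p w u) + dird f p u \<bullet> (S (f p) *v dird f p w) = 0"
      using frechet_derivative_eqI[OF ell_has_derivative[OF df[OF p] dF nz[OF p]], of w] by simp
    moreover have "ell (f p) (hess p w u) = - \<kappa> * c * metric p w u"
      unfolding hess_decomp[OF p] by (simp add: linear_add[OF linear_ell] linear_scale[OF linear_ell] tang[OF p] ellC[OF p])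
    ultimately show ?thesis by simp
  qed
  \<comment> \<open>The blocks decouple because \<open>S\<close> maps the position vector to minus
    the covector \<open>ell\<close>, which annihilates the tangent space.\<close>
  have gram: "frame f C p ** S (f p) ** transpose (frame f C p) = block_mat (- \<kappa>\<^sup>2 * c) ((\<kappa> * c) *\<^sub>R metric_matrix f C p)"
    if p: "p \<in> U" for p
  proof -
    have ent: "(frame f C p ** S (f p) ** transpose (frame f C p)) $ i $ j = frame f C p $ i \<bullet> (S (f p) *v frame f C p $ j)" for i j
    proof -
      have "(frame f C p ** S (f p) ** transpose (frame f C p)) $ i $ j = (frame f C p $ i v* S (f p)) \<bullet> frame f C p $ j"
        by (simp add: matrix_matrix_mult_def vector_matrix_mult_def transpose_def inner_vec_def mult.commute)
      then show ?thesis by (simp add: dot_vector_matrix)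
    qed
    have SC: "v \<bullet> (S (f p) *v C p) = \<kappa> * ell (f p) v" for v
    proof -
      have "S (f p) *v C p = - \<kappa> *\<^sub>R (S (f p) *v f p)"
        unfolding C_def by (simp only: matrix_vector_mult_scaleR)
      then show ?thesis using ell_S_self[OF nz[OF p], of v] by simp
    qed
    have SC': "C p \<bullet> (S (f p) *v dird f p u) = 0" for u
    proof -
      have "((\<lambda>q. ell (f q) (C p)) has_derivative (\<lambda>v. ell (f p) 0 + C p \<bullet> (S (f p) *v dird f p v))) (at p)"
        by (rule ell_has_derivative[OF df[OF p] has_derivative_const nz[OF p]])
      have sym: "transpose (S (f p)) = S (f p)"
      proof -
        have "S (f p) $ r $ s = S (f p) $ s $ r" for r s
          using fixfree invol by (auto simp: S_def)
        then show ?thesis by (simp add: vec_eq_iff transpose_def)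
      qed
      have "C p \<bullet> (S (f p) *v dird f p u) = dird f p u \<bullet> (S (f p) *v C p)"
        using symmetric_matrix_dot[OF sym, of "C p" "dird f p u"] by (simp add: dot_vector_matrix)
      then show ?thesis by (simp add: SC tang[OF p])
    qed
    show ?thesis
      unfolding vec_eq_iff[of "frame f C p ** _ ** _"] vec_eq_iff[of "(frame f C p ** _ ** _) $ _"] all_option ent
      by (simp add: frame_def block_mat_def SC SC' tang[OF p] ellC[OF p] metric[OF p] metric_matrix_def metric_sym[OF p] power2_eq_square)
  qed
  have det: "\<bar>det (metric_matrix f C p)\<bar> = (det (frame f C p))\<^sup>2" if p: "p \<in> U" for p
  proof -
    have "(\<kappa> * c) *\<^sub>R metric_matrix f C p = (\<chi> i. (\<kappa> * c) *s metric_matrix f C p $ i)" by (simp add: vec_eq_iff)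
    then have "det ((\<kappa> * c) *\<^sub>R metric_matrix f C p) = (\<kappa> * c) ^ CARD('m) * det (metric_matrix f C p)"
      using det_rows_mul[of "\<lambda>_. \<kappa> * c" "\<lambda>i. metric_matrix f C p $ i"] by simp
    then have "(det (frame f C p))\<^sup>2 * det (S (f p)) = (- \<kappa>\<^sup>2 * c) * ((\<kappa> * c) ^ CARD('m) * det (metric_matrix f C p))"
      using arg_cong[OF gram[OF p], of det] by (simp add: det_mul det_block_mat power2_eq_square mult_ac)
    then have "\<bar>(det (frame f C p))\<^sup>2 * det (S (f p))\<bar> = \<bar>(- \<kappa>\<^sup>2 * c) * ((\<kappa> * c) ^ CARD('m) * det (metric_matrix f C p))\<bar>"
      by simp
    then have "(det (frame f C p))\<^sup>2 = \<kappa> ^ (CARD('m) + 2) * c ^ (CARD('m) + 1) * \<bar>det (metric_matrix f C p)\<bar>"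
      using det_S[OF prod[OF p]] \<kappa>(1) c by (simp add: abs_mult power_mult_distrib power_add mult_ac power2_eq_square)
    then show ?thesis unfolding \<kappa>(2) by simp
  qed
  have "sphere_data \<kappa>"
    unfolding sphere_data_def
  proof (intro conjI ballI allI impI)
    fix p v assume p: "p \<in> U"
    show "dird C p v = - \<kappa> *\<^sub>R dird f p v"
      unfolding C_def[abs_def] by (rule frechet_derivative_eqI[OF bounded_linear.has_derivative[OF bounded_linear_scaleR_right df[OF p]]])
  next
    fix p u assume p: "p \<in> U" and u: "\<forall>v. metric p u v = 0"
    have "det (metric_matrix f C p) \<noteq> 0" using det[OF p] det_frame_nz[OF p] by auto
    then have inv: "invertible (metric_matrix f C p)" by (simp add: invertible_det_nz)
    have lin': "linear (\<lambda>u. metric p u v)" for v using bilinear_metric[OF p] by (simp add: bilinear_def)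
    have "(u v* metric_matrix f C p) $ j = metric p u (axis j 1)" for j
      using linear_as_sum_axis[OF lin', of u "axis j 1"]
      by (simp add: vector_matrix_mult_def metric_matrix_def mult.commute)
    then have "u v* metric_matrix f C p = 0" using u by (simp add: vec_eq_iff)
    then have "u v* metric_matrix f C p v* matrix_inv (metric_matrix f C p) = 0" by (simp add: vmat_simps)
    then show "u = 0" by (simp add: vector_matrix_mul_assoc matrix_inv_left_right[OF inv])
  next
    fix p assume "p \<in> U" then show "\<bar>det (metric_matrix f C p)\<bar> = (det (frame f C p))\<^sup>2" by (rule det)
  qed
  then have "affine_hypersphere_with U f C \<kappa>" by (rule affine_hypersphere_withI)
  moreover have "w \<in> tangent_space f p" if p: "p \<in> U" and w: "ell (f p) w = 0" for p w
  proof -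
    let ?v = "tangential_part f C p w" and ?a = "transversal_part f C p w"
    have d: "w = dird f p ?v + ?a *\<^sub>R C p" by (rule tangential_transversal_decomp[OF p])
    have "ell (f p) (dird f p ?v + ?a *\<^sub>R C p) = ?a * (- \<kappa> * c)"
      by (simp add: linear_add[OF linear_ell] linear_scale[OF linear_ell] tang[OF p] ellC[OF p])
    then have "?a * (- \<kappa> * c) = 0" using w d by metis
    then have "?a = 0" using \<kappa>(1) c by simp
    then have "w = dird f p ?v" using d by (metis add.right_neutral scaleR_zero_left)
    then show ?thesis unfolding tangent_space_def by (metis rangeI)
  qed
  ultimately show ?thesis unfolding C_def[abs_def] by blast
qed

section \<open>Transport of parametrizations by linear maps\<close>

lemma immersion_on_linear:
  fixes f :: "real ^ 'm \<Rightarrow> real ^ ('m::finite option)"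
  assumes f: "immersion_on U f" and L: "linear L" "inj L"
  shows "immersion_on U (L \<circ> f)"
proof -
  have U: "open U" and sf: "smooth_on U f" using f by (auto simp: immersion_on_def)
  have "smooth_on U (L \<circ> f)"
    using smooth_on_linear[OF U linear_conv_bounded_linear[THEN iffD1, OF L(1)] sf] by (simp add: o_def)
  moreover have "inj (frechet_derivative (L \<circ> f) (at p))" if p: "p \<in> U" for p
  proof -
    have "frechet_derivative (L \<circ> f) (at p) = L \<circ> frechet_derivative f (at p)"
      using frechet_derivative_compose_linear[OF L(1) smooth_on_differentiable[OF sf p]] by (simp add: fun_eq_iff)
    moreover have "inj (frechet_derivative f (at p))" using f p by (simp add: immersion_on_def)
    ultimately show ?thesis using inj_compose[OF L(2)] by simp
  qed
  ultimately show ?thesis using f by (simp add: immersion_on_def)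
qed

lemma local_parametrization_linear_image:
  assumes H: "local_parametrization H U f" and L: "linear L" "bij L"
  shows "local_parametrization (L ` H) U (L \<circ> f)"
proof -
  obtain g where g: "homeomorphism U (f ` U) f g" using H by (auto simp: local_parametrization_def)
  obtain W where W: "open W" "f ` U = H \<inter> W" using H by (auto simp: local_parametrization_def openin_open)
  have "L ` f ` U = L ` H \<inter> L ` W" unfolding W(2) using bij_is_inj[OF L(2)] by (simp add: image_Int)
  moreover have "open (L ` W)" by (rule open_surjective_linear_image[OF W(1) L(1) bij_is_surj[OF L(2)]])
  ultimately have "openin (top_of_set (L ` H)) ((L \<circ> f) ` U)" by (auto simp: openin_open image_comp)
  moreover have "homeomorphism (f ` U) (L ` f ` U) L (inv L)"
  proof -
    have "linear (inv L)" by (rule inj_linear_imp_inv_linear[OF L(1) bij_is_inj[OF L(2)]])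
    then show ?thesis
      using L bij_is_inj[OF L(2)] unfolding homeomorphism_def
      by (auto simp: image_image linear_continuous_on linear_conv_bounded_linear)
  qed
  then have "\<exists>g. homeomorphism U ((L \<circ> f) ` U) (L \<circ> f) g"
    using homeomorphism_compose[OF g] by (auto simp: image_comp)
  moreover have "immersion_on U (L \<circ> f)"
    using H immersion_on_linear[OF _ L(1) bij_is_inj[OF L(2)]] by (simp add: local_parametrization_def)
  ultimately show ?thesis by (simp add: local_parametrization_def)
qed

section \<open>Numbering of the circle coordinates\<close>

lemma prod_pairs:
  fixes h :: "nat \<Rightarrow> 'a::comm_monoid_mult"
  shows "(\<Prod>k=1..2*m. h k) = (\<Prod>i=1..m. h (2*i-1) * h (2*i))"
proof (induction m)
  case (Suc m)
  have "(\<Prod>k=1..2*Suc m. h k) = (\<Prod>k=1..2*m. h k) * h (2*m+1) * h (2*m+2)"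
    by (simp add: numeral_2_eq_2 mult.assoc)
  then show ?case using Suc.IH by (simp add: mult.assoc)
qed simp

lemma sum_pairs:
  fixes h :: "nat \<Rightarrow> 'a::comm_monoid_add"
  shows "(\<Sum>k=1..2*m. h k) = (\<Sum>i=1..m. h (2*i-1) + h (2*i))"
proof (induction m)
  case (Suc m)
  have "(\<Sum>k=1..2*Suc m. h k) = (\<Sum>k=1..2*m. h k) + h (2*m+1) + h (2*m+2)"
    by (simp add: numeral_2_eq_2 add.assoc)
  then show ?case using Suc.IH by (simp add: add.assoc)
qed simp

definition partner :: "nat \<Rightarrow> (nat \<Rightarrow> 'd) \<Rightarrow> 'd \<Rightarrow> 'd" where
  "partner n e r = (let k = the_inv_into {1..2*n+2} e r in e (if odd k then k + 1 else k - 1))"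

text \<open>The two coordinates of the \<open>i\<close>-th circle are read as the real and imaginary
  parts of a complex coordinate.\<close>

definition re_ix :: "(nat \<Rightarrow> 'd) \<Rightarrow> nat \<Rightarrow> 'd" where "re_ix e i = e (2*i-1)"

definition im_ix :: "(nat \<Rightarrow> 'd) \<Rightarrow> nat \<Rightarrow> 'd" where "im_ix e i = e (2*i)"

definition pairs :: "nat \<Rightarrow> nat set" where "pairs n = {1..n+1}"

context
  fixes n :: nat and e :: "nat \<Rightarrow> 'd::finite"
  assumes e: "bij_betw e {1..2*n+2} UNIV"
begin

lemma inv_e: "k \<in> {1..2*n+2} \<Longrightarrow> the_inv_into {1..2*n+2} e (e k) = k"
  using e by (intro the_inv_into_f_f) (auto simp: bij_betw_def)

lemma finite_pairs: "finite (pairs n)" "card (pairs n) = n + 1"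
  by (simp_all add: pairs_def)

lemma inv_ix:
  assumes "i \<in> pairs n"
  shows "the_inv_into {1..2*n+2} e (re_ix e i) = 2*i-1" "the_inv_into {1..2*n+2} e (im_ix e i) = 2*i"
  unfolding re_ix_def im_ix_def using assms by (intro inv_e; auto simp: pairs_def)+

lemma ix_eq_iff:
  assumes "i \<in> pairs n" "j \<in> pairs n"
  shows "re_ix e i = re_ix e j \<longleftrightarrow> i = j" "im_ix e i = im_ix e j \<longleftrightarrow> i = j" "re_ix e i \<noteq> im_ix e j" "im_ix e i \<noteq> re_ix e j"
proof -
  have i: "1 \<le> i" "1 \<le> j" using assms by (auto simp: pairs_def)
  show "re_ix e i = re_ix e j \<longleftrightarrow> i = j"
  proof
    assume "re_ix e i = re_ix e j"
    then have "2 * i - 1 = 2 * j - 1" using inv_ix(1)[OF assms(1)] inv_ix(1)[OF assms(2)] by simp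
    then show "i = j" using i by presburger
  qed simp
  show "im_ix e i = im_ix e j \<longleftrightarrow> i = j"
  proof
    assume eq: "im_ix e i = im_ix e j"
    have "2 * i = 2 * j" using inv_ix(2)[OF assms(1)] inv_ix(2)[OF assms(2)] unfolding eq by simp
    then show "i = j" by simp
  qed simp
  have "2 * i - 1 \<noteq> 2 * j" "2 * i \<noteq> 2 * j - 1" using i by presburger+
  note ne = this
  show "re_ix e i \<noteq> im_ix e j"
  proof
    assume h: "re_ix e i = im_ix e j"
    show False using inv_ix(1)[OF assms(1)] unfolding h inv_ix(2)[OF assms(2)] using ne(1) by simp
  qed
  show "im_ix e i \<noteq> re_ix e j"
  proof
    assume h: "im_ix e i = re_ix e j"
    show False using inv_ix(2)[OF assms(1)] unfolding h inv_ix(1)[OF assms(2)] using ne(2) by simp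
  qed
qed

lemma partner_ix:
  assumes "i \<in> pairs n"
  shows "partner n e (re_ix e i) = im_ix e i" "partner n e (im_ix e i) = re_ix e i"
proof -
  have "1 \<le> i" using assms by (auto simp: pairs_def)
  then have "odd (2 * i - 1)" "2 * i - 1 + 1 = 2 * i" by presburger+
  then show "partner n e (re_ix e i) = im_ix e i" "partner n e (im_ix e i) = re_ix e i"
    unfolding partner_def inv_ix[OF assms] Let_def by (simp_all add: re_ix_def im_ix_def)
qed

lemma ex_pair: obtains i where "i \<in> pairs n" "r = re_ix e i" | i where "i \<in> pairs n" "r = im_ix e i"
proof -
  obtain k where k: "k \<in> {1..2*n+2}" "r = e k" using e unfolding bij_betw_def by (metis UNIV_I imageE)
  show ?thesis
  proof (cases "odd k")
    case True
    then obtain j where "k = 2 * j + 1" by (rule oddE)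
    then show ?thesis using k that(1)[of "j + 1"] by (auto simp: pairs_def re_ix_def)
  next
    case False
    then obtain j where "k = 2 * j" by (auto elim: evenE)
    then show ?thesis using k that(2)[of j] by (auto simp: pairs_def im_ix_def)
  qed
qed

lemma circle_product_iff:
  "x \<in> circle_product_hypersurface n e \<longleftrightarrow> (\<Prod>i\<in>pairs n. (x $ re_ix e i)\<^sup>2 + (x $ im_ix e i)\<^sup>2) = 1"
  by (simp add: circle_product_hypersurface_def pairs_def re_ix_def im_ix_def)

lemma pairing_partner: "pairing (partner n e)"
proof
  fix r
  show "partner n e (partner n e r) = r"
    by (rule ex_pair[of r]) (simp_all add: partner_ix)
  show "partner n e r \<noteq> r"
  proof (rule ex_pair[of r])
    fix i assume i: "i \<in> pairs n" "r = re_ix e i"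
    then show ?thesis using ix_eq_iff[OF i(1) i(1)] by (simp add: partner_ix)
  next
    fix i assume i: "i \<in> pairs n" "r = im_ix e i"
    then show ?thesis using ix_eq_iff[OF i(1) i(1)] by (simp add: partner_ix)
  qed
qed

section \<open>The two structures on the product of circles\<close>

interpretation pairing "partner n e" by (rule pairing_partner)

lemma prod_e: "(\<Prod>r\<in>UNIV. g r) = (\<Prod>i\<in>pairs n. g (re_ix e i) * g (im_ix e i))" for g :: "'d \<Rightarrow> 'a::comm_monoid_mult"
  using prod.reindex_bij_betw[OF e, of g] prod_pairs[of "\<lambda>k. g (e k)" "n+1"] by (simp add: pairs_def re_ix_def im_ix_def)

lemma sum_e: "(\<Sum>r\<in>UNIV. g r) = (\<Sum>i\<in>pairs n. g (re_ix e i) + g (im_ix e i))" for g :: "'d \<Rightarrow> 'a::comm_monoid_add"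
  using sum.reindex_bij_betw[OF e, of g] sum_pairs[of "\<lambda>k. g (e k)" "n+1"] by (simp add: pairs_def re_ix_def im_ix_def)

lemma card_d: "CARD('d) = 2 * n + 2"
  using bij_betw_same_card[OF e] by simp

text \<open>Both coordinates of a circle have the same \<open>rho\<close>, so the product over all
  coordinates is the square of the defining one.\<close>

lemma prod_rho:
  assumes "x \<in> circle_product_hypersurface n e"
  shows "(\<Prod>r\<in>UNIV. rho x r) = 1"
proof -
  have "(\<Prod>r\<in>UNIV. rho x r) = (\<Prod>i\<in>pairs n. ((x $ re_ix e i)\<^sup>2 + (x $ im_ix e i)\<^sup>2) * ((x $ re_ix e i)\<^sup>2 + (x $ im_ix e i)\<^sup>2))"
    unfolding prod_e by (rule prod.cong) (simp_all add: rho_def partner_ix add.commute)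
  also have "\<dots> = 1" using assms by (simp add: prod.distrib circle_product_iff)
  finally show ?thesis .
qed

lemma rho_nonzero: "x \<in> circle_product_hypersurface n e \<Longrightarrow> rho x r \<noteq> 0"
  using prod_rho by (metis UNIV_I finite prod_zero_iff zero_neq_one)

lemma finite_axes: "axis r (1::real) \<in> Basis"
  by (simp add: axis_in_Basis_iff)

text \<open>\<open>J\<close> multiplies every complex coordinate by the imaginary unit. It is the
  velocity of a simultaneous rotation of the circles, which preserves each factor; accordingly the
  terms of \<open>ell x (J x)\<close> cancel within each pair.\<close>

lemma circle_product_complex:
  "\<exists>J L. (\<forall>c x. J (c *\<^sub>R x) = c *\<^sub>R J x) \<and> linear L \<and> bij L \<and> \<bar>det (matrix L)\<bar> = 1
     \<and> (\<forall>x. L (J x) = complex_structure n e (L x)) \<and> (\<forall>x. ell x (J x) = 0)"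
proof -
  define t where "t r = (if odd (the_inv_into {1..2*n+2} e r) then 1 else (-1::real))" for r
  have te: "t (re_ix e i) = 1" "t (im_ix e i) = -1" if "i \<in> pairs n" for i
  proof -
    have "odd (2*i-1)" using that by (auto simp: pairs_def)
    then show "t (re_ix e i) = 1" "t (im_ix e i) = -1" unfolding t_def inv_ix[OF that] by simp_all
  qed
  have tp: "t (partner n e r) = - t r" for r
    by (rule ex_pair[of r]) (simp_all add: partner_ix te)
  have tt: "t r * t r = 1" for r by (simp add: t_def)
  define J where "J x = (\<chi> r. - t r * x $ partner n e r)" for x :: "real^'d"
  have lin: "linear J" by (rule linearI) (simp_all add: J_def vec_eq_iff algebra_simps)
  have JJ: "J (J x) = - x" for x by (simp add: J_def vec_eq_iff tp invol tt flip: mult.assoc)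
  have Jax: "J (axis (re_ix e i) 1) = axis (im_ix e i) 1" if i: "i \<in> pairs n" for i
  proof -
    have "- t r * axis (re_ix e i) 1 $ partner n e r = axis (im_ix e i) 1 $ r" for r
    proof -
      have "partner n e r = re_ix e i \<longleftrightarrow> r = im_ix e i" using partner_ix[OF i] invol by metis
      then show ?thesis using te[OF i] by (auto simp: axis_def)
    qed
    then show ?thesis by (simp add: J_def vec_eq_iff)
  qed
  let ?I = "pairs n"
  define B where "B = (\<lambda>i. axis (re_ix e i) (1::real)) ` ?I"
  have ax: "axis a (1::real) = axis b 1 \<longleftrightarrow> a = b" for a b :: 'd by (simp add: axis_eq_axis)
  have inj: "inj_on (\<lambda>i. axis (re_ix e i) (1::real)) ?I"
  proof (rule inj_onI)
    fix i j assume "i \<in> ?I" "j \<in> ?I" "axis (re_ix e i) (1::real) = axis (re_ix e j) 1"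
    then show "i = j" using ix_eq_iff(1)[of i j] by (simp add: ax)
  qed
  have JB: "J ` B = (\<lambda>i. axis (im_ix e i) (1::real)) ` ?I"
    unfolding B_def image_image by (rule image_cong) (simp_all add: Jax)
  have "B \<inter> J ` B = {}"
  proof -
    have "re_ix e i \<noteq> im_ix e j" if "i \<in> ?I" "j \<in> ?I" for i j by (rule ix_eq_iff(3)[OF that])
    then show ?thesis unfolding JB unfolding B_def by (auto simp: ax)
  qed
  moreover have "independent (B \<union> J ` B)"
    by (rule independent_mono[OF independent_Basis]) (use finite_axes in \<open>auto simp: JB[unfolded B_def] B_def\<close>)
  moreover have "inj_on J B" using JJ by (metis inj_on_def neg_equal_iff_equal)
  moreover have "finite B" "card B = n + 1" using card_image[OF inj] by (simp_all add: B_def finite_pairs)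
  ultimately obtain L where L: "linear L" "bij L" "\<bar>det (matrix L)\<bar> = 1" "\<forall>x. L (J x) = complex_structure n e (L x)"
    using conjugate_complex_structure[OF e lin JJ, of B] by blast
  moreover have "ell x (J x) = 0" for x
  proof -
    let ?g = "\<lambda>r. x $ r * J x $ r / rho x r"
    have "?g (partner n e r) = - ?g r" for r
      by (simp add: J_def tp invol)
    then have "(\<Sum>r\<in>UNIV. ?g r) = - (\<Sum>r\<in>UNIV. ?g r)"
      using sum_partner[of ?g] by (simp add: sum_negf)
    then show ?thesis by (simp add: ell_def)
  qed
  ultimately show ?thesis using linear_scale[OF lin] by blast
qed

text \<open>\<open>J\<close> is 1 on the circles with odd number and -1 on the others, of which
  there are equally many as \<open>n + 1\<close> is even. It is the velocity of a scaling that
  expands the former and contracts the latter, which preserves the product.\<close>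

lemma circle_product_para_complex:
  assumes n: "odd n"
  shows "\<exists>J L. (\<forall>c x. J (c *\<^sub>R x) = c *\<^sub>R J x) \<and> linear L \<and> bij L \<and> \<bar>det (matrix L)\<bar> = 1
     \<and> (\<forall>x. L (J x) = para_complex_structure n e (L x))
     \<and> (\<forall>x\<in>circle_product_hypersurface n e. ell x (J x) = 0)"
proof -
  \<comment> \<open>Coordinates \<open>2 * i - 1\<close> and \<open>2 * i\<close> both belong to
    circle \<open>i\<close>, which is the quotient by 2 after adding 1.\<close>
  define t where "t r = (if odd ((the_inv_into {1..2*n+2} e r + 1) div 2) then 1 else (-1::real))" for r
  have te: "t (re_ix e i) = (if odd i then 1 else -1)" "t (im_ix e i) = (if odd i then 1 else -1)" if "i \<in> pairs n" for i
  proof -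
    have "(2*i-1+1) div 2 = i" "(2*i+1) div 2 = i" using that by (auto simp: pairs_def)
    then show "t (re_ix e i) = (if odd i then 1 else -1)" "t (im_ix e i) = (if odd i then 1 else -1)"
      unfolding t_def inv_ix[OF that] by simp_all
  qed
  have tp: "t (partner n e r) = t r" for r
    by (rule ex_pair[of r]) (simp_all add: partner_ix te)
  obtain m where m: "n + 1 = 2 * m" using n by (metis evenE odd_even_add odd_one)
  have "(\<Sum>r\<in>UNIV. t r) = (\<Sum>i\<in>pairs n. 2 * (if odd i then 1 else (-1::real)))"
    unfolding sum_e by (rule sum.cong) (simp_all add: te)
  also have "\<dots> = 0" unfolding pairs_def m sum_pairs by (rule sum.neutral) auto
  finally have sum0: "(\<Sum>r\<in>UNIV. t r) = 0" .
  define J where "J x = (\<chi> r. t r * x $ r)" for x :: "real^'d"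
  have lin: "linear J" by (rule linearI) (simp_all add: J_def vec_eq_iff algebra_simps)
  have Jax: "J (axis r 1) = t r *\<^sub>R axis r 1" for r by (simp add: J_def vec_eq_iff axis_def)
  define P where "P = {r. t r = 1}"
  have P: "t r = (if r \<in> P then 1 else -1)" for r by (auto simp: P_def t_def)
  have "(\<Sum>r\<in>UNIV. t r) = (\<Sum>r\<in>P. 1) + (\<Sum>r\<in>- P. -1)"
    unfolding P by (simp add: sum.If_cases)
  then have "real (card P) = real (card (- P))" using sum0 by simp
  moreover have "card P + card (- P) = 2 * n + 2"
    using card_Un_disjoint[of P "- P"] card_d by simp
  ultimately have cards: "card P = n + 1" "card (- P) = n + 1" by auto
  define B where "B = (\<lambda>r. axis r (1::real)) ` P"
  define B' where "B' = (\<lambda>r. axis r (1::real)) ` (- P)"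
  have inj: "inj_on (\<lambda>r. axis r (1::real) :: real^'d) Q" for Q by (auto simp: inj_on_def axis_eq_axis)
  have "J x = x" if "x \<in> B" for x using that by (auto simp: B_def Jax P)
  moreover have "J x = - x" if "x \<in> B'" for x using that by (auto simp: B'_def Jax P)
  moreover have "finite B" "finite B'" "card B = n + 1" "card B' = n + 1"
    using card_image[OF inj] cards by (simp_all add: B_def B'_def)
  moreover have "B \<inter> B' = {}" by (auto simp: B_def B'_def axis_eq_axis)
  moreover have "independent (B \<union> B')"
    by (rule independent_mono[OF independent_Basis]) (auto simp: B_def B'_def finite_axes)
  ultimately obtain L where L: "linear L" "bij L" "\<bar>det (matrix L)\<bar> = 1" "\<forall>x. L (J x) = para_complex_structure n e (L x)"
    using conjugate_para_complex_structure[OF e lin, of B B'] by blast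
  moreover have "ell x (J x) = 0" if "x \<in> circle_product_hypersurface n e" for x
    using half_sum[of x t, OF rho_nonzero[OF that] tp] sum0
    by (simp add: ell_def J_def power2_eq_square mult_ac)
  ultimately show ?thesis using linear_scale[OF lin] by blast
qed

lemma circle_product_nonempty: "circle_product_hypersurface n e \<noteq> {}"
proof -
  define x :: "real^'d" where "x = (\<chi> r. if odd (the_inv_into {1..2*n+2} e r) then 1 else 0)"
  have "x $ re_ix e i = 1" "x $ im_ix e i = 0" if "i \<in> pairs n" for i
  proof -
    have "odd (2*i-1)" using that by (auto simp: pairs_def)
    then show "x $ re_ix e i = 1" "x $ im_ix e i = 0" unfolding x_def vec_lambda_beta inv_ix[OF that] by simp_all
  qed
  then have "x \<in> circle_product_hypersurface n e" by (simp add: circle_product_iff)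
  then show ?thesis by blast
qed

end

text \<open>Near a point with \<open>x $ s \<noteq> 0\<close> the hypersurface is a graph over the other coordinates.\<close>
lemma circle_product_chart:
  fixes e :: "nat \<Rightarrow> 'm::finite option"
  assumes e: "bij_betw e {1..2*n+2} UNIV" and x: "x \<in> circle_product_hypersurface n e"
  shows "\<exists>U f. local_parametrization (circle_product_hypersurface n e) U f \<and> x \<in> f ` U"
proof -
  let ?H = "circle_product_hypersurface n e"
  have one: "1 \<in> pairs n" by (simp add: pairs_def)
  define q where "q i y = (y $ re_ix e i)\<^sup>2 + (y $ im_ix e i)\<^sup>2" for i and y :: "real ^ ('m option)"
  define Q where "Q y = (\<Prod>i\<in>pairs n - {1}. q i y)" for y
  have H: "y \<in> ?H \<longleftrightarrow> q 1 y * Q y = 1" for y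
    unfolding circle_product_iff[OF e] Q_def q_def[symmetric] by (subst prod.remove[OF finite_pairs(1)[OF e] one]) (rule refl)
  have "q 1 x \<noteq> 0" using x unfolding H by auto
  then have "x $ re_ix e 1 \<noteq> 0 \<or> x $ im_ix e 1 \<noteq> 0" by (auto simp: q_def)
  \<comment> \<open>\<open>s\<close> is the coordinate of the first circle to be solved for; which
    of the two it is depends on the point.\<close>
  then obtain s t where st: "{s, t} = {re_ix e 1, im_ix e 1}" "s \<noteq> t" "x $ s \<noteq> 0"
    using ix_eq_iff(3)[OF e one one] by (metis insert_commute)
  have q1: "q 1 y = (y $ s)\<^sup>2 + (y $ t)\<^sup>2" for y
    using st(1,2) by (auto simp: q_def doubleton_eq_iff)
  have s_notin: "re_ix e i \<noteq> s" "im_ix e i \<noteq> s" if "i \<in> pairs n - {1}" for i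
    using st(1) ix_eq_iff[OF e, of i 1] one that by (auto simp: doubleton_eq_iff)
  have Q_cong: "Q y = Q z" if "\<And>r. r \<noteq> s \<Longrightarrow> y $ r = z $ r" for y z
    unfolding Q_def q_def by (rule prod.cong) (use that s_notin in auto)
  have "card (UNIV :: 'm set) = card (UNIV - {s})" by (simp add: card_Diff_singleton)
  then obtain \<iota> where \<iota>: "bij_betw \<iota> (UNIV :: 'm set) (UNIV - {s})"
    using finite_same_card_bij[of "UNIV :: 'm set" "UNIV - {s}"] by auto
  define k where "k = inv_into UNIV \<iota>"
  have k\<iota>: "k (\<iota> j) = j" for j using \<iota> by (simp add: k_def bij_betw_def)
  have \<iota>k: "\<iota> (k r) = r" if "r \<noteq> s" for r
    using \<iota> that by (simp add: k_def bij_betw_inv_into_right[of \<iota> UNIV "UNIV - {s}"])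
  have \<iota>s: "\<iota> j \<noteq> s" for j using \<iota> by (auto simp: bij_betw_def)
  define pr where "pr y = (\<chi> j. y $ \<iota> j)" for y :: "real ^ 'm option"
  define emb where "emb u a = (\<chi> r. if r = s then a else u $ k r)" for u :: "real ^ 'm" and a
  have pr_emb: "pr (emb u a) = u" for u a by (simp add: pr_def emb_def vec_eq_iff \<iota>s k\<iota>)
  have emb_pr: "emb (pr y) (y $ s) = y" for y by (simp add: pr_def emb_def vec_eq_iff \<iota>k)
  have emb_s: "emb u a $ s = a" for u a by (simp add: emb_def)
  have emb_t: "emb u a $ t = u $ k t" for u a using st(2) by (simp add: emb_def)
  have blpr: "bounded_linear pr"
    by (rule linear_conv_bounded_linear[THEN iffD1], rule linearI) (simp_all add: pr_def vec_eq_iff)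
  define Q' where "Q' u = Q (emb u 0)" for u
  have Q_emb: "Q (emb u a) = Q' u" for u a unfolding Q'_def by (rule Q_cong) (simp add: emb_def)
  \<comment> \<open>The value that the equation prescribes for the square of the coordinate
    \<open>s\<close>; the other factors \<open>Q'\<close> do not involve it.\<close>
  define g where "g u = inverse (Q' u) - (u $ k t)\<^sup>2" for u
  have smooth_emb: "smooth_on V (\<lambda>u. emb u 0 $ r)" if "open V" for V r
    by (cases "r = s") (simp_all add: emb_def smooth_on_const smooth_on_vec_nth[OF that smooth_on_ident[OF that]])
  have smooth_Q': "smooth_on V Q'" if "open V" for V
    unfolding Q'_def[abs_def] Q_def q_def power2_eq_square
    by (intro smooth_on_prod smooth_on_add smooth_on_mult smooth_emb that)
  \<comment> \<open>The second condition is \<open>g u > 0\<close> multiplied by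
    \<open>Q' u\<close>, which avoids the division.\<close>
  define W where "W = {u. 0 < Q' u} \<inter> {u. (u $ k t)\<^sup>2 * Q' u < 1}"
  have "open W"
    unfolding W_def using smooth_on_continuous[OF smooth_Q'[OF open_UNIV]]
    by (intro open_Int open_Collect_less continuous_intros)
  moreover have "pr x \<in> W"
  proof -
    have Qx: "Q' (pr x) = Q x" using Q_emb[of "pr x" "x $ s"] by (simp add: emb_pr)
    have xt: "pr x $ k t = x $ t" using st(2) by (simp add: pr_def \<iota>k)
    have 1: "((x $ s)\<^sup>2 + (x $ t)\<^sup>2) * Q x = 1" using x unfolding H q1 .
    have pos: "(x $ s)\<^sup>2 > 0" using st(3) by simp
    then have "(x $ s)\<^sup>2 + (x $ t)\<^sup>2 > 0" by (simp add: add_pos_nonneg)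
    then have Q: "Q x > 0" using 1 by (metis zero_less_mult_pos zero_less_one)
    then have "(x $ t)\<^sup>2 * Q x < 1" using 1 mult_pos_pos[OF pos Q] by (simp add: distrib_right)
    then show ?thesis using Q by (simp add: W_def Qx xt)
  qed
  ultimately obtain r where r: "r > 0" "ball (pr x) r \<subseteq> W" using open_contains_ball by blast
  define U where "U = ball (pr x) r"
  have openU: "open U" by (simp add: U_def)
  have pos: "Q' u > 0" "g u > 0" if "u \<in> U" for u
  proof -
    have "u \<in> W" using that r by (auto simp: U_def)
    then show "Q' u > 0" "g u > 0" by (auto simp: W_def g_def field_simps)
  qed
  \<comment> \<open>The sign selects the branch of the square root that passes through
    \<open>x\<close>.\<close>
  define sg where "sg = sgn (x $ s)"
  have sg: "sg\<^sup>2 = 1" "sg * x $ s > 0" using st(3) by (simp_all add: sg_def sgn_if power2_eq_square)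
  define f where "f u = emb u (sg * sqrt (g u))" for u
  have smooth_g: "smooth_on U g"
    unfolding g_def[abs_def] power2_eq_square
    by (intro smooth_on_diff smooth_on_inverse smooth_on_mult smooth_Q' smooth_on_vec_nth[OF openU smooth_on_ident[OF openU]] openU)
      (use pos in force)
  have smooth_f: "smooth_on U f"
  proof (rule smooth_on_vecI[OF openU])
    fix i
    show "smooth_on U (\<lambda>u. f u $ i)"
    proof (cases "i = s")
      case True
      have "smooth_on U (\<lambda>u. sg * sqrt (g u))"
        by (intro smooth_on_mult smooth_on_const smooth_on_sqrt smooth_g openU pos)
      then show ?thesis by (simp add: f_def emb_def True)
    next
      case False
      then show ?thesis
        by (simp add: f_def emb_def smooth_on_vec_nth[OF openU smooth_on_ident[OF openU]])
    qed
  qed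
  have pr_f: "pr (f u) = u" for u by (simp add: f_def pr_emb)
  have fH: "f u \<in> ?H" if "u \<in> U" for u
    unfolding H q1 using pos[OF that] sg(1)
    by (simp add: f_def emb_s emb_t Q_emb power_mult_distrib) (simp add: g_def)
  let ?V = "{y. pr y \<in> U} \<inter> {y. 0 < sg * y $ s}"
  have image: "f ` U = ?H \<inter> ?V"
  proof (intro equalityI subsetI)
    fix y assume "y \<in> f ` U"
    then obtain u where u: "u \<in> U" "y = f u" by blast
    have "sg * (sg * sqrt (g u)) > 0" using sg(1) pos[OF u(1)] by (simp add: power2_eq_square flip: mult.assoc)
    then show "y \<in> ?H \<inter> ?V" using u fH pr_f by (simp add: f_def emb_s)
  next
    fix y assume y: "y \<in> ?H \<inter> ?V"
    let ?u = "pr y"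
    have u: "?u \<in> U" using y by auto
    have Qy: "Q' ?u = Q y" using Q_emb[of ?u "y $ s"] by (simp add: emb_pr)
    have "((y $ s)\<^sup>2 + (y $ t)\<^sup>2) * Q y = 1" using y by (simp only: H q1 Int_iff)
    then have "(y $ s)\<^sup>2 + (y $ t)\<^sup>2 = inverse (Q' ?u)" using pos(1)[OF u] Qy by (simp add: field_simps)
    then have "g ?u = (y $ s)\<^sup>2" using st(2) by (simp add: g_def pr_def \<iota>k)
    then have "sg * sqrt (g ?u) = sg * \<bar>y $ s\<bar>" by simp
    also have "\<dots> = y $ s"
      using y by (auto simp: sg_def sgn_if zero_less_mult_iff split: if_splits)
    finally have "f ?u = y" by (simp add: f_def emb_pr)
    then show "y \<in> f ` U" using u by (metis imageI)
  qed
  have "open ?V"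
  proof (rule open_Int)
    have "open (pr -` U)" by (rule open_vimage[OF openU linear_continuous_on[OF blpr]])
    then show "open {y. pr y \<in> U}" by (simp add: vimage_def)
    show "open {y. 0 < sg * y $ s}" by (intro open_Collect_less continuous_intros)
  qed
  then have "openin (top_of_set ?H) (f ` U)" unfolding image by (rule openin_open_Int)
  moreover have "homeomorphism U (f ` U) f pr"
    unfolding homeomorphism_def
    by (auto simp: pr_f image_image smooth_on_continuous[OF smooth_f] linear_continuous_on[OF blpr])
  moreover have "immersion_on U f"
  proof -
    \<comment> \<open>The projection \<open>pr\<close> is a linear left inverse of \<open>f\<close>,
      hence also of its derivative.\<close>
    have "inj (frechet_derivative f (at p))" if p: "p \<in> U" for p
    proof (rule inj_on_inverseI)
      fix v
      have "pr (frechet_derivative f (at p) v) = frechet_derivative (\<lambda>q. pr (f q)) (at p) v"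
        by (rule frechet_derivative_linear[OF blpr smooth_on_differentiable[OF smooth_f p], symmetric])
      then show "pr (frechet_derivative f (at p) v) = v" by (simp add: pr_f)
    qed
    then show ?thesis using openU smooth_f r(1) by (simp add: immersion_on_def U_def)
  qed
  moreover have "x \<in> f ` U"
    unfolding image using x r(1) sg(2) by (simp add: U_def)
  ultimately show ?thesis unfolding local_parametrization_def by blast
qed

text \<open>An arbitrary parametrization of the image is pulled back by the inverse of
  \<open>L\<close>, so that its Blaschke field is a multiple of the position vector and the kernel
  of \<open>ell\<close> is its tangent space; \<open>L\<close> then carries the tangency of
  \<open>J\<close> to that of \<open>J0\<close>.\<close>

lemma circle_product_structure_tangent:
  fixes e :: "nat \<Rightarrow> 'm::finite option"
  assumes e: "bij_betw e {1..2*n+2} UNIV"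
    and L: "linear L" "bij L" "\<bar>det (matrix L)\<bar> = 1" "\<And>x. L (J x) = J0 (L x)"
    and J: "\<And>c x. J (c *\<^sub>R x) = c *\<^sub>R J x"
      "\<And>x. x \<in> circle_product_hypersurface n e \<Longrightarrow> pairing.ell (partner n e) x (J x) = 0"
  shows "structure_tangent_hypersurface J0 (L ` circle_product_hypersurface n e)"
  unfolding structure_tangent_hypersurface_def
proof (intro conjI allI impI ballI)
  let ?H = "circle_product_hypersurface n e"
  show "L ` ?H \<noteq> {}" using circle_product_nonempty[OF e] by simp
  fix y assume "y \<in> L ` ?H"
  then obtain x where x: "x \<in> ?H" "y = L x" by blast
  then obtain U f where f: "local_parametrization ?H U f" "x \<in> f ` U" using circle_product_chart[OF e] by blast
  have "local_parametrization (L ` ?H) U (L \<circ> f)" by (rule local_parametrization_linear_image[OF f(1) L(1,2)])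
  then show "\<exists>U f. local_parametrization (L ` ?H) U f \<and> y \<in> f ` U" using f(2) x(2) by (metis image_comp imageI)
next
  let ?H = "circle_product_hypersurface n e"
  interpret pairing "partner n e" by (rule pairing_partner[OF e])
  fix U and f :: "real ^ 'm \<Rightarrow> real ^ 'm option"
  assume f: "local_parametrization (L ` ?H) U f"
  then have imm: "immersion_on U f" by (simp add: local_parametrization_def)
  have injL: "inj L" and surjL: "surj L" using L(2) by (auto simp: bij_def)
  have linv: "linear (inv L)" "inj (inv L)"
    using inj_linear_imp_inv_linear[OF L(1) injL] bij_imp_bij_inv[OF L(2)] by (auto simp: bij_def)
  define g where "g = inv L \<circ> f"
  have Lg: "L \<circ> g = f" by (simp add: g_def fun_eq_iff surj_f_inv_f[OF surjL])
  have gH: "g q \<in> ?H" if "q \<in> U" for q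
  proof -
    have "f q \<in> L ` ?H"
      using f that by (auto simp: local_parametrization_def openin_open)
    then show ?thesis by (auto simp: g_def inv_f_f[OF injL])
  qed
  have g: "immersion_on U g" unfolding g_def by (rule immersion_on_linear[OF imm linv])
  have "\<exists>\<kappa>. affine_hypersphere_with U g (\<lambda>p. - \<kappa> *\<^sub>R g p) \<kappa> \<and> (\<forall>p\<in>U. \<forall>w. ell (g p) w = 0 \<longrightarrow> w \<in> tangent_space g p)"
    by (rule circle_product_affine_hypersphere[OF pairing_partner[OF e] g]) (rule prod_rho[OF e gH])
  then obtain \<kappa> where \<kappa>: "affine_hypersphere_with U g (\<lambda>p. - \<kappa> *\<^sub>R g p) \<kappa>"
    "\<And>p w. p \<in> U \<Longrightarrow> ell (g p) w = 0 \<Longrightarrow> w \<in> tangent_space g p" by blast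
  have "structure_tangent J0 U (L \<circ> g)"
  proof (rule structure_tangent_linear_image[OF \<kappa>(1) _ _ _ subset_refl L(1-3)])
    show "open U" "connected U" "U \<noteq> {}" using imm by (auto simp: immersion_on_def)
    fix p assume p: "p \<in> U"
    have "ell (g p) (J (- \<kappa> *\<^sub>R g p)) = 0"
      unfolding J(1) linear_scale[OF linear_ell] J(2)[OF gH[OF p]] by simp
    then obtain v where "J (- \<kappa> *\<^sub>R g p) = dird g p v" using \<kappa>(2)[OF p] by (auto simp: tangent_space_def)
    then show "\<exists>v. J0 (L (- \<kappa> *\<^sub>R g p)) = L (dird g p v)" using L(4) by metis
  qed
  then show "structure_tangent J0 U f" unfolding Lg .
qed

theorem mainTheorem16:
  fixes n :: nat and e :: "nat \<Rightarrow> 'm::finite option"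
  assumes "n \<ge> 1"
    and "CARD('m) = 2 * n + 1"
    and "bij_betw e {1..2*n+2} UNIV"
  shows "(\<forall>U (f :: real ^ 'm \<Rightarrow> real ^ ('m option)).
            proper_flat_affine_hypersphere U f \<longrightarrow>
            (\<forall>p\<in>U. \<exists>V A. open V \<and> connected V \<and> p \<in> V \<and> V \<subseteq> U \<and> affine_transformation A \<and>
               (structure_tangent (para_complex_structure n e) V (A \<circ> f) \<or>
                structure_tangent (complex_structure n e) V (A \<circ> f))))
       \<and> (odd n \<longrightarrow>
            (\<exists>A. affine_transformation A \<and>
               structure_tangent_hypersurface (para_complex_structure n e)
                 (A ` circle_product_hypersurface n e)) \<and>
            (\<exists>A. affine_transformation A \<and>
               structure_tangent_hypersurface (complex_structure n e)
                 (A ` circle_product_hypersurface n e)))"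
proof (intro conjI impI allI ballI)
  fix U and f :: "real ^ 'm \<Rightarrow> real ^ ('m option)" and p
  assume "proper_flat_affine_hypersphere U f" "p \<in> U"
  then show "\<exists>V A. open V \<and> connected V \<and> p \<in> V \<and> V \<subseteq> U \<and> affine_transformation A \<and>
     (structure_tangent (para_complex_structure n e) V (A \<circ> f) \<or>
      structure_tangent (complex_structure n e) V (A \<circ> f))"
    by (rule proper_flat_affine_hypersphere_structure_tangent[OF assms])
next
  assume "odd n"
  from circle_product_para_complex[OF assms(3) this] obtain J L where
    J: "\<And>c x. J (c *\<^sub>R x) = c *\<^sub>R J x" "\<And>x. x \<in> circle_product_hypersurface n e \<Longrightarrow> pairing.ell (partner n e) x (J x) = 0"
    and L: "linear L" "bij L" "\<bar>det (matrix L)\<bar> = 1" "\<And>x. L (J x) = para_complex_structure n e (L x)"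
    by blast
  show "\<exists>A. affine_transformation A \<and>
     structure_tangent_hypersurface (para_complex_structure n e) (A ` circle_product_hypersurface n e)"
    using circle_product_structure_tangent[OF assms(3) L J] affine_transformation_linear[OF L(1,2)] by blast
next
  from circle_product_complex[OF assms(3)] obtain J L where
    J: "\<And>c x. J (c *\<^sub>R x) = c *\<^sub>R J x" "\<And>x. x \<in> circle_product_hypersurface n e \<Longrightarrow> pairing.ell (partner n e) x (J x) = 0"
    and L: "linear L" "bij L" "\<bar>det (matrix L)\<bar> = 1" "\<And>x. L (J x) = complex_structure n e (L x)"
    by blast
  show "\<exists>A. affine_transformation A \<and>
     structure_tangent_hypersurface (complex_structure n e) (A ` circle_product_hypersurface n e)"
    using circle_product_structure_tangent[OF assms(3) L J] affine_transformation_linear[OF L(1,2)] by blast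
qed

end
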